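(* Let $(M,\Omega)$ be a connected symplectic $2$-manifold and let $D$ be a symplectic connection on $(M,\Omega)$ with parallel Ricci tensor $\mathscr{R}_{ij}$. Suppose $Z_i$ is a nontrivial one-form satisfying $D_{(i}Z_{j)}=0$. Let $\gamma=D_pZ^p$. Then $$\nu=\gamma^2+4Z^aZ^b\mathscr{R}_{ab}$$ is constant. On $\hat M=\{p\in M:\gamma(p)^2\neq\nu\}$ define $\Gamma_{ijk}=(\nu-\gamma^2)^{-1}Z_iZ_jZ_k$. On $\hat M$, for $t\in\mathbb{R}$, the symplectic connection $\nabla(t)=D+t\Gamma_{ij}{}^k$ with Ricci tensor $R(t)_{ij}$ satisfies $$R(t)_{ij}=\mathscr{R}_{ij}+t\gamma(\nu-\gamma^2)^{-1}Z_iZ_j,$$ $$\nabla(t)_{(i}R(t)_{jk)}=-4t\nu(\nu-\gamma^2)^{-2}Z_{(i}Z_j\mathscr{R}_{k)p}Z^p,$$ $$\rho(\nabla(t))_i=\tfrac12t(\nu-3\gamma^2)(\nu-\gamma^2)^{-1}Z_i,\qquad \mathcal{K}(\nabla(t))=-\tfrac34t\gamma,\qquad \tau(\nabla(t))=\tfrac{3}{16}t^2\nu,$$ where $\tau(\nabla)=\mathcal{K}(\nabla)^2+\rho(\nabla)^i\,d\mathcal{K}(\nabla)_i$. Moreover, $\mathcal{H}_{\nabla(t)}(\gamma)=0$, so $\nabla(t)$ is critical. If $4\nu(\nu-\gamma^2)^{-2}Z_{(i}Z_j\mathscr{R}_{k)p}Z^p$ is nonzero somewhere on $\hat M$, then $\nabla(t)$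 is not preferred for $t\neq0$. Finally, the Jacobi operator satisfies $\mathcal{J}_{\nabla(t)}(\Gamma)=0$ for all $t\in\mathbb{R}$.
   Context: Abstract index notation is used; parentheses denote complete symmetrization (with averaging factor). Indices are raised and lowered by $X_i=X^p\Omega_{pi}$, $X^i=\Omega^{ip}X_p$, where $\Omega^{ip}\Omega_{pj}=-\delta_j{}^i$. A symplectic connection is a torsion-free affine connection $\nabla$ with $\nabla\Omega=0$; these form an affine space modeled on $\Gamma(S^3(T^*M))$ ($D+t\Gamma_{ij}{}^k$ has difference tensor $t\Gamma_{ij}{}^k=t\,\Omega^{kp}\Gamma_{ijp}$ with $D$). Curvature: $\nabla_i\nabla_jX^k-\nabla_j\nabla_iX^k=R_{ijp}{}^kX^p$, $R_{ij}=R_{pij}{}^p$, $R_{ijkl}=R_{ijk}{}^p\Omega_{pl}$. The curvature one-form is $\rho(\nabla)_i=2\nabla^pR_{ip}$ and $\mathcal{K}(\nabla)=\nabla^i\nabla^jR_{ij}-\tfrac12R^{ij}R_{ij}+\tfrac14R^{ijkl}R_{ijkl}$ (in dimension $2$ this equals $\tfrac12\nabla^i\rho_i$). $\nabla$ is preferred if $\nabla_{(i}R_{jk)}=0$. $\nabla$ is critical if it is a critical point, with respect to compactly supported variations through symplectic connections, of $\int\mathcal{K}(\nabla)^2\,\Omega$ (on noncompact manifolds: the derivative at $t=0$ of the integral of $\mathcal{K}(\nabla+t\Pi)^2-\mathcal{K}(\nabla)^2$ vanishes for all compactly supported $\Pi$); equivalently $\mathcal{H}_\nabla(\mathcal{K}(\nabla))=0$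 with $\mathcal{H}$ as follows. The Hamiltonian vector field is $\mathsf{H}_f^i=\Omega^{pi}df_p$, $(\mathfrak{L}_X\nabla)_{ij}{}^k=\nabla_i\nabla_jX^k+X^pR_{pij}{}^k$, and $\mathcal{H}_\nabla(f)\in\Gamma(S^3(T^*M))$ is $\mathcal{H}_\nabla(f)_{ijk}=(\mathfrak{L}_{\mathsf{H}_f}\nabla)_{ijk}$. Its formal adjoint $\mathcal{H}_\nabla^*:\Gamma(S^3(T^*M))\to C^\infty(M)$ is determined by $\int f\,\mathcal{H}^*_\nabla(\Pi)\,\Omega=\int\mathcal{H}_\nabla(f)_{ijk}\Pi^{ijk}\,\Omega$ for compactly supported $f$. The Jacobi operator is $\mathcal{J}_\nabla(\alpha)=\mathcal{H}_\nabla\mathcal{H}_\nabla^*(\alpha)+\mathfrak{L}_{\mathsf{H}_{\mathcal{K}(\nabla)}}\alpha$ for $\alpha\in\Gamma(S^3(T^*M))$. *)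

theory Defs
  imports "HOL-Analysis.Analysis"
begin

section \<open>Smooth functions on open subsets of the coordinate plane\<close>

definition partial :: "2 \<Rightarrow> (real^2 \<Rightarrow> real) \<Rightarrow> real^2 \<Rightarrow> real" where
  "partial i f x = frechet_derivative f (at x) (axis i 1)"

primrec Ck_on :: "nat \<Rightarrow> (real^2 \<Rightarrow> real) \<Rightarrow> (real^2) set \<Rightarrow> bool" where
  "Ck_on 0 f S \<longleftrightarrow> continuous_on S f"
| "Ck_on (Suc k) f S \<longleftrightarrow> f differentiable_on S \<and> (\<forall>i. Ck_on k (partial i f) S)"

text \<open>Only used for open \<open>S\<close>, where it is the class of infinitely differentiable functions.\<close>

definition smooth_on :: "(real^2 \<Rightarrow> real) \<Rightarrow> (real^2) set \<Rightarrow> bool" where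
  "smooth_on f S \<longleftrightarrow> (\<forall>k. Ck_on k f S)"


section \<open>Smooth surfaces\<close>

text \<open>A chart is a pair of its domain and its coordinate map; the coordinate map is irrelevant
  outside the domain.\<close>

type_synonym 'a chart = "'a set \<times> ('a \<Rightarrow> real^2)"

definition chart_inv :: "'a chart \<Rightarrow> real^2 \<Rightarrow> 'a" where
  "chart_inv c = inv_into (fst c) (snd c)"

text \<open>The surface \<open>M\<close> is an open subset of a Hausdorff, second countable type. The atlas
  need not be maximal.\<close>

definition smooth_surface ::
    "'a::{t2_space,second_countable_topology} set \<Rightarrow> 'a chart set \<Rightarrow> bool" where
  "smooth_surface M A \<longleftrightarrow>
     M = (\<Union>c\<in>A. fst c) \<and>
     (\<forall>c\<in>A. open (fst c) \<and> open (snd c ` fst c) \<and>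
        homeomorphism (fst c) (snd c ` fst c) (snd c) (chart_inv c)) \<and>
     (\<forall>c\<in>A. \<forall>d\<in>A. \<forall>i.
        smooth_on (\<lambda>x. snd d (chart_inv c x) $ i) (snd c ` (fst c \<inter> fst d)))"

text \<open>\<open>pd c i f p\<close> is the partial derivative of \<open>f\<close> at the point \<open>p\<close> with respect to the
  \<open>i\<close>-th coordinate of the chart \<open>c\<close>, and \<open>jac c d p a i\<close> is the derivative of
  the \<open>a\<close>-th coordinate of \<open>d\<close> with respect to the \<open>i\<close>-th coordinate of \<open>c\<close>.\<close>

definition pd :: "'a chart \<Rightarrow> 2 \<Rightarrow> ('a \<Rightarrow> real) \<Rightarrow> 'a \<Rightarrow> real" where
  "pd c i f p = partial i (\<lambda>x. f (chart_inv c x)) (snd c p)"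

definition jac :: "'a chart \<Rightarrow> 'a chart \<Rightarrow> 'a \<Rightarrow> 2 \<Rightarrow> 2 \<Rightarrow> real" where
  "jac c d p a i = pd c i (\<lambda>q. snd d q $ a) p"

definition smooth_fun ::
    "'a chart set \<Rightarrow> 'a set \<Rightarrow> ('a \<Rightarrow> real) \<Rightarrow> bool" where
  "smooth_fun A W f \<longleftrightarrow>
     (\<forall>c\<in>A. smooth_on (\<lambda>x. f (chart_inv c x)) (snd c ` (fst c \<inter> W)))"


section \<open>Tensor fields and affine connections\<close>

text \<open>A tensor field is given by its components in every chart: \<open>T c p us ls\<close> is the component
  at the point \<open>p\<close> in the chart \<open>c\<close> with upper indices \<open>us\<close> and lower indices \<open>ls\<close>.
  All notions below are relative to an open subset \<open>W\<close> of the surface, and the values of \<open>T c p\<close>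
  for \<open>p\<close> outside \<open>W\<close> or outside the domain of \<open>c\<close> are irrelevant.\<close>

type_synonym 'a tensor = "'a chart \<Rightarrow> 'a \<Rightarrow> 2 list \<Rightarrow> 2 list \<Rightarrow> real"

definition idx :: "nat \<Rightarrow> 2 list set" where
  "idx n = {is. length is = n}"

definition tensor_field ::
    "'a chart set \<Rightarrow> 'a set \<Rightarrow> nat \<Rightarrow> nat \<Rightarrow> 'a tensor \<Rightarrow> bool" where
  "tensor_field A W r s T \<longleftrightarrow>
     (\<forall>c\<in>A. \<forall>us\<in>idx r. \<forall>ls\<in>idx s.
        smooth_on (\<lambda>x. T c (chart_inv c x) us ls) (snd c ` (fst c \<inter> W))) \<and>
     (\<forall>c\<in>A. \<forall>d\<in>A. \<forall>p\<in>fst c \<inter> fst d \<inter> W. \<forall>us\<in>idx r. \<forall>ls\<in>idx s.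
        T c p us ls =
          (\<Sum>vs\<in>idx r. \<Sum>ms\<in>idx s.
             (\<Prod>n<r. jac d c p (us ! n) (vs ! n)) * (\<Prod>n<s. jac c d p (ms ! n) (ls ! n)) *
             T d p vs ms))"

text \<open>\<open>scalar A F\<close> is the function on the surface whose expression in every chart is \<open>F\<close>, for a
  quantity \<open>F\<close> that is computed in charts but does not depend on the chart.\<close>

definition scalar :: "'a chart set \<Rightarrow> ('a chart \<Rightarrow> 'a \<Rightarrow> real) \<Rightarrow> 'a \<Rightarrow> real" where
  "scalar A F p = F (SOME c. c \<in> A \<and> p \<in> fst c) p"

text \<open>Complete symmetrization over the lower indices, with averaging factor.\<close>

definition symmetrize :: "'a tensor \<Rightarrow> 'a tensor" where
  "symmetrize T c p us ls =
     (\<Sum>\<pi> | \<pi> permutes {..<length ls}. T c p us (permute_list \<pi> ls)) / fact (length ls)"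

text \<open>The smooth sections of \<open>S\<^sup>3(T\<^sup>*M)\<close> over \<open>W\<close>.\<close>

definition sym3_field :: "'a chart set \<Rightarrow> 'a set \<Rightarrow> 'a tensor \<Rightarrow> bool" where
  "sym3_field A W \<Phi> \<longleftrightarrow>
     tensor_field A W 0 3 \<Phi> \<and>
     (\<forall>c\<in>A. \<forall>p\<in>fst c \<inter> W. \<forall>ls\<in>idx 3. \<forall>\<pi>.
        \<pi> permutes {..<3} \<longrightarrow> \<Phi> c p [] (permute_list \<pi> ls) = \<Phi> c p [] ls)"

text \<open>A connection is given by its Christoffel symbols in every chart: \<open>G c p i j k\<close> is
  \<open>\<Gamma>\<^sub>i\<^sub>j\<^sup>k\<close> in the convention \<open>\<nabla>\<^sub>i X\<^sup>k = \<partial>\<^sub>i X\<^sup>k + \<Gamma>\<^sub>i\<^sub>j\<^sup>k X\<^sup>j\<close>.\<close>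

type_synonym 'a connection = "'a chart \<Rightarrow> 'a \<Rightarrow> 2 \<Rightarrow> 2 \<Rightarrow> 2 \<Rightarrow> real"

definition affine_connection ::
    "'a chart set \<Rightarrow> 'a set \<Rightarrow> 'a connection \<Rightarrow> bool" where
  "affine_connection A W G \<longleftrightarrow>
     (\<forall>c\<in>A. \<forall>i j k.
        smooth_on (\<lambda>x. G c (chart_inv c x) i j k) (snd c ` (fst c \<inter> W))) \<and>
     (\<forall>c\<in>A. \<forall>d\<in>A. \<forall>p\<in>fst c \<inter> fst d \<inter> W. \<forall>i j l.
        (\<Sum>k\<in>UNIV. G c p i j k * jac c d p l k) =
          pd c i (\<lambda>q. jac c d q l j) p +
          (\<Sum>a\<in>UNIV. \<Sum>b\<in>UNIV. jac c d p a i * jac c d p b j * G d p a b l))"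

text \<open>The covariant derivative; the index of differentiation is the first lower index, so that
  \<open>\<nabla>\<^sub>i \<nabla>\<^sub>j X\<^sup>k\<close> is \<open>cov G (cov G X) c p [k] [i, j]\<close>.\<close>

fun cov :: "'a connection \<Rightarrow> 'a tensor \<Rightarrow> 'a tensor" where
  "cov G T c p us (i # ls) =
     pd c i (\<lambda>q. T c q us ls) p
     + (\<Sum>n<length us. \<Sum>m\<in>UNIV. G c p i m (us ! n) * T c p (us[n := m]) ls)
     - (\<Sum>n<length ls. \<Sum>m\<in>UNIV. G c p i (ls ! n) m * T c p us (ls[n := m]))"
| "cov G T c p us [] = 0"

text \<open>\<open>R\<^sub>i\<^sub>j\<^sub>q\<^sup>k\<close> with \<open>\<nabla>\<^sub>i \<nabla>\<^sub>j X\<^sup>k - \<nabla>\<^sub>j \<nabla>\<^sub>i X\<^sup>k = R\<^sub>i\<^sub>j\<^sub>q\<^sup>k X\<^sup>q\<close> for a torsion-free connection: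
  the left-hand side is evaluated at the coordinate vector field \<open>X = \<partial>\<^sub>q\<close>, whose components in
  the chart are constant.\<close>

definition coord_field :: "2 \<Rightarrow> 'a tensor" where
  "coord_field q c p us ls = (if us = [q] then 1 else 0)"

definition riem :: "'a connection \<Rightarrow> 'a chart \<Rightarrow> 'a \<Rightarrow> 2 \<Rightarrow> 2 \<Rightarrow> 2 \<Rightarrow> 2 \<Rightarrow> real" where
  "riem G c p i j q k =
     cov G (cov G (coord_field q)) c p [k] [i, j] - cov G (cov G (coord_field q)) c p [k] [j, i]"

definition ricci :: "'a connection \<Rightarrow> 'a tensor" where
  "ricci G c p us ls = (\<Sum>q\<in>UNIV. riem G c p q (ls ! 0) (ls ! 1) q)"

definition lie_deriv :: "'a tensor \<Rightarrow> 'a tensor \<Rightarrow> 'a tensor" where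
  "lie_deriv X T c p us ls =
     (\<Sum>q\<in>UNIV. X c p [q] [] * pd c q (\<lambda>r. T c r us ls) p)
     + (\<Sum>n<length ls. \<Sum>q\<in>UNIV. pd c (ls ! n) (\<lambda>r. X c r [q] []) p * T c p us (ls[n := q]))
     - (\<Sum>n<length us. \<Sum>q\<in>UNIV. pd c q (\<lambda>r. X c r [us ! n] []) p * T c p (us[n := q]) ls)"

text \<open>\<open>(L\<^sub>X\<nabla>)\<^sub>i\<^sub>j\<^sup>k\<close>\<close>

definition lie_conn ::
    "'a connection \<Rightarrow> 'a tensor \<Rightarrow> 'a chart \<Rightarrow> 'a \<Rightarrow> 2 \<Rightarrow> 2 \<Rightarrow> 2 \<Rightarrow> real" where
  "lie_conn G X c p i j k =
     cov G (cov G X) c p [k] [i, j] + (\<Sum>q\<in>UNIV. X c p [q] [] * riem G c p q i j k)"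


section \<open>Symplectic structures and symplectic connections\<close>

text \<open>\<open>\<Omega>\<^sub>i\<^sub>j\<close> is \<open>\<Omega> c p [] [i, j]\<close>.\<close>

definition symplectic_form :: "'a chart set \<Rightarrow> 'a set \<Rightarrow> 'a tensor \<Rightarrow> bool" where
  "symplectic_form A W \<Omega> \<longleftrightarrow>
     tensor_field A W 0 2 \<Omega> \<and>
     (\<forall>c\<in>A. \<forall>p\<in>fst c \<inter> W.
        (\<forall>i j. \<Omega> c p [] [i, j] = - \<Omega> c p [] [j, i]) \<and>
        invertible (\<chi> i j. \<Omega> c p [] [i, j]) \<and>
        (\<forall>i j k. pd c i (\<lambda>q. \<Omega> c q [] [j, k]) p + pd c j (\<lambda>q. \<Omega> c q [] [k, i]) p
                 + pd c k (\<lambda>q. \<Omega> c q [] [i, j]) p = 0))"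

text \<open>\<open>\<Omega>\<^sup>i\<^sup>j\<close>, determined by \<open>\<Omega>\<^sup>i\<^sup>p \<Omega>\<^sub>p\<^sub>j = - \<delta>\<^sub>j\<^sup>i\<close>.\<close>

definition up :: "'a tensor \<Rightarrow> 'a chart \<Rightarrow> 'a \<Rightarrow> 2 \<Rightarrow> 2 \<Rightarrow> real" where
  "up \<Omega> c p i j = - (matrix_inv (\<chi> a b. \<Omega> c p [] [a, b]) $ i $ j)"

text \<open>\<open>raise \<Omega> T c p us ls\<close> is obtained from the covariant tensor \<open>T\<close> by raising its first
  \<open>length us\<close> indices, according to \<open>X\<^sup>i = \<Omega>\<^sup>i\<^sup>p X\<^sub>p\<close>.\<close>

definition raise :: "'a tensor \<Rightarrow> 'a tensor \<Rightarrow> 'a tensor" where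
  "raise \<Omega> T c p us ls =
     (\<Sum>js\<in>idx (length us). (\<Prod>n<length us. up \<Omega> c p (us ! n) (js ! n)) * T c p [] (js @ ls))"

text \<open>The full contraction \<open>S\<^sup>i\<^sup>1\<^sup>.\<^sup>.\<^sup>.\<^sup>i\<^sup>n T\<^sub>i\<^sub>1\<^sub>.\<^sub>.\<^sub>.\<^sub>i\<^sub>n\<close> of covariant tensors of rank \<open>n\<close>.\<close>

definition contract :: "'a tensor \<Rightarrow> nat \<Rightarrow> 'a tensor \<Rightarrow> 'a tensor \<Rightarrow> 'a chart \<Rightarrow> 'a \<Rightarrow> real" where
  "contract \<Omega> n S T c p = (\<Sum>is\<in>idx n. raise \<Omega> S c p is [] * T c p [] is)"

definition symplectic_connection ::
    "'a chart set \<Rightarrow> 'a tensor \<Rightarrow> 'a set \<Rightarrow> 'a connection \<Rightarrow> bool" where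
  "symplectic_connection A \<Omega> W G \<longleftrightarrow>
     affine_connection A W G \<and>
     (\<forall>c\<in>A. \<forall>p\<in>fst c \<inter> W.
        (\<forall>i j k. G c p i j k = G c p j i k) \<and>
        (\<forall>i j k. cov G \<Omega> c p [] [i, j, k] = 0))"

text \<open>\<open>translate \<Omega> G t \<Phi>\<close> is the connection whose difference tensor with \<open>G\<close> is
  \<open>t \<Phi>\<^sub>i\<^sub>j\<^sup>k = t \<Omega>\<^sup>k\<^sup>p \<Phi>\<^sub>i\<^sub>j\<^sub>p\<close>.\<close>

definition translate :: "'a tensor \<Rightarrow> 'a connection \<Rightarrow> real \<Rightarrow> 'a tensor \<Rightarrow> 'a connection" where
  "translate \<Omega> G t \<Phi> c p i j k =
     G c p i j k + t * (\<Sum>q\<in>UNIV. up \<Omega> c p k q * \<Phi> c p [] [i, j, q])"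

definition parallel_ricci :: "'a chart set \<Rightarrow> 'a set \<Rightarrow> 'a connection \<Rightarrow> bool" where
  "parallel_ricci A W G \<longleftrightarrow>
     (\<forall>c\<in>A. \<forall>p\<in>fst c \<inter> W. \<forall>i j k. cov G (ricci G) c p [] [i, j, k] = 0)"

definition preferred :: "'a chart set \<Rightarrow> 'a set \<Rightarrow> 'a connection \<Rightarrow> bool" where
  "preferred A W G \<longleftrightarrow>
     (\<forall>c\<in>A. \<forall>p\<in>fst c \<inter> W. \<forall>i j k. symmetrize (cov G (ricci G)) c p [] [i, j, k] = 0)"

text \<open>\<open>R\<^sub>i\<^sub>j\<^sub>k\<^sub>l = R\<^sub>i\<^sub>j\<^sub>k\<^sup>p \<Omega>\<^sub>p\<^sub>l\<close>\<close>

definition riem_low :: "'a tensor \<Rightarrow> 'a connection \<Rightarrow> 'a tensor" where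
  "riem_low \<Omega> G c p us ls =
     (\<Sum>q\<in>UNIV. riem G c p (ls ! 0) (ls ! 1) (ls ! 2) q * \<Omega> c p [] [q, ls ! 3])"

text \<open>\<open>\<rho>(\<nabla>)\<^sub>i = 2 \<nabla>\<^sup>p R\<^sub>i\<^sub>p\<close>\<close>

definition rho :: "'a tensor \<Rightarrow> 'a connection \<Rightarrow> 'a tensor" where
  "rho \<Omega> G c p us ls = 2 * (\<Sum>q\<in>UNIV. raise \<Omega> (cov G (ricci G)) c p [q] [ls ! 0, q])"

text \<open>\<open>K(\<nabla>) = \<nabla>\<^sup>i \<nabla>\<^sup>j R\<^sub>i\<^sub>j - 1/2 R\<^sup>i\<^sup>j R\<^sub>i\<^sub>j + 1/4 R\<^sup>i\<^sup>j\<^sup>k\<^sup>l R\<^sub>i\<^sub>j\<^sub>k\<^sub>l\<close>\<close>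

definition Kfun :: "'a chart set \<Rightarrow> 'a tensor \<Rightarrow> 'a connection \<Rightarrow> 'a \<Rightarrow> real" where
  "Kfun A \<Omega> G = scalar A (\<lambda>c p.
     (\<Sum>i\<in>UNIV. \<Sum>j\<in>UNIV. raise \<Omega> (cov G (cov G (ricci G))) c p [i, j] [i, j])
     - 1 / 2 * contract \<Omega> 2 (ricci G) (ricci G) c p
     + 1 / 4 * contract \<Omega> 4 (riem_low \<Omega> G) (riem_low \<Omega> G) c p)"

text \<open>\<open>\<tau>(\<nabla>) = K(\<nabla>)\<^sup>2 + \<rho>(\<nabla>)\<^sup>i dK(\<nabla>)\<^sub>i\<close>\<close>

definition tau :: "'a chart set \<Rightarrow> 'a tensor \<Rightarrow> 'a connection \<Rightarrow> 'a \<Rightarrow> real" where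
  "tau A \<Omega> G = scalar A (\<lambda>c p.
     (Kfun A \<Omega> G p)\<^sup>2 + (\<Sum>i\<in>UNIV. raise \<Omega> (rho \<Omega> G) c p [i] [] * pd c i (Kfun A \<Omega> G) p))"

text \<open>The Hamiltonian vector field \<open>\<Omega>\<^sup>p\<^sup>i df\<^sub>p\<close>; note the position of the index \<open>i\<close>.\<close>

definition ham :: "'a tensor \<Rightarrow> ('a \<Rightarrow> real) \<Rightarrow> 'a tensor" where
  "ham \<Omega> f c p us ls = (\<Sum>q\<in>UNIV. up \<Omega> c p q (us ! 0) * pd c q f p)"

text \<open>The operator \<open>\<H>\<close>, with the third index lowered by \<open>X\<^sub>i = X\<^sup>p \<Omega>\<^sub>p\<^sub>i\<close>.\<close>

definition Hop :: "'a tensor \<Rightarrow> 'a connection \<Rightarrow> ('a \<Rightarrow> real) \<Rightarrow> 'a tensor" where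
  "Hop \<Omega> G f c p us ls =
     (\<Sum>q\<in>UNIV. lie_conn G (ham \<Omega> f) c p (ls ! 0) (ls ! 1) q * \<Omega> c p [] [q, ls ! 2])"


section \<open>Integration, critical connections and the Jacobi operator\<close>

text \<open>Integration against the symplectic form, with respect to the orientation it induces, is
  integration against the Borel measure on the surface that is given by \<open>|\<Omega>\<^sub>1\<^sub>2| dx\<^sup>1 dx\<^sup>2\<close> in every
  chart. The complement of the surface in the ambient type is a null set. The elements of the index
  type are \<open>1\<close> and \<open>2\<close> (which equals \<open>0\<close>), as for the components of vectors in \<open>real^2\<close>.\<close>

definition symplectic_measure ::
    "'a::{t2_space,second_countable_topology} chart set \<Rightarrow> 'a tensor \<Rightarrow> 'a measure" where
  "symplectic_measure A \<Omega> = (THE \<mu>.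
     sets \<mu> = sets borel \<and>
     emeasure \<mu> (- (\<Union>c\<in>A. fst c)) = 0 \<and>
     (\<forall>c\<in>A. \<forall>B\<in>sets borel. B \<subseteq> fst c \<longrightarrow>
        emeasure \<mu> B =
          (\<integral>\<^sup>+ x \<in> snd c ` B. ennreal \<bar>\<Omega> c (chart_inv c x) [] [1, 2]\<bar> \<partial>lborel)))"

definition compactly_supported_fun ::
    "'a::topological_space set \<Rightarrow> ('a \<Rightarrow> real) \<Rightarrow> bool" where
  "compactly_supported_fun W f \<longleftrightarrow> (\<exists>C. compact C \<and> C \<subseteq> W \<and> (\<forall>p\<in>W - C. f p = 0))"

definition compactly_supported_tensor ::
    "'a::topological_space chart set \<Rightarrow> 'a set \<Rightarrow> nat \<Rightarrow> nat \<Rightarrow>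
     'a tensor \<Rightarrow> bool" where
  "compactly_supported_tensor A W r s T \<longleftrightarrow>
     (\<exists>C. compact C \<and> C \<subseteq> W \<and>
        (\<forall>c\<in>A. \<forall>p\<in>fst c \<inter> W - C. \<forall>us\<in>idx r. \<forall>ls\<in>idx s. T c p us ls = 0))"

text \<open>The variations are \<open>G + t \<Phi>\<close>, since symplectic connections form an affine space over the
  sections of \<open>S\<^sup>3(T\<^sup>*M)\<close>. The integrand is the difference with the value at \<open>t = 0\<close>, so that it
  has compact support even if \<open>K\<^sup>2\<close> is not integrable over \<open>W\<close>.\<close>

definition critical ::
    "'a::{t2_space,second_countable_topology} chart set \<Rightarrow> 'a tensor \<Rightarrow> 'a set \<Rightarrow>
     'a connection \<Rightarrow> bool" where
  "critical A \<Omega> W G \<longleftrightarrow>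
     (\<forall>\<Phi>. sym3_field A W \<Phi> \<and> compactly_supported_tensor A W 0 3 \<Phi> \<longrightarrow>
        ((\<lambda>t. LINT p:W|symplectic_measure A \<Omega>.
                (Kfun A \<Omega> (translate \<Omega> G t \<Phi>) p)\<^sup>2 - (Kfun A \<Omega> G p)\<^sup>2)
          has_real_derivative 0) (at 0))"

text \<open>The formal adjoint of \<open>\<H>\<close> over \<open>W\<close>; it is unique as a function on \<open>W\<close>.\<close>

definition Hadj ::
    "'a::{t2_space,second_countable_topology} chart set \<Rightarrow> 'a tensor \<Rightarrow> 'a set \<Rightarrow>
     'a connection \<Rightarrow> 'a tensor \<Rightarrow> 'a \<Rightarrow> real" where
  "Hadj A \<Omega> W G \<Phi> = (SOME h. smooth_fun A W h \<and>
     (\<forall>f. smooth_fun A W f \<and> compactly_supported_fun W f \<longrightarrow>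
        (LINT p:W|symplectic_measure A \<Omega>. f p * h p) =
        (LINT p:W|symplectic_measure A \<Omega>.
           scalar A (contract \<Omega> 3 \<Phi> (Hop \<Omega> G f)) p)))"

definition jacobi_op ::
    "'a::{t2_space,second_countable_topology} chart set \<Rightarrow> 'a tensor \<Rightarrow> 'a set \<Rightarrow>
     'a connection \<Rightarrow> 'a tensor \<Rightarrow> 'a tensor" where
  "jacobi_op A \<Omega> W G \<alpha> c p us ls =
     Hop \<Omega> G (Hadj A \<Omega> W G \<alpha>) c p us ls + lie_deriv (ham \<Omega> (Kfun A \<Omega> G)) \<alpha> c p us ls"

end

theory Submission
  imports Defs "HOL-Computational_Algebra.Polynomial"
begin

text \<open>In dimension \<open>2\<close> the curvature is determined by the Ricci tensor, and
  \<open>K(\<nabla>) \<Omega> = - 1/2 d\<rho>(\<nabla>)\<close>. Since \<open>D\<^sub>i Z\<^sub>j = \<gamma>/2 \<Omega>\<^sub>i\<^sub>j\<close> and \<open>d\<gamma>\<^sub>i = - 2 R\<^sub>i\<^sub>p Z\<^sup>p\<close>, the ring generated by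
  \<open>Z\<close>, \<open>\<gamma>\<close>, \<open>\<nu>\<close>, the Ricci tensor and \<open>(\<nu> - \<gamma>\<^sup>2)\<^sup>-\<^sup>1\<close> is closed under differentiation, so that the
  formulas for \<open>\<nabla>(t)\<close> and \<open>\<H>(\<gamma>) = 0\<close> are computations in charts.

  For criticality, \<open>K(\<nabla> + s\<Phi>)\<close> is a cubic polynomial in \<open>s\<close>; if \<open>\<H>\<^sub>\<nabla>(f) = 0\<close> then
  \<open>f\<close> times its linear coefficient is a divergence in each chart, and a partition of unity reduces
  the integral to variations supported in a coordinate disc. In the same way
  \<open>\<Gamma>\<^sup>i\<^sup>j\<^sup>k \<H>(f)\<^sub>i\<^sub>j\<^sub>k\<close> is \<open>- 3/4 \<gamma> f\<close> plus a divergence, hence \<open>\<H>\<^sup>*(\<Gamma>) = - 3/4 \<gamma>\<close> is annihilated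
  by \<open>\<H>\<close>. The remaining term \<open>L \<Gamma>\<close>, for the Hamiltonian field of \<open>K = - 3/4 t \<gamma>\<close>,
  vanishes because that field preserves \<open>Z\<close> and \<open>\<gamma>\<close>.\<close>

section \<open>Calculus in the coordinate plane\<close>

text \<open>The factor y = 1 / (\<nu> - \<gamma>^2) in \<Gamma> is the one that makes the vector
  field y Z divergence-free: Z has divergence \<gamma>, and 2 Z(\<gamma>) = \<gamma>^2 - \<nu> gives
  Z(y) = - \<gamma> y. Together with \<open>Z\<^sup>p Z\<^sub>p = 0\<close> this makes the Ricci
  tensor of D + t \<Gamma> affine in t. Tensors are bare families of components,
  \<open>scalar\<close> and \<open>Hadj\<close> are choices and \<open>symplectic_measure\<close> is
  a definite description. So chart independence of \<gamma> and K, existence and uniqueness of the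
  measure and uniqueness of the adjoint must be established before the formulas can be used.
  Invariance of K is obtained without transforming second covariant derivatives: K and \<gamma> are
  each a constant times a curl divided by \<open>\<Omega>\<^sub>1\<^sub>2\<close>, and curls and
  \<open>\<Omega>\<^sub>1\<^sub>2\<close> scale by the same Jacobian determinant. Charts are not
  assumed to be oriented, so a sign enters the divergence theorem; it is constant on a closed
  coordinate disc, and integrals are evaluated over one such disc at a time.\<close>

lemma partial_eqI: "(f has_derivative F) (at x) \<Longrightarrow> partial i f x = F (axis i 1)"
  unfolding partial_def by (metis frechet_derivative_at)

text \<open>Holds without differentiability: \<open>frechet_derivative\<close> is a choice among the
  derivatives at x, and f and g have the same ones, so the choices agree even if there are
  none.\<close>

lemma partial_cong:
  assumes "open S" "x \<in> S" "\<And>y. y \<in> S \<Longrightarrow> f y = g y"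
  shows "partial i f x = partial i g x"
proof -
  have "(f has_derivative F) (at x) \<longleftrightarrow> (g has_derivative F) (at x)" for F
    using assms has_derivative_transform_within_open[of f F x UNIV S g]
      has_derivative_transform_within_open[of g F x UNIV S f] by metis
  then show ?thesis by (simp add: partial_def frechet_derivative_def)
qed

lemma partial_has_derivative:
  assumes "f differentiable (at x)"
  shows "(f has_derivative (\<lambda>v. \<Sum>i\<in>UNIV. partial i f x * v $ i)) (at x)"
proof -
  let ?F = "frechet_derivative f (at x)"
  have F: "(f has_derivative ?F) (at x)"
    using assms frechet_derivative_works by blast
  then have lin: "linear ?F" by (rule has_derivative_linear)
  have "?F v = (\<Sum>i\<in>UNIV. partial i f x * v $ i)" for v
  proof -
    have "?F v = ?F (\<Sum>i\<in>UNIV. v $ i *\<^sub>R axis i 1)"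
      using basis_expansion[of v] by (simp add: scalar_mult_eq_scaleR)
    then show ?thesis
      by (simp add: linear_sum[OF lin] linear_scale[OF lin] partial_def mult.commute)
  qed
  with F show ?thesis by (metis (no_types, lifting) ext)
qed

lemma partial_const: "partial i (\<lambda>x. k) x = 0"
  by (rule partial_eqI[OF has_derivative_const, THEN trans]) simp

lemma partial_add:
  assumes "f differentiable (at x)" "g differentiable (at x)"
  shows "partial i (\<lambda>x. f x + g x) x = partial i f x + partial i g x"
  using assms[THEN frechet_derivative_works[THEN iffD1]]
  by (subst partial_eqI[OF has_derivative_add]) (auto simp: partial_def)

lemma partial_uminus:
  assumes "f differentiable (at x)"
  shows "partial i (\<lambda>x. - f x) x = - partial i f x"
  using assms[THEN frechet_derivative_works[THEN iffD1]]
  by (subst partial_eqI[OF has_derivative_minus]) (auto simp: partial_def)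

lemma partial_mult:
  assumes "f differentiable (at x)" "g differentiable (at x)"
  shows "partial i (\<lambda>x. f x * g x) x = f x * partial i g x + partial i f x * g x"
  using assms[THEN frechet_derivative_works[THEN iffD1]]
  by (subst partial_eqI[OF has_derivative_mult]) (auto simp: partial_def)

lemma partial_compose_real:
  assumes "f differentiable (at x)" "(h has_real_derivative h') (at (f x))"
  shows "partial i (\<lambda>x. h (f x)) x = h' * partial i f x"
proof -
  have "((\<lambda>x. h (f x)) has_derivative (\<lambda>v. h' * frechet_derivative f (at x) v)) (at x)"
    using has_derivative_compose[OF assms(1)[THEN frechet_derivative_works[THEN iffD1]]]
      assms(2) unfolding has_field_derivative_def by blast
  from partial_eqI[OF this] show ?thesis by (simp add: partial_def)
qed

lemma differentiable_compose_real:
  assumes "f differentiable (at x)" "(h has_real_derivative h') (at (f x))"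
  shows "(\<lambda>x. h (f x)) differentiable (at x)"
  by (metis assms differentiable_compose differentiable_def has_field_derivative_def)

lemma partial_inverse:
  assumes "f differentiable (at x)" "f x \<noteq> 0"
  shows "partial i (\<lambda>x. inverse (f x)) x = - (inverse (f x))\<^sup>2 * partial i f x"
  using partial_compose_real[OF assms(1) DERIV_inverse[OF assms(2)]] by (simp add: power2_eq_square)

lemma partial_chain:
  fixes f :: "real^2 \<Rightarrow> real" and \<phi> :: "real^2 \<Rightarrow> real^2"
  assumes "f differentiable (at (\<phi> x))" "\<And>a. (\<lambda>x. \<phi> x $ a) differentiable (at x)"
  shows "partial i (\<lambda>x. f (\<phi> x)) x =
    (\<Sum>a\<in>UNIV. partial a f (\<phi> x) * partial i (\<lambda>x. \<phi> x $ a) x)"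
proof -
  have "(\<phi> has_derivative (\<lambda>v. \<chi> a. frechet_derivative (\<lambda>x. \<phi> x $ a) (at x) v)) (at x)"
    using assms(2)[THEN frechet_derivative_works[THEN iffD1]]
    by (subst has_derivative_componentwise_within)
       (auto simp: Basis_vec_def inner_axis)
  from has_derivative_compose[OF this partial_has_derivative[OF assms(1)]]
  show ?thesis by (subst partial_eqI) (auto simp: partial_def)
qed

section \<open>Closure properties of the classes C^k and of smooth functions\<close>

lemma Ck_on_cong:
  assumes "open S" "\<And>x. x \<in> S \<Longrightarrow> f x = g x" "Ck_on k f S"
  shows "Ck_on k g S"
  using assms(2,3)
proof (induction k arbitrary: f g)
  case 0
  then show ?case using continuous_on_cong[of S S f g] by simp
next
  case (Suc k)
  have "g differentiable_on S"
    using Suc.prems differentiable_on_def differentiable_transform_within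
    by (metis (no_types, lifting) Ck_on.simps(2) zero_less_one)
  moreover have "Ck_on k (partial i g) S" for i
  proof (rule Suc.IH)
    show "partial i f x = partial i g x" if "x \<in> S" for x
      using partial_cong[OF assms(1) that Suc.prems(1)] .
    show "Ck_on k (partial i f) S" using Suc.prems(2) by simp
  qed
  ultimately show ?case by simp
qed

lemma Ck_on_subset: "Ck_on k f S \<Longrightarrow> T \<subseteq> S \<Longrightarrow> Ck_on k f T"
  by (induction k arbitrary: f) (auto intro: continuous_on_subset differentiable_on_subset)

lemma Ck_on_Suc_imp: "Ck_on (Suc k) f S \<Longrightarrow> Ck_on k f S"
  by (induction k arbitrary: f) (auto simp: differentiable_imp_continuous_on)

lemma Ck_on_local:
  assumes "open S" "\<And>x. x \<in> S \<Longrightarrow> \<exists>T. open T \<and> x \<in> T \<and> Ck_on k f T"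
  shows "Ck_on k f S"
  using assms(2)
proof (induction k arbitrary: f)
  case 0
  have "isCont f x" if "x \<in> S" for x
    using 0[OF that] continuous_on_eq_continuous_at by auto
  then show ?case by (simp add: continuous_at_imp_continuous_on)
next
  case (Suc k)
  have "f differentiable (at x)" if "x \<in> S" for x
    using Suc.prems[OF that] by (auto simp: differentiable_on_eq_differentiable_at)
  then have "f differentiable_on S" using assms(1) differentiable_on_eq_differentiable_at by blast
  moreover have "Ck_on k (partial i f) S" for i
    using Suc.prems by (intro Suc.IH) (metis Ck_on.simps(2))
  ultimately show ?case by simp
qed

lemma Ck_on_const: "Ck_on k (\<lambda>x. a) S"
proof (induction k arbitrary: a)
  case (Suc k)
  have "partial i (\<lambda>x. a) = (\<lambda>x. 0)" for i by (rule ext) (rule partial_const)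
  then show ?case using Suc by simp
qed simp

lemma Ck_on_add:
  assumes "open S" "Ck_on k f S" "Ck_on k g S"
  shows "Ck_on k (\<lambda>x. f x + g x) S"
  using assms(2,3)
proof (induction k arbitrary: f g)
  case 0
  then show ?case by (simp add: continuous_on_add)
next
  case (Suc k)
  have d: "f differentiable (at x)" "g differentiable (at x)" if "x \<in> S" for x
    using Suc.prems assms(1) that by (simp_all add: differentiable_on_eq_differentiable_at)
  have "Ck_on k (partial i (\<lambda>x. f x + g x)) S" for i
  proof (rule Ck_on_cong[OF assms(1)])
    show "Ck_on k (\<lambda>x. partial i f x + partial i g x) S"
      using Suc by simp
  qed (simp add: partial_add d)
  then show ?case using Suc.prems by simp
qed

lemma Ck_on_mult:
  assumes "open S" "Ck_on k f S" "Ck_on k g S"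
  shows "Ck_on k (\<lambda>x. f x * g x) S"
  using assms(2,3)
proof (induction k arbitrary: f g)
  case 0
  then show ?case by (simp add: continuous_on_mult)
next
  case (Suc k)
  have d: "f differentiable (at x)" "g differentiable (at x)" if "x \<in> S" for x
    using Suc.prems assms(1) that by (simp_all add: differentiable_on_eq_differentiable_at)
  have "Ck_on k (partial i (\<lambda>x. f x * g x)) S" for i
  proof (rule Ck_on_cong[OF assms(1)])
    have "Ck_on k (partial i f) S" "Ck_on k (partial i g) S" using Suc.prems by simp_all
    then show "Ck_on k (\<lambda>x. f x * partial i g x + partial i f x * g x) S"
      using Suc.prems[THEN Ck_on_Suc_imp] by (intro Ck_on_add[OF assms(1)] Suc.IH)
  qed (simp add: partial_mult d)
  then show ?case using Suc.prems by simp
qed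

text \<open>The whole sequence of derivatives of the outer function is carried along, because the
  chain rule replaces \<open>h n\<close> by \<open>h (Suc n)\<close> in the induction on k. It is
  applied to \<open>flat\<close>.\<close>

lemma Ck_on_compose_real:
  assumes "open S" "Ck_on k f S"
    and "\<And>n y. (h n has_real_derivative h (Suc n) y) (at y)"
  shows "Ck_on k (\<lambda>x. h n (f x)) S"
  using assms(2)
proof (induction k arbitrary: f n)
  case 0
  have "continuous_on UNIV (h n)"
    by (intro continuous_at_imp_continuous_on ballI DERIV_isCont[OF assms(3)])
  from continuous_on_compose2[OF this] show ?case using 0 by simp
next
  case (Suc k)
  have d: "f differentiable (at x)" if "x \<in> S" for x
    using Suc.prems assms(1) that by (simp add: differentiable_on_eq_differentiable_at)
  have "Ck_on k (partial i (\<lambda>x. h n (f x))) S" for i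
  proof (rule Ck_on_cong[OF assms(1)])
    show "Ck_on k (\<lambda>x. h (Suc n) (f x) * partial i f x) S"
      using Suc.prems Suc.IH[OF Ck_on_Suc_imp[OF Suc.prems]]
      by (intro Ck_on_mult[OF assms(1)]) simp_all
  qed (simp add: partial_compose_real[OF d assms(3)])
  moreover have "(\<lambda>x. h n (f x)) differentiable_on S"
    using differentiable_compose_real[OF d assms(3)] assms(1)
    by (simp add: differentiable_on_eq_differentiable_at)
  ultimately show ?case by simp
qed

lemma Ck_on_inverse:
  assumes "open S" "Ck_on k f S" "\<And>x. x \<in> S \<Longrightarrow> f x \<noteq> 0"
  shows "Ck_on k (\<lambda>x. inverse (f x)) S"
  using assms(2,3)
proof (induction k)
  case 0
  then show ?case by (auto intro: continuous_on_inverse)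
next
  case (Suc k)
  have d: "f differentiable (at x)" if "x \<in> S" for x
    using Suc.prems assms(1) that by (simp add: differentiable_on_eq_differentiable_at)
  have "Ck_on k (partial i (\<lambda>x. inverse (f x))) S" for i
  proof (rule Ck_on_cong[OF assms(1)])
    have "Ck_on k (\<lambda>x. inverse (f x)) S"
      using Suc.IH Ck_on_Suc_imp[OF Suc.prems(1)] Suc.prems(2) by blast
    then show "Ck_on k (\<lambda>x. - 1 * (inverse (f x) * inverse (f x)) * partial i f x) S"
      using Suc.prems by (intro Ck_on_mult[OF assms(1)] Ck_on_const) simp_all
  qed (simp add: partial_inverse[OF d Suc.prems(2)] power2_eq_square)
  moreover have "(\<lambda>x. inverse (f x)) differentiable_on S"
    using differentiable_compose_real[OF d DERIV_inverse] assms(1) Suc.prems(2)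
    by (simp add: differentiable_on_eq_differentiable_at)
  ultimately show ?case by simp
qed

lemma smooth_on_continuous: "smooth_on f S \<Longrightarrow> continuous_on S f"
  unfolding smooth_on_def by (metis Ck_on.simps(1))

lemma smooth_on_differentiable: "smooth_on f S \<Longrightarrow> open S \<Longrightarrow> x \<in> S \<Longrightarrow> f differentiable (at x)"
  unfolding smooth_on_def by (metis Ck_on.simps(2) differentiable_on_eq_differentiable_at)

lemma smooth_on_partial: "smooth_on f S \<Longrightarrow> smooth_on (partial i f) S"
  unfolding smooth_on_def by (metis Ck_on.simps(2))

lemma axis_line_derivative:
  assumes "f differentiable (at (x + s *\<^sub>R axis i 1))"
  shows "((\<lambda>s. f (x + s *\<^sub>R axis i 1)) has_real_derivative partial i f (x + s *\<^sub>R axis i 1)) (at s)"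
proof -
  have 1: "((\<lambda>s::real. x + s *\<^sub>R axis i (1::real)) has_derivative (\<lambda>s. s *\<^sub>R axis i 1)) (at s)"
    by (auto intro!: derivative_eq_intros)
  have "((\<lambda>s. f (x + s *\<^sub>R axis i 1)) has_derivative
      (\<lambda>h. \<Sum>j\<in>UNIV. partial j f (x + s *\<^sub>R axis i 1) * (h *\<^sub>R axis i 1) $ j)) (at s)"
    using has_derivative_compose[OF 1 partial_has_derivative[OF assms]] by simp
  moreover have "(\<Sum>j\<in>UNIV. partial j f (x + s *\<^sub>R axis i 1) * (h *\<^sub>R axis i 1) $ j)
      = partial i f (x + s *\<^sub>R axis i 1) * h" for h :: real
    by (simp add: axis_def if_distrib[of "\<lambda>t. _ * (h * t)"] cong: if_cong)
  ultimately show ?thesis by (simp add: has_field_derivative_def)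
qed

text \<open>The mean value theorem twice, first along direction i for the difference in direction j,
  then along j. The margin e keeps points at distance exactly 2 h inside S.\<close>

lemma second_difference:
  assumes "smooth_on f S" "open S" "h > 0" "ball x (2 * h + e) \<subseteq> S" "e > 0"
  shows "\<exists>y\<in>S. dist x y \<le> 2 * h \<and>
    f (x + h *\<^sub>R axis i 1 + h *\<^sub>R axis j 1) - f (x + h *\<^sub>R axis i 1)
      - f (x + h *\<^sub>R axis j 1) + f x = h\<^sup>2 * partial j (partial i f) y"
proof -
  define a b where "a = (axis i 1 :: real^2)" and "b = (axis j 1 :: real^2)"
  have nrm: "norm (s *\<^sub>R a + t *\<^sub>R b) \<le> 2 * h" if "0 \<le> s" "s \<le> h" "0 \<le> t" "t \<le> h" for s t
    using norm_triangle_ineq[of "s *\<^sub>R a" "t *\<^sub>R b"] that by (simp add: a_def b_def)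
  have inS: "x + s *\<^sub>R a + t *\<^sub>R b \<in> S" "dist x (x + s *\<^sub>R a + t *\<^sub>R b) \<le> 2 * h"
    if "0 \<le> s" "s \<le> h" "0 \<le> t" "t \<le> h" for s t
  proof -
    show d: "dist x (x + s *\<^sub>R a + t *\<^sub>R b) \<le> 2 * h"
      using nrm[OF that] by (simp add: dist_norm norm_minus_commute add.assoc add.commute)
    show "x + s *\<^sub>R a + t *\<^sub>R b \<in> S" using d assms by (auto intro!: subsetD[OF assms(4)])
  qed
  define g where "g s = f (x + s *\<^sub>R a + h *\<^sub>R b) - f (x + s *\<^sub>R a)" for s
  have dg: "(g has_real_derivative
      partial i f (x + s *\<^sub>R a + h *\<^sub>R b) - partial i f (x + s *\<^sub>R a)) (at s)"
    if "0 \<le> s" "s \<le> h" for s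
  proof -
    have "f differentiable (at ((x + h *\<^sub>R b) + s *\<^sub>R a))" "f differentiable (at (x + s *\<^sub>R a))"
      using inS(1)[OF that, of h] inS(1)[OF that, of 0] assms(3)
      by (auto intro!: smooth_on_differentiable[OF assms(1,2)] simp: algebra_simps)
    from this[unfolded a_def, THEN axis_line_derivative]
    have "((\<lambda>s. f (x + h *\<^sub>R b + s *\<^sub>R a) - f (x + s *\<^sub>R a)) has_real_derivative
      partial i f (x + h *\<^sub>R b + s *\<^sub>R a) - partial i f (x + s *\<^sub>R a)) (at s)"
      unfolding a_def by (rule DERIV_diff)
    then show ?thesis unfolding g_def by (simp add: algebra_simps)
  qed
  obtain s where s: "0 < s" "s < h" "g h - g 0 = (h - 0) *
      (partial i f (x + s *\<^sub>R a + h *\<^sub>R b) - partial i f (x + s *\<^sub>R a))"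
    using MVT2[of 0 h g, OF assms(3) dg] by auto
  have dk: "((\<lambda>t. partial i f (x + s *\<^sub>R a + t *\<^sub>R b)) has_real_derivative
      partial j (partial i f) (x + s *\<^sub>R a + t *\<^sub>R b)) (at t)" if "0 \<le> t" "t \<le> h" for t
    unfolding b_def using inS(1)[of s t] s that
    by (intro axis_line_derivative smooth_on_differentiable[OF smooth_on_partial[OF assms(1)] assms(2)])
       (auto simp: b_def)
  obtain t where t: "0 < t" "t < h" "partial i f (x + s *\<^sub>R a + h *\<^sub>R b) - partial i f (x + s *\<^sub>R a + 0 *\<^sub>R b)
      = (h - 0) * partial j (partial i f) (x + s *\<^sub>R a + t *\<^sub>R b)"
    using MVT2[of 0 h "\<lambda>t. partial i f (x + s *\<^sub>R a + t *\<^sub>R b)", OF assms(3) dk] by auto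
  have "g h - g 0 = h\<^sup>2 * partial j (partial i f) (x + s *\<^sub>R a + t *\<^sub>R b)"
    using s t by (simp add: power2_eq_square)
  then show ?thesis using inS[of s t] s t
    by (intro bexI[of _ "x + s *\<^sub>R a + t *\<^sub>R b"]) (auto simp: g_def a_def b_def algebra_simps)
qed

text \<open>The second difference is unchanged when i and j are exchanged, so the two mixed
  derivatives agree at two points arbitrarily close to x; continuity carries the equality to
  x.\<close>

lemma partial_commute:
  assumes "smooth_on f S" "open S" "x \<in> S"
  shows "partial i (partial j f) x = partial j (partial i f) x"
proof -
  obtain r where r: "r > 0" "ball x r \<subseteq> S" using assms openE by blast
  have ex: "\<exists>y\<in>S. \<exists>z\<in>S. dist x y \<le> d \<and> dist x z \<le> d \<and>
      partial i (partial j f) y = partial j (partial i f) z" if "d > 0" "d < r" for d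
  proof -
    have "ball x (2 * (d/2) + (r - d)) \<subseteq> S" using r by auto
    note sd = second_difference[OF assms(1,2) _ this]
    from sd[of i j] sd[of j i] that obtain y z where
      "y\<in>S" "dist x y \<le> d" "z\<in>S" "dist x z \<le> d"
      "(d/2)\<^sup>2 * partial i (partial j f) y = (d/2)\<^sup>2 * partial j (partial i f) z"
      by (auto simp: algebra_simps)
    then show ?thesis using that by auto
  qed
  \<comment> \<open>A null sequence of positive scales below r, so that \<open>ex\<close> applies to
    each of them.\<close>
  let ?u = "\<lambda>n. min (r/2) (1 / real (Suc n))"
  have u: "?u n > 0" "?u n < r" for n using r by auto
  from ex[OF u] obtain y z where yz: "\<And>n. y n \<in> S" "\<And>n. z n \<in> S" "\<And>n. dist x (y n) \<le> ?u n"
    "\<And>n. dist x (z n) \<le> ?u n" "\<And>n. partial i (partial j f) (y n) = partial j (partial i f) (z n)"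
    by metis
  have lim: "v \<longlonglongrightarrow> x" if "\<And>n. dist x (v n) \<le> ?u n" for v
  proof (rule tendsto_dist_iff[THEN iffD2], rule tendsto_sandwich[where f="\<lambda>_. 0"])
    show "(\<lambda>n. 1 / real (Suc n)) \<longlonglongrightarrow> 0" by (rule lim_1_over_n[THEN LIMSEQ_Suc])
    show "\<forall>\<^sub>F n in sequentially. dist (v n) x \<le> 1 / real (Suc n)"
      using that by (auto simp: dist_commute)
  qed auto
  have cont: "isCont (partial a (partial b f)) x" for a b
    using smooth_on_continuous[OF smooth_on_partial[OF smooth_on_partial[OF assms(1)]]] assms(2,3)
      continuous_on_eq_continuous_at by blast
  have "(\<lambda>n. partial i (partial j f) (y n)) \<longlonglongrightarrow> partial i (partial j f) x"
    by (rule isCont_tendsto_compose[OF cont lim[OF yz(3)]])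
  moreover have "(\<lambda>n. partial i (partial j f) (y n)) \<longlonglongrightarrow> partial j (partial i f) x"
    unfolding yz(5) by (rule isCont_tendsto_compose[OF cont lim[OF yz(4)]])
  ultimately show ?thesis using LIMSEQ_unique by blast
qed

subsection \<open>A smooth plateau function\<close>

text \<open>With y = 1/x the derivative of p(y) exp(-y) with respect to x is y^2 (p(y) - p'(y))
  exp(-y), which gives the recursion.\<close>

primrec flat_poly :: "nat \<Rightarrow> real poly" where
  "flat_poly 0 = 1"
| "flat_poly (Suc n) = [:0, 0, 1:] * (flat_poly n - pderiv (flat_poly n))"

text \<open>The \<open>n\<close>-th derivative of \<open>exp (- 1 / x)\<close>, extended by zero.\<close>

definition flat :: "nat \<Rightarrow> real \<Rightarrow> real" where
  "flat n x = (if x > 0 then poly (flat_poly n) (inverse x) * exp (- inverse x) else 0)"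

lemma poly_times_exp_tendsto_0: "((\<lambda>y. poly p y * exp (- y)) \<longlongrightarrow> 0) (at_top :: real filter)"
proof -
  have "((\<lambda>y. \<Sum>i\<le>degree p. coeff p i * (y ^ i / exp y)) \<longlongrightarrow> (\<Sum>i\<le>degree p. coeff p i * 0))
      (at_top :: real filter)"
    by (intro tendsto_intros tendsto_power_div_exp_0)
  then show ?thesis
    by (simp add: poly_altdef sum_distrib_right exp_minus divide_inverse mult.assoc)
qed

lemma flat_derivative: "(flat n has_real_derivative flat (Suc n) x) (at x)"
proof -
  consider "x > 0" | "x < 0" | "x = 0" by linarith
  then show ?thesis
  proof cases
    case 1
    have "((\<lambda>x. poly (flat_poly n) (inverse x) * exp (- inverse x)) has_real_derivative
        flat (Suc n) x) (at x)"
      using 1 by (auto intro!: derivative_eq_intros DERIV_chain2[OF poly_DERIV]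
          simp: flat_def algebra_simps power2_eq_square)
    then show ?thesis
      by (rule has_field_derivative_transform_within_open[where S="{0<..}"]) (use 1 in \<open>auto simp: flat_def\<close>)
  next
    case 2
    have "((\<lambda>x. 0) has_real_derivative flat (Suc n) x) (at x)" using 2 by (simp add: flat_def)
    then show ?thesis
      by (rule has_field_derivative_transform_within_open[where S="{..<0}"]) (use 2 in \<open>auto simp: flat_def\<close>)
  next
    case 3
    \<comment> \<open>The difference quotient of \<open>flat n\<close> at 0 divides by h, that is,
      multiplies by y = 1/h; this is the factor \<open>[:0,1:]\<close>.\<close>
    have "((\<lambda>y. poly ([:0,1:] * flat_poly n) y * exp (- y)) \<longlongrightarrow> 0) at_top"
      by (rule poly_times_exp_tendsto_0)
    from filterlim_compose[OF this filterlim_inverse_at_top_right]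
    have "((\<lambda>h. flat n h / h) \<longlongrightarrow> 0) (at_right 0)"
      by (rule Lim_transform_eventually)
         (auto simp: flat_def eventually_at_right_less field_simps intro!: eventually_at_rightI[of 0 1])
    moreover have "((\<lambda>h. flat n h / h) \<longlongrightarrow> 0) (at_left 0)"
      by (rule Lim_transform_eventually[of "\<lambda>_. 0"])
         (auto simp: flat_def intro!: eventually_at_leftI[of "-1" 0])
    ultimately have "((\<lambda>h. flat n h / h) \<longlongrightarrow> 0) (at 0)"
      by (simp add: filterlim_split_at)
    then show ?thesis using 3 by (simp add: has_field_derivative_iff flat_def)
  qed
qed

lemma smooth_on_flat: "open S \<Longrightarrow> smooth_on f S \<Longrightarrow> smooth_on (\<lambda>x. flat 0 (f x)) S"
  unfolding smooth_on_def using Ck_on_compose_real[where h=flat] flat_derivative by blast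

lemma flat_nonneg: "flat 0 x \<ge> 0" and flat_pos_iff: "flat 0 x > 0 \<longleftrightarrow> x > 0"
  by (auto simp: flat_def)

section \<open>Differentiation in charts\<close>

definition dif :: "'a chart \<Rightarrow> ('a \<Rightarrow> real) \<Rightarrow> 'a \<Rightarrow> bool" where
  "dif c f p \<longleftrightarrow> (\<lambda>x. f (chart_inv c x)) differentiable (at (snd c p))"

text \<open>Smoothness in one chart only, so that it applies to components and Christoffel symbols,
  which change with the chart.\<close>

definition smc :: "'a chart \<Rightarrow> 'a set \<Rightarrow> ('a \<Rightarrow> real) \<Rightarrow> bool" where
  "smc c W f \<longleftrightarrow> smooth_on (\<lambda>x. f (chart_inv c x)) (snd c ` (fst c \<inter> W))"

locale chart =
  fixes c :: "'a::{t2_space,second_countable_topology} chart"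
  assumes open_dom: "open (fst c)" and open_img: "open (snd c ` fst c)"
    and homeo: "homeomorphism (fst c) (snd c ` fst c) (snd c) (chart_inv c)"
begin

lemma chart_inv_snd [simp]: "p \<in> fst c \<Longrightarrow> chart_inv c (snd c p) = p"
  using homeo by (auto simp: homeomorphism_def)

lemma chart_inv_in: "x \<in> snd c ` (fst c \<inter> W) \<Longrightarrow> chart_inv c x \<in> fst c \<inter> W"
  by auto

lemma snd_chart_inv [simp]: "x \<in> snd c ` fst c \<Longrightarrow> snd c (chart_inv c x) = x"
  using homeo by (auto simp: homeomorphism_def)

lemma open_chart_image: "open W \<Longrightarrow> open (snd c ` (fst c \<inter> W))"
  using homeomorphism_imp_open_map[OF homeo, of "fst c \<inter> W"] open_img
  by (metis openin_open_eq openin_open_Int open_openin openin_trans)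

lemma pd_const: "p \<in> fst c \<Longrightarrow> pd c i (\<lambda>q. a) p = 0"
  by (simp add: pd_def partial_const)

lemma pd_add: "p \<in> fst c \<Longrightarrow> dif c f p \<Longrightarrow> dif c g p \<Longrightarrow>
    pd c i (\<lambda>q. f q + g q) p = pd c i f p + pd c i g p"
  by (simp add: pd_def dif_def partial_add)

lemma pd_uminus: "p \<in> fst c \<Longrightarrow> dif c f p \<Longrightarrow> pd c i (\<lambda>q. - f q) p = - pd c i f p"
  by (simp add: pd_def dif_def partial_uminus)

lemma pd_mult: "p \<in> fst c \<Longrightarrow> dif c f p \<Longrightarrow> dif c g p \<Longrightarrow>
    pd c i (\<lambda>q. f q * g q) p = f p * pd c i g p + pd c i f p * g p"
  by (simp add: pd_def dif_def partial_mult)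

lemma pd_inverse: "p \<in> fst c \<Longrightarrow> dif c f p \<Longrightarrow> f p \<noteq> 0 \<Longrightarrow>
    pd c i (\<lambda>q. inverse (f q)) p = - (inverse (f p))\<^sup>2 * pd c i f p"
  by (simp add: pd_def dif_def partial_inverse)

lemma dif_const: "dif c (\<lambda>q. a) p"
  by (simp add: dif_def)

lemma dif_add: "dif c f p \<Longrightarrow> dif c g p \<Longrightarrow> dif c (\<lambda>q. f q + g q) p"
  by (simp add: dif_def)

lemma dif_uminus: "dif c f p \<Longrightarrow> dif c (\<lambda>q. - f q) p"
  by (simp add: dif_def)

lemma dif_mult: "dif c f p \<Longrightarrow> dif c g p \<Longrightarrow> dif c (\<lambda>q. f q * g q) p"
  by (simp add: dif_def)

lemma dif_inverse: "p \<in> fst c \<Longrightarrow> dif c f p \<Longrightarrow> f p \<noteq> 0 \<Longrightarrow> dif c (\<lambda>q. inverse (f q)) p"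
  unfolding dif_def by (rule differentiable_compose_real[OF _ DERIV_inverse]) auto

lemma dif_diff: "dif c f p \<Longrightarrow> dif c g p \<Longrightarrow> dif c (\<lambda>q. f q - g q) p"
  by (simp add: dif_def)

lemma pd_diff: "p \<in> fst c \<Longrightarrow> dif c f p \<Longrightarrow> dif c g p \<Longrightarrow>
    pd c i (\<lambda>q. f q - g q) p = pd c i f p - pd c i g p"
  using pd_add[of p f "\<lambda>q. - g q" i] by (simp add: dif_uminus pd_uminus)

lemma dif_power: "dif c f p \<Longrightarrow> dif c (\<lambda>q. f q ^ n) p"
  by (induction n) (simp_all add: dif_const dif_mult)

lemma pd_power2: "p \<in> fst c \<Longrightarrow> dif c f p \<Longrightarrow> pd c i (\<lambda>q. (f q)\<^sup>2) p = 2 * f p * pd c i f p"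
  by (simp add: power2_eq_square pd_mult)

lemma dif_divide_const: "dif c f p \<Longrightarrow> dif c (\<lambda>q. f q / a) p"
  using dif_mult[OF _ dif_const, of f p "inverse a"] by (simp add: divide_inverse)

lemma pd_divide_const: "p \<in> fst c \<Longrightarrow> dif c f p \<Longrightarrow> pd c i (\<lambda>q. f q / a) p = pd c i f p / a"
  using pd_mult[OF _ _ dif_const, of p f i "inverse a"] by (simp add: divide_inverse pd_const)

lemmas pd_rules = pd_const pd_add pd_uminus pd_mult pd_diff pd_inverse pd_power2 pd_divide_const
lemmas dif_rules = dif_const dif_add dif_uminus dif_mult dif_diff dif_inverse dif_power dif_divide_const

lemma pd_cong:
  assumes "open W" "p \<in> fst c \<inter> W" "\<And>q. q \<in> fst c \<inter> W \<Longrightarrow> f q = g q"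
  shows "pd c i f p = pd c i g p"
  unfolding pd_def
  by (rule partial_cong[OF open_chart_image[OF assms(1)]]) (use assms chart_inv_in in auto)

lemma smc_dif: "smc c W f \<Longrightarrow> open W \<Longrightarrow> p \<in> fst c \<inter> W \<Longrightarrow> dif c f p"
  unfolding smc_def dif_def using smooth_on_differentiable open_chart_image by blast

lemma smc_cong:
  assumes "open W" "smc c W f" "\<And>q. q \<in> fst c \<inter> W \<Longrightarrow> f q = g q"
  shows "smc c W g"
  unfolding smc_def smooth_on_def
proof
  fix k
  show "Ck_on k (\<lambda>x. g (chart_inv c x)) (snd c ` (fst c \<inter> W))"
    by (rule Ck_on_cong[OF open_chart_image[OF assms(1)], of "\<lambda>x. f (chart_inv c x)"])
       (use assms(2,3) in \<open>auto simp: smc_def smooth_on_def\<close>)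
qed

lemma smc_mono: "smc c W f \<Longrightarrow> V \<subseteq> W \<Longrightarrow> smc c V f"
  unfolding smc_def smooth_on_def by (meson Ck_on_subset Int_mono image_mono order_refl)

lemma smc_const: "smc c W (\<lambda>q. a)"
  by (simp add: smc_def smooth_on_def Ck_on_const)

lemma smc_add: "open W \<Longrightarrow> smc c W f \<Longrightarrow> smc c W g \<Longrightarrow> smc c W (\<lambda>q. f q + g q)"
  by (simp add: smc_def smooth_on_def Ck_on_add open_chart_image)

lemma smc_mult: "open W \<Longrightarrow> smc c W f \<Longrightarrow> smc c W g \<Longrightarrow> smc c W (\<lambda>q. f q * g q)"
  by (simp add: smc_def smooth_on_def Ck_on_mult open_chart_image)

lemma smc_uminus: "open W \<Longrightarrow> smc c W f \<Longrightarrow> smc c W (\<lambda>q. - f q)"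
  using smc_mult[of W "\<lambda>_. -1" f] by (simp add: smc_const)

lemma smc_diff: "open W \<Longrightarrow> smc c W f \<Longrightarrow> smc c W g \<Longrightarrow> smc c W (\<lambda>q. f q - g q)"
  using smc_add[of W f "\<lambda>q. - g q"] by (simp add: smc_uminus)

lemma smc_power: "open W \<Longrightarrow> smc c W f \<Longrightarrow> smc c W (\<lambda>q. f q ^ n)"
  by (induction n) (simp_all add: smc_const smc_mult)

lemma smc_inverse: "open W \<Longrightarrow> smc c W f \<Longrightarrow> (\<And>q. q \<in> fst c \<inter> W \<Longrightarrow> f q \<noteq> 0) \<Longrightarrow>
    smc c W (\<lambda>q. inverse (f q))"
  using chart_inv_in by (auto simp: smc_def smooth_on_def intro!: Ck_on_inverse open_chart_image)

lemma smc_sum: "open W \<Longrightarrow> (\<And>i. i \<in> I \<Longrightarrow> smc c W (f i)) \<Longrightarrow> smc c W (\<lambda>q. \<Sum>i\<in>I. f i q)"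
  by (induction I rule: infinite_finite_induct) (simp_all add: smc_const smc_add)

lemma smc_pd: "open W \<Longrightarrow> smc c W f \<Longrightarrow> smc c W (pd c i f)"
proof -
  assume W: "open W" and f: "smc c W f"
  let ?S = "snd c ` (fst c \<inter> W)"
  have *: "smooth_on (partial i (\<lambda>x. f (chart_inv c x))) ?S"
    using smooth_on_partial f by (auto simp: smc_def)
  show "smc c W (pd c i f)"
    unfolding smc_def smooth_on_def pd_def
  proof
    fix k
    show "Ck_on k (\<lambda>x. partial i (\<lambda>x. f (chart_inv c x)) (snd c (chart_inv c x))) ?S"
      by (rule Ck_on_cong[OF open_chart_image[OF W], of "partial i (\<lambda>x. f (chart_inv c x))"])
         (use * in \<open>auto simp: smooth_on_def\<close>)
  qed
qed

lemma pd_commute: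
  assumes "open W" "smc c W f" "p \<in> fst c \<inter> W"
  shows "pd c i (pd c j f) p = pd c j (pd c i f) p"
proof -
  let ?S = "snd c ` (fst c \<inter> W)"
  have "pd c k (pd c l f) p = partial k (partial l (\<lambda>x. f (chart_inv c x))) (snd c p)" for k l
    unfolding pd_def
    by (rule partial_cong[OF open_chart_image[OF assms(1)]]) (use assms(3) in auto)
  moreover have "partial i (partial j (\<lambda>x. f (chart_inv c x))) (snd c p) =
      partial j (partial i (\<lambda>x. f (chart_inv c x))) (snd c p)"
    by (rule partial_commute[OF _ open_chart_image[OF assms(1)]]) (use assms in \<open>auto simp: smc_def\<close>)
  ultimately show ?thesis by simp
qed

lemma smc_continuous: "smc c W f \<Longrightarrow> open W \<Longrightarrow> continuous_on (fst c \<inter> W) f"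
proof -
  assume f: "smc c W f" and W: "open W"
  have "continuous_on (fst c \<inter> W) (snd c)"
    using homeo by (auto simp: homeomorphism_def intro: continuous_on_subset)
  then have "continuous_on (fst c \<inter> W) (\<lambda>p. f (chart_inv c (snd c p)))"
    by (rule continuous_on_compose2[OF smooth_on_continuous[OF f[unfolded smc_def]]]) simp
  then show ?thesis by (rule continuous_on_eq) simp
qed

lemma pd_coordinate: "p \<in> fst c \<Longrightarrow> pd c i (\<lambda>q. snd c q $ k) p = (if i = k then 1 else 0)"
proof -
  assume p: "p \<in> fst c"
  have "pd c i (\<lambda>q. snd c q $ k) p = partial i (\<lambda>x. x $ k) (snd c p)"
    unfolding pd_def by (rule partial_cong[OF open_img]) (use p in auto)
  also have "\<dots> = axis i 1 $ k"
    by (rule partial_eqI) (auto intro: bounded_linear.has_derivative bounded_linear_vec_nth)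
  finally show ?thesis by (auto simp: axis_def)
qed

end

lemma differentiable_chain:
  fixes f :: "real^2 \<Rightarrow> real" and \<phi> :: "real^2 \<Rightarrow> real^2"
  assumes "f differentiable (at (\<phi> x))" "\<And>a. (\<lambda>x. \<phi> x $ a) differentiable (at x)"
  shows "(\<lambda>x. f (\<phi> x)) differentiable (at x)"
proof -
  have "(\<phi> has_derivative (\<lambda>v. \<chi> a. frechet_derivative (\<lambda>x. \<phi> x $ a) (at x) v)) (at x)"
    using assms(2)[THEN frechet_derivative_works[THEN iffD1]]
    by (subst has_derivative_componentwise_within)
       (auto simp: Basis_vec_def inner_axis)
  then have "\<phi> differentiable (at x)" by (auto simp: differentiable_def)
  from differentiable_chain_at[OF this assms(1)] show ?thesis by (simp add: comp_def)
qed

text \<open>Multiplicativity of the determinant, with the entries of the product left as sums to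
  which \<open>jac_inverse\<close> applies.\<close>

lemma det_mult_2:
  fixes J K :: "2 \<Rightarrow> 2 \<Rightarrow> real"
  shows "(J 1 1 * J 2 2 - J 1 2 * J 2 1) * (K 1 1 * K 2 2 - K 1 2 * K 2 1) =
    (\<Sum>a\<in>UNIV. J a 1 * K 1 a) * (\<Sum>a\<in>UNIV. J a 2 * K 2 a) -
    (\<Sum>a\<in>UNIV. J a 1 * K 2 a) * (\<Sum>a\<in>UNIV. J a 2 * K 1 a)"
  unfolding sum_2 by algebra

section \<open>Transition between two charts of the surface\<close>

locale surface =
  fixes M :: "'a::{t2_space,second_countable_topology} set" and A :: "'a chart set"
  assumes smooth_surface: "smooth_surface M A"
begin

lemma chart: "c \<in> A \<Longrightarrow> chart c"
  using smooth_surface by (auto simp: smooth_surface_def chart_def)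

lemma M_eq: "M = (\<Union>c\<in>A. fst c)"
  using smooth_surface by (auto simp: smooth_surface_def)

lemma open_M: "open M"
  unfolding M_eq using chart chart.open_dom by blast

text \<open>No invariance of F is required: the chart obtained is the one that \<open>scalar\<close>
  has chosen. \<open>scalar_eqI\<close> is the version for invariant F.\<close>

lemma scalar_cases:
  assumes "p \<in> M"
  obtains c where "c \<in> A" "p \<in> fst c" "scalar A F p = F c p"
proof -
  have "\<exists>c. c \<in> A \<and> p \<in> fst c" using assms M_eq by auto
  from someI_ex[OF this] show ?thesis
    by (intro that[of "SOME c. c \<in> A \<and> p \<in> fst c"]) (simp_all add: scalar_def)
qed

lemma scalar_eqI: "c \<in> A \<Longrightarrow> p \<in> fst c \<Longrightarrow> (\<And>d. d \<in> A \<Longrightarrow> p \<in> fst d \<Longrightarrow> F c p = F d p) \<Longrightarrow>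
    scalar A F p = F c p"
  using scalar_cases[of p F] M_eq by (metis UN_I)

lemma smc_coordinate: "c \<in> A \<Longrightarrow> d \<in> A \<Longrightarrow> smc c (fst d) (\<lambda>q. snd d q $ a)"
  using smooth_surface by (auto simp: smooth_surface_def smc_def)

lemma smc_jac: "c \<in> A \<Longrightarrow> d \<in> A \<Longrightarrow> smc c (fst d) (\<lambda>q. jac c d q a i)"
  unfolding jac_def using chart.smc_pd[OF chart] chart.open_dom[OF chart] smc_coordinate by blast

lemma dif_jac: "c \<in> A \<Longrightarrow> d \<in> A \<Longrightarrow> p \<in> fst c \<inter> fst d \<Longrightarrow> dif c (\<lambda>q. jac c d q a i) p"
  using chart.smc_dif[OF chart smc_jac chart.open_dom[OF chart]] by blast

lemma pd_jac_commute: "c \<in> A \<Longrightarrow> d \<in> A \<Longrightarrow> p \<in> fst c \<inter> fst d \<Longrightarrow>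
    pd c i (\<lambda>q. jac c d q a j) p = pd c j (\<lambda>q. jac c d q a i) p"
  unfolding jac_def
  using chart.pd_commute[OF chart chart.open_dom[OF chart] smc_coordinate] by blast

lemma pd_pd_jac_commute: "c \<in> A \<Longrightarrow> d \<in> A \<Longrightarrow> p \<in> fst c \<inter> fst d \<Longrightarrow>
    pd c k (pd c i (\<lambda>q. jac c d q a j)) p = pd c i (pd c k (\<lambda>q. jac c d q a j)) p"
  using chart.pd_commute[OF chart chart.open_dom[OF chart] smc_jac] by blast

lemma transition:
  assumes "c \<in> A" "d \<in> A" "p \<in> fst c \<inter> fst d" "dif d f p"
  shows dif_transition: "dif c f p"
    and pd_transition: "pd c i f p = (\<Sum>a\<in>UNIV. jac c d p a i * pd d a f p)"
proof -
  interpret c: chart c by (rule chart[OF assms(1)])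
  interpret d: chart d by (rule chart[OF assms(2)])
  let ?\<phi> = "\<lambda>x. snd d (chart_inv c x)"
  let ?S = "snd c ` (fst c \<inter> fst d)"
  have S: "open ?S" "snd c p \<in> ?S" using c.open_chart_image[OF d.open_dom] assms(3) by auto
  have eq: "f (chart_inv c x) = f (chart_inv d (?\<phi> x))" if "x \<in> ?S" for x
    using that by auto
  have d1: "(\<lambda>x. ?\<phi> x $ a) differentiable (at (snd c p))" for a
    using c.smc_dif[OF smc_coordinate[OF assms(1,2)] d.open_dom assms(3)] by (simp add: dif_def)
  have d2: "(\<lambda>x. f (chart_inv d x)) differentiable (at (?\<phi> (snd c p)))"
    using assms(3,4) by (simp add: dif_def)
  from differentiable_chain[OF d2 d1]
  have "(\<lambda>x. f (chart_inv c x)) differentiable (at (snd c p))"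
    unfolding differentiable_def
    using has_derivative_transform_within_open[OF _ S] eq by (metis (no_types, lifting))
  then show "dif c f p" by (simp add: dif_def)
  have "pd c i f p = partial i (\<lambda>x. f (chart_inv d (?\<phi> x))) (snd c p)"
    unfolding pd_def by (rule partial_cong[OF S]) (rule eq)
  also have "\<dots> = (\<Sum>a\<in>UNIV. partial a (\<lambda>x. f (chart_inv d x)) (?\<phi> (snd c p)) *
      partial i (\<lambda>x. ?\<phi> x $ a) (snd c p))"
    by (rule partial_chain[OF d2 d1])
  finally show "pd c i f p = (\<Sum>a\<in>UNIV. jac c d p a i * pd d a f p)"
    using assms(3) by (simp add: pd_def jac_def mult.commute)
qed

text \<open>This is the transition law of derivatives applied to a coordinate function of c
  itself.\<close>

lemma jac_inverse:
  assumes "c \<in> A" "d \<in> A" "p \<in> fst c \<inter> fst d"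
  shows "(\<Sum>a\<in>UNIV. jac c d p a i * jac d c p k a) = (if i = k then 1 else 0)"
proof -
  have p: "p \<in> fst d \<inter> fst c" using assms(3) by auto
  have "dif d (\<lambda>q. snd c q $ k) p"
    using chart.smc_dif[OF chart smc_coordinate chart.open_dom[OF chart]] assms(1,2) p by blast
  from pd_transition[OF assms this, of i] show ?thesis
    using chart.pd_coordinate[OF chart[OF assms(1)], of p i k] assms(3) by (simp add: jac_def)
qed

lemma det_jac_nonzero:
  assumes "c \<in> A" "d \<in> A" "p \<in> fst c \<inter> fst d"
  shows "jac c d p 1 1 * jac c d p 2 2 - jac c d p 1 2 * jac c d p 2 1 \<noteq> 0"
proof -
  have "(1::2) \<noteq> 2" by simp
  then have "(jac c d p 1 1 * jac c d p 2 2 - jac c d p 1 2 * jac c d p 2 1) *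
    (jac d c p 1 1 * jac d c p 2 2 - jac d c p 1 2 * jac d c p 2 1) = 1"
    unfolding det_mult_2 jac_inverse[OF assms] by (simp only: if_False if_True refl not_sym simp_thms)
  then show ?thesis by auto
qed

lemma smooth_funD: "smooth_fun A W f \<Longrightarrow> c \<in> A \<Longrightarrow> smc c W f"
  by (simp add: smooth_fun_def smc_def)

lemma smooth_funI: "(\<And>c. c \<in> A \<Longrightarrow> smc c W f) \<Longrightarrow> smooth_fun A W f"
  by (simp add: smooth_fun_def smc_def)

end

section \<open>Components of tensors\<close>

lemma idx_0 [simp]: "idx 0 = {[]}"
  by (auto simp: idx_def)

lemma idx_Suc: "idx (Suc n) = (\<lambda>(a, is). a # is) ` (UNIV \<times> idx n)"
  by (auto simp: idx_def length_Suc_conv image_iff)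

lemma sum_idx_Suc: "(\<Sum>is\<in>idx (Suc n). f is) = (\<Sum>a\<in>UNIV. \<Sum>is\<in>idx n. f (a # is))"
proof -
  have "inj_on (\<lambda>(a, is). a # is) (UNIV \<times> idx n)" by (auto simp: inj_on_def)
  then show ?thesis
    by (simp add: idx_Suc sum.reindex sum.cartesian_product case_prod_unfold comp_def)
qed

lemma sum_idx:
  "(\<Sum>is\<in>idx 1. f is) = (\<Sum>a\<in>UNIV. f [a])"
  "(\<Sum>is\<in>idx 2. f is) = (\<Sum>a\<in>UNIV. \<Sum>b\<in>UNIV. f [a, b])"
  "(\<Sum>is\<in>idx 3. f is) = (\<Sum>a\<in>UNIV. \<Sum>b\<in>UNIV. \<Sum>d\<in>UNIV. f [a, b, d])"
  "(\<Sum>is\<in>idx 4. f is) = (\<Sum>a\<in>UNIV. \<Sum>b\<in>UNIV. \<Sum>d\<in>UNIV. \<Sum>e\<in>UNIV. f [a, b, d, e])"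
  by (simp_all add: sum_idx_Suc numeral_eq_Suc)

lemma idx_iff:
  "is \<in> idx 1 \<longleftrightarrow> (\<exists>a. is = [a])"
  "is \<in> idx 2 \<longleftrightarrow> (\<exists>a b. is = [a, b])"
  "is \<in> idx 3 \<longleftrightarrow> (\<exists>a b d. is = [a, b, d])"
  by (auto simp: idx_def length_Suc_conv numeral_eq_Suc)

lemma tensor_field_1: "tensor_field A W 0 1 T \<longleftrightarrow>
    (\<forall>c\<in>A. \<forall>i. smc c W (\<lambda>p. T c p [] [i])) \<and>
    (\<forall>c\<in>A. \<forall>d\<in>A. \<forall>p\<in>fst c \<inter> fst d \<inter> W. \<forall>i.
       T c p [] [i] = (\<Sum>a\<in>UNIV. jac c d p a i * T d p [] [a]))"
proof -
  have 1: "(\<forall>ls\<in>idx 1. P ls) \<longleftrightarrow> (\<forall>i. P [i])" for P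
    by (auto simp: idx_def length_Suc_conv)
  show ?thesis unfolding tensor_field_def smc_def 1 sum_idx by simp
qed

lemma tensor_field_2: "tensor_field A W 0 2 T \<longleftrightarrow>
    (\<forall>c\<in>A. \<forall>i j. smc c W (\<lambda>p. T c p [] [i, j])) \<and>
    (\<forall>c\<in>A. \<forall>d\<in>A. \<forall>p\<in>fst c \<inter> fst d \<inter> W. \<forall>i j.
       T c p [] [i, j] = (\<Sum>a\<in>UNIV. \<Sum>b\<in>UNIV. jac c d p a i * jac c d p b j * T d p [] [a, b]))"
proof -
  have 1: "(\<forall>ls\<in>idx 2. P ls) \<longleftrightarrow> (\<forall>i j. P [i, j])" for P by (auto simp: idx_iff)
  show ?thesis unfolding tensor_field_def smc_def 1 sum_idx
    by (simp add: numeral_eq_Suc mult_ac)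
qed

lemma tensor_field_3: "tensor_field A W 0 3 T \<longleftrightarrow>
    (\<forall>c\<in>A. \<forall>i j k. smc c W (\<lambda>p. T c p [] [i, j, k])) \<and>
    (\<forall>c\<in>A. \<forall>d\<in>A. \<forall>p\<in>fst c \<inter> fst d \<inter> W. \<forall>i j k.
       T c p [] [i, j, k] = (\<Sum>a\<in>UNIV. \<Sum>b\<in>UNIV. \<Sum>e\<in>UNIV.
         jac c d p a i * jac c d p b j * jac c d p e k * T d p [] [a, b, e]))"
proof -
  have 1: "(\<forall>ls\<in>idx 3. P ls) \<longleftrightarrow> (\<forall>i j k. P [i, j, k])" for P by (auto simp: idx_iff)
  show ?thesis unfolding tensor_field_def smc_def 1 sum_idx
    by (simp add: numeral_eq_Suc mult_ac)
qed

lemma symmetrize_2: "symmetrize T c p us [i, j] = (T c p us [i, j] + T c p us [j, i]) / 2"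
proof -
  have 2: "{..<2::nat} = insert 1 (insert 0 {})" by auto
  have l: "length [i, j] = 2" by simp
  show ?thesis
    unfolding symmetrize_def l 2
    by (simp add: sum_over_permutations_insert permute_list_def Transposition.transpose_def numeral_2_eq_2 upt_rec)
qed

lemma symmetrize_3: "symmetrize T c p us [i, j, k] =
    (T c p us [i, j, k] + T c p us [i, k, j] + T c p us [j, i, k] + T c p us [j, k, i]
      + T c p us [k, i, j] + T c p us [k, j, i]) / 6"
proof -
  have 3: "{..<3::nat} = insert 2 (insert 1 (insert 0 {}))" by auto
  have l: "length [i, j, k] = 3" by simp
  show ?thesis
    unfolding symmetrize_def l 3
    by (simp add: sum_over_permutations_insert permute_list_def Transposition.transpose_def numeral_2_eq_2 upt_rec fact_numeral)
qed

text \<open>The two adjacent transpositions generate all permutations of three indices.\<close>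

lemma sym3_field_iff: "sym3_field A W \<Phi> \<longleftrightarrow> tensor_field A W 0 3 \<Phi> \<and>
    (\<forall>c\<in>A. \<forall>p\<in>fst c \<inter> W. \<forall>i j k. \<Phi> c p [] [i, j, k] = \<Phi> c p [] [j, i, k] \<and>
      \<Phi> c p [] [i, j, k] = \<Phi> c p [] [i, k, j])" (is "?L \<longleftrightarrow> ?R")
proof
  assume L: ?L
  have "Transposition.transpose 0 (1::nat) permutes {..<3}" "Transposition.transpose 1 (2::nat) permutes {..<3}"
    by (auto intro: permutes_swap_id)
  then have "\<Phi> c p [] (permute_list (Transposition.transpose 0 1) [i, j, k]) = \<Phi> c p [] [i, j, k]"
    "\<Phi> c p [] (permute_list (Transposition.transpose 1 2) [i, j, k]) = \<Phi> c p [] [i, j, k]"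
    if "c \<in> A" "p \<in> fst c \<inter> W" for c p i j k
    using L that unfolding sym3_field_def by (simp_all add: idx_iff)
  then show ?R using L unfolding sym3_field_def
    by (simp add: permute_list_def Transposition.transpose_def numeral_2_eq_2 upt_rec)
next
  assume R: ?R
  have "\<Phi> c p [] (permute_list \<pi> ls) = \<Phi> c p [] ls"
    if c: "c \<in> A" "p \<in> fst c \<inter> W" "ls \<in> idx 3" "\<pi> permutes {..<3}" for c p ls \<pi>
  proof -
    obtain i j k where ls: "ls = [i, j, k]" using c(3) by (auto simp: idx_iff)
    \<comment> \<open>Permutations need not be decomposed: the permuted list has the same multiset
      of entries, so it is one of six explicit lists.\<close>
    have "mset (permute_list \<pi> ls) = mset ls"
      using c(4) ls by (intro mset_permute_list) (simp add: numeral_3_eq_3)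
    moreover obtain i' j' k' where ls': "permute_list \<pi> ls = [i', j', k']"
      using ls by (metis idx_iff(3) c(3) idx_def length_permute_list mem_Collect_eq)
    ultimately have "{#i', j', k'#} = {#i, j, k#}" using ls by simp
    then have "[i', j', k'] \<in> {[i,j,k], [i,k,j], [j,i,k], [j,k,i], [k,i,j], [k,j,i]}"
      by (auto simp: add_eq_conv_ex)
    moreover have s: "\<Phi> c p [] [i, j, k] = \<Phi> c p [] [j, i, k]" "\<Phi> c p [] [i, j, k] = \<Phi> c p [] [i, k, j]" for i j k
      using R c(1,2) by blast+
    have "\<Phi> c p [] [k, i, j] = \<Phi> c p [] [i, j, k]" "\<Phi> c p [] [j, k, i] = \<Phi> c p [] [i, j, k]"
      "\<Phi> c p [] [k, j, i] = \<Phi> c p [] [i, j, k]"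
      using s(1)[of i k j] s(2)[of i j k] s(2)[of j i k] s(1)[of i j k] s(1)[of j k i] s(2)[of k i j]
      by simp_all
    ultimately have "\<Phi> c p [] [i', j', k'] = \<Phi> c p [] [i, j, k]"
      using s(1)[of i j k] s(2)[of i j k] by (elim insertE) simp_all
    then show ?thesis by (subst ls', subst ls)
  qed
  then show ?L using R by (simp add: sym3_field_def)
qed

section \<open>Symplectic connections in a chart\<close>

lemma matrix_inv_skew_2:
  fixes B :: "real^2^2"
  assumes "B $ 1 $ 1 = 0" "B $ 2 $ 2 = 0" "B $ 1 $ 2 = w" "B $ 2 $ 1 = - w" "w \<noteq> 0"
  shows "matrix_inv B $ 1 $ 1 = 0" "matrix_inv B $ 2 $ 2 = 0"
    "matrix_inv B $ 1 $ 2 = - inverse w" "matrix_inv B $ 2 $ 1 = inverse w"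
proof -
  define C :: "real^2^2" where
    "C = (\<chi> i j. if i = j then 0 else if i = 1 then - inverse w else inverse w)"
  have BC: "B ** C = mat 1" "C ** B = mat 1"
    using assms by (auto simp: C_def vec_eq_iff matrix_matrix_mult_def mat_def forall_2 sum_2)
  then have inv: "invertible B" by (auto simp: invertible_def)
  have "matrix_inv B = matrix_inv B ** (B ** C)" by (simp add: BC)
  also have "\<dots> = C"
    using someI_ex[OF inv[unfolded invertible_def]]
    by (simp add: matrix_mul_assoc matrix_inv_def)
  finally have "matrix_inv B = C" .
  then show "matrix_inv B $ 1 $ 1 = 0" "matrix_inv B $ 2 $ 2 = 0"
    "matrix_inv B $ 1 $ 2 = - inverse w" "matrix_inv B $ 2 $ 1 = inverse w"
    by (simp_all add: C_def)
qed

lemma cov_0_1: "cov G T c p [] [i, a] =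
    pd c i (\<lambda>q. T c q [] [a]) p - (\<Sum>m\<in>UNIV. G c p i a m * T c p [] [m])"
  by simp

lemma cov_0_2: "cov G T c p [] [i, a, b] =
    pd c i (\<lambda>q. T c q [] [a, b]) p
      - (\<Sum>m\<in>UNIV. G c p i a m * T c p [] [m, b]) - (\<Sum>m\<in>UNIV. G c p i b m * T c p [] [a, m])"
  by simp

lemma cov_0_3: "cov G T c p [] [i, a, b, e] =
    pd c i (\<lambda>q. T c q [] [a, b, e]) p
      - (\<Sum>m\<in>UNIV. G c p i a m * T c p [] [m, b, e]) - (\<Sum>m\<in>UNIV. G c p i b m * T c p [] [a, m, e])
      - (\<Sum>m\<in>UNIV. G c p i e m * T c p [] [a, b, m])"
  by simp

lemma cov_1_0: "cov G T c p [k] [i] =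
    pd c i (\<lambda>q. T c q [k] []) p + (\<Sum>m\<in>UNIV. G c p i m k * T c p [m] [])"
  by simp

lemma cov_1_1: "cov G T c p [k] [i, j] =
    pd c i (\<lambda>q. T c q [k] [j]) p + (\<Sum>m\<in>UNIV. G c p i m k * T c p [m] [j])
      - (\<Sum>m\<in>UNIV. G c p i j m * T c p [k] [m])"
  by simp

lemma raise_1: "raise \<Omega> T c p [i] ls = (\<Sum>a\<in>UNIV. up \<Omega> c p i a * T c p [] (a # ls))"
  by (simp add: raise_def sum_idx_Suc)

lemma raise_2: "raise \<Omega> T c p [i, j] ls =
    (\<Sum>a\<in>UNIV. up \<Omega> c p i a * (\<Sum>b\<in>UNIV. up \<Omega> c p j b * T c p [] (a # b # ls)))"
  by (simp add: raise_def sum_idx_Suc sum_distrib_left mult.assoc)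

lemma raise_3: "raise \<Omega> T c p [i, j, k] ls =
    (\<Sum>a\<in>UNIV. up \<Omega> c p i a * (\<Sum>b\<in>UNIV. up \<Omega> c p j b *
      (\<Sum>d\<in>UNIV. up \<Omega> c p k d * T c p [] (a # b # d # ls))))"
  by (simp add: raise_def sum_idx_Suc sum_distrib_left mult.assoc)

lemma raise_4: "raise \<Omega> T c p [i, j, k, l] ls =
    (\<Sum>a\<in>UNIV. up \<Omega> c p i a * (\<Sum>b\<in>UNIV. up \<Omega> c p j b *
      (\<Sum>d\<in>UNIV. up \<Omega> c p k d * (\<Sum>e\<in>UNIV. up \<Omega> c p l e * T c p [] (a # b # d # e # ls)))))"
  by (simp add: raise_def sum_idx_Suc sum_distrib_left mult.assoc)

lemma contract_2: "contract \<Omega> 2 S T c p =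
    (\<Sum>i\<in>UNIV. \<Sum>j\<in>UNIV. raise \<Omega> S c p [i, j] [] * T c p [] [i, j])"
  by (simp add: contract_def sum_idx)

lemma contract_3: "contract \<Omega> 3 S T c p =
    (\<Sum>i\<in>UNIV. \<Sum>j\<in>UNIV. \<Sum>k\<in>UNIV. raise \<Omega> S c p [i, j, k] [] * T c p [] [i, j, k])"
  by (simp add: contract_def sum_idx)

lemma contract_4: "contract \<Omega> 4 S T c p =
    (\<Sum>i\<in>UNIV. \<Sum>j\<in>UNIV. \<Sum>k\<in>UNIV. \<Sum>l\<in>UNIV. raise \<Omega> S c p [i, j, k, l] [] * T c p [] [i, j, k, l])"
  by (simp add: contract_def sum_idx)

text \<open>The contracted covariant exterior derivative \<open>\<nabla>\<^sub>2 R\<^sub>i\<^sub>1 - \<nabla>\<^sub>1 R\<^sub>i\<^sub>2\<close>, from which \<open>\<rho>\<close> and then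
  \<open>K\<close> arise in dimension two.\<close>

definition dric :: "'a connection \<Rightarrow> 'a tensor \<Rightarrow> 'a chart \<Rightarrow> 2 \<Rightarrow> 'a \<Rightarrow> real" where
  "dric G R c i p =
     pd c 2 (\<lambda>q. R c q [] [1, i]) p - pd c 1 (\<lambda>q. R c q [] [2, i]) p
     - (\<Sum>m\<in>UNIV. G c p 2 i m * R c p [] [1, m]) + (\<Sum>m\<in>UNIV. G c p 1 i m * R c p [] [2, m])"

locale symp_chart = chart c for c :: "'a::{t2_space,second_countable_topology} chart" +
  fixes W :: "'a set" and \<Omega> :: "'a tensor"
  assumes open_W: "open W"
    and smc_Omega: "smc c W (\<lambda>p. \<Omega> c p [] [i, j])"
    and Omega_skew: "p \<in> fst c \<inter> W \<Longrightarrow> \<Omega> c p [] [i, j] = - \<Omega> c p [] [j, i]"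
    and Omega_nz: "p \<in> fst c \<inter> W \<Longrightarrow> \<Omega> c p [] [1, 2] \<noteq> 0"
begin

text \<open>In dimension two this single nonvanishing component carries all of \<Omega>.\<close>

definition w :: "'a \<Rightarrow> real" where "w p = \<Omega> c p [] [1, 2]"

lemma w_nz: "p \<in> fst c \<inter> W \<Longrightarrow> w p \<noteq> 0"
  using Omega_nz by (simp add: w_def)

lemma smc_w: "smc c W w"
  unfolding w_def by (rule smc_Omega)

lemma Omega_eqs:
  assumes "p \<in> fst c \<inter> W"
  shows "\<Omega> c p [] [1, 1] = 0" "\<Omega> c p [] [2, 2] = 0" "\<Omega> c p [] [1, 2] = w p" "\<Omega> c p [] [2, 1] = - w p"
  using Omega_skew[OF assms, of 1 1] Omega_skew[OF assms, of 2 2] Omega_skew[OF assms, of 2 1]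
  by (simp_all add: w_def)

lemma up_eqs:
  assumes "p \<in> fst c \<inter> W"
  shows "up \<Omega> c p 1 1 = 0" "up \<Omega> c p 2 2 = 0" "up \<Omega> c p 1 2 = inverse (w p)" "up \<Omega> c p 2 1 = - inverse (w p)"
  using matrix_inv_skew_2[of "\<chi> a b. \<Omega> c p [] [a, b]" "w p"] Omega_eqs[OF assms] w_nz[OF assms]
  by (simp_all add: up_def)

lemma dif_smc: "smc c W f \<Longrightarrow> p \<in> fst c \<inter> W \<Longrightarrow> dif c f p"
  using smc_dif open_W by blast

lemmas smc_simps = smc_const smc_add[OF open_W] smc_mult[OF open_W] smc_uminus[OF open_W]
  smc_diff[OF open_W] smc_power[OF open_W] smc_inverse[OF open_W] smc_pd[OF open_W]
lemmas cong_W = pd_cong[OF open_W]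

end

section \<open>Curvature of a symplectic connection in one chart\<close>

locale symp_conn = symp_chart c W \<Omega> for c :: "'a::{t2_space,second_countable_topology} chart" and W \<Omega> +
  fixes G :: "'a connection"
  assumes smc_G: "smc c W (\<lambda>p. G c p i j k)"
    and G_sym: "p \<in> fst c \<inter> W \<Longrightarrow> G c p i j k = G c p j i k"
    and cov_Omega: "p \<in> fst c \<inter> W \<Longrightarrow> cov G \<Omega> c p [] [i, j, k] = 0"
begin

lemma G_sym_21: "p \<in> fst c \<inter> W \<Longrightarrow> G c p 2 1 k = G c p 1 2 k"
  by (rule G_sym)

text \<open>Parallelism of \<Omega> says exactly that the trace of the Christoffel symbols is the
  logarithmic derivative of w.\<close>

lemma pd_w:
  assumes "p \<in> fst c \<inter> W"
  shows "pd c i w p = w p * (G c p i 1 1 + G c p i 2 2)"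
proof -
  have "pd c i (\<lambda>q. \<Omega> c q [] [1, 2]) p = pd c i w p" by (simp add: w_def[abs_def])
  then show ?thesis
    using cov_Omega[OF assms, of i 1 2] Omega_eqs[OF assms] by (simp add: sum_2 algebra_simps)
qed

text \<open>By \<open>pd_w\<close> the trace of the Christoffel symbols is locally d log w, hence
  closed. This makes the curvature trace-free and the Ricci tensor symmetric.\<close>

lemma trace_closed:
  assumes p: "p \<in> fst c \<inter> W"
  shows "pd c 1 (\<lambda>q. G c q 2 1 1) p + pd c 1 (\<lambda>q. G c q 2 2 2) p
    = pd c 2 (\<lambda>q. G c q 1 1 1) p + pd c 2 (\<lambda>q. G c q 1 2 2) p"
proof -
  have "pd c j (pd c i w) p = w p * ((G c p j 1 1 + G c p j 2 2) * (G c p i 1 1 + G c p i 2 2)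
     + pd c j (\<lambda>q. G c q i 1 1) p + pd c j (\<lambda>q. G c q i 2 2) p)" for i j
  proof -
    have "pd c j (pd c i w) p = pd c j (\<lambda>q. w q * (G c q i 1 1 + G c q i 2 2)) p"
      by (rule cong_W[OF p]) (rule pd_w)
    also have "\<dots> = w p * ((G c p j 1 1 + G c p j 2 2) * (G c p i 1 1 + G c p i 2 2)
        + pd c j (\<lambda>q. G c q i 1 1) p + pd c j (\<lambda>q. G c q i 2 2) p)"
      using p by (simp add: pd_rules dif_rules dif_smc smc_w smc_G pd_w algebra_simps)
    finally show ?thesis .
  qed
  from this[of 1 2] this[of 2 1] pd_commute[OF open_W smc_w p, of 1 2]
  have "w p * (pd c 1 (\<lambda>q. G c q 2 1 1) p + pd c 1 (\<lambda>q. G c q 2 2 2) p)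
    = w p * (pd c 2 (\<lambda>q. G c q 1 1 1) p + pd c 2 (\<lambda>q. G c q 1 2 2) p)"
    by (simp add: algebra_simps)
  then show ?thesis using w_nz[OF p] by simp
qed

text \<open>Coordinate fields have constant components, so their first covariant derivatives are the
  Christoffel symbols. The term that contracts with \<open>G c p i j m\<close> is symmetric in i and
  j and drops out of the commutator.\<close>

lemma riem_eq:
  assumes p: "p \<in> fst c \<inter> W"
  shows "riem G c p i j q k = pd c i (\<lambda>r. G c r j q k) p - pd c j (\<lambda>r. G c r i q k) p
    + (\<Sum>m\<in>UNIV. G c p i m k * G c p j q m - G c p j m k * G c p i q m)"
proof -
  have 1: "cov G (coord_field q) c r [k] [j] = G c r j q k" if "r \<in> fst c \<inter> W" for r j k
    using that exhaust_2[of q] unfolding cov_1_0 coord_field_def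
    by (auto simp: pd_const sum_2)
  have 2: "cov G (cov G (coord_field q)) c p [k] [i, j] = pd c i (\<lambda>r. G c r j q k) p +
     (\<Sum>m\<in>UNIV. G c p i m k * G c p j q m) - (\<Sum>m\<in>UNIV. G c p i j m * G c p m q k)" for i j
  proof -
    have "pd c i (\<lambda>r. cov G (coord_field q) c r [k] [j]) p = pd c i (\<lambda>r. G c r j q k) p"
      by (rule cong_W[OF p]) (rule 1)
    then show ?thesis unfolding cov_1_1 1[OF p] by simp
  qed
  then show ?thesis
    unfolding riem_def 2 using G_sym[OF p, of i j] by (simp add: sum_subtractf)
qed


text \<open>Skewness in the first two indices leaves one matrix, indexed by the last two.
  \<open>trace_closed\<close> makes it trace-free, and its three free entries are those of the Ricci
  tensor.\<close>

lemma riem_ricci: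
  assumes p: "p \<in> fst c \<inter> W"
  shows "riem G c p 1 2 1 1 = ricci G c p [] [1, 2]" "riem G c p 1 2 1 2 = - ricci G c p [] [1, 1]"
    "riem G c p 1 2 2 1 = ricci G c p [] [2, 2]" "riem G c p 1 2 2 2 = - ricci G c p [] [1, 2]"
    "riem G c p 2 1 a b = - riem G c p 1 2 a b" "riem G c p 1 1 a b = 0" "riem G c p 2 2 a b = 0"
    "ricci G c p [] [2, 1] = ricci G c p [] [1, 2]"
proof -
  show anti: "riem G c p 2 1 a b = - riem G c p 1 2 a b" "riem G c p 1 1 a b = 0" "riem G c p 2 2 a b = 0"
    for a b unfolding riem_def by simp_all
  have tr: "riem G c p 1 2 1 1 + riem G c p 1 2 2 2 = 0"
    using trace_closed[OF p] by (simp add: riem_eq[OF p] sum_2 algebra_simps)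
  show "riem G c p 1 2 1 2 = - ricci G c p [] [1, 1]" "riem G c p 1 2 2 1 = ricci G c p [] [2, 2]"
    "riem G c p 1 2 2 2 = - ricci G c p [] [1, 2]"
    by (simp_all add: ricci_def sum_2 anti)
  show "riem G c p 1 2 1 1 = ricci G c p [] [1, 2]" "ricci G c p [] [2, 1] = ricci G c p [] [1, 2]"
    using tr by (simp_all add: ricci_def sum_2 anti)
qed

lemma smc_ricci: "smc c W (\<lambda>p. ricci G c p [] [i, j])"
proof -
  have "smc c W (\<lambda>p. \<Sum>q\<in>UNIV. pd c q (\<lambda>r. G c r i j q) p - pd c i (\<lambda>r. G c r q j q) p
    + (G c p q 1 q * G c p i j 1 - G c p i 1 q * G c p q j 1 + (G c p q 2 q * G c p i j 2 - G c p i 2 q * G c p q j 2)))"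
    by (intro smc_sum[OF open_W] smc_simps smc_G)
  then show ?thesis
    by (rule smc_cong[OF open_W]) (simp add: ricci_def riem_eq sum_2)
qed

lemma ricci_sym_21: "p \<in> fst c \<inter> W \<Longrightarrow> ricci G c p [] [2, 1] = ricci G c p [] [1, 2]"
  by (rule riem_ricci)

lemma ricci_sym: "p \<in> fst c \<inter> W \<Longrightarrow> ricci G c p [] [i, j] = ricci G c p [] [j, i]"
  using exhaust_2[of i] exhaust_2[of j] ricci_sym_21 by auto

lemma pd_ricci_21: "p \<in> fst c \<inter> W \<Longrightarrow>
    pd c i (\<lambda>q. ricci G c q [] [2, 1]) p = pd c i (\<lambda>q. ricci G c q [] [1, 2]) p"
  by (rule cong_W) (auto intro: ricci_sym_21)

lemma smc_cov_ricci: "smc c W (\<lambda>p. cov G (ricci G) c p [] [i, j, k])"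
  unfolding cov_0_2 sum_2 by (intro smc_simps smc_G smc_ricci)

lemma cov_ricci_sym: "p \<in> fst c \<inter> W \<Longrightarrow> cov G (ricci G) c p [] [i, 2, 1] = cov G (ricci G) c p [] [i, 1, 2]"
  unfolding cov_0_2 sum_2 by (simp add: pd_ricci_21 ricci_sym_21)

lemma smc_dric: "smc c W (dric G (ricci G) c i)"
  unfolding dric_def[abs_def] sum_2 by (intro smc_simps smc_G smc_ricci)

text \<open>The Christoffel symbols with lower indices 1 and 2 cancel by symmetry, so only those
  acting on the index i survive, as in an exterior derivative.\<close>

lemma dric_cov:
  assumes p: "p \<in> fst c \<inter> W"
  shows "dric G (ricci G) c i p = cov G (ricci G) c p [] [2, i, 1] - cov G (ricci G) c p [] [1, i, 2]"
proof -
  have "pd c k (\<lambda>q. ricci G c q [] [i, j]) p = pd c k (\<lambda>q. ricci G c q [] [j, i]) p" for k j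
    by (rule cong_W[OF p]) (rule ricci_sym)
  then show ?thesis
    unfolding dric_def cov_0_2 sum_2
    by (simp add: ricci_sym[OF p, of i] ricci_sym[OF p, of 2 1] G_sym[OF p, of 2 1])
qed

lemma rho_eq:
  assumes p: "p \<in> fst c \<inter> W"
  shows "rho \<Omega> G c p [] [i] = 2 * inverse (w p) * dric G (ricci G) c i p"
  unfolding rho_def dric_cov[OF p] raise_1 sum_2
  by (simp add: up_eqs[OF p] algebra_simps del: cov.simps)

lemma smc_rho: "smc c W (\<lambda>p. rho \<Omega> G c p [] [i])"
proof (rule smc_cong[OF open_W])
  show "smc c W (\<lambda>p. 2 * inverse (w p) * dric G (ricci G) c i p)"
    by (intro smc_simps smc_w smc_dric w_nz)
qed (simp add: rho_eq)

lemma riem_low_eqs: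
  assumes p: "p \<in> fst c \<inter> W"
  shows "riem_low \<Omega> G c p [] [1, 2, 1, 1] = w p * ricci G c p [] [1, 1]"
    "riem_low \<Omega> G c p [] [1, 2, 1, 2] = w p * ricci G c p [] [1, 2]"
    "riem_low \<Omega> G c p [] [1, 2, 2, 1] = w p * ricci G c p [] [1, 2]"
    "riem_low \<Omega> G c p [] [1, 2, 2, 2] = w p * ricci G c p [] [2, 2]"
    "riem_low \<Omega> G c p [] [2, 1, a, b] = - riem_low \<Omega> G c p [] [1, 2, a, b]"
    "riem_low \<Omega> G c p [] [1, 1, a, b] = 0" "riem_low \<Omega> G c p [] [2, 2, a, b] = 0"
  by (simp_all add: riem_low_def sum_2 riem_ricci[OF p] Omega_eqs[OF p])

text \<open>\<open>R\<^sub>i\<^sub>j\<^sub>k\<^sub>l = \<Omega>\<^sub>i\<^sub>j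
  R\<^sub>k\<^sub>l\<close> and
  \<open>\<Omega>\<^sup>i\<^sup>j \<Omega>\<^sub>i\<^sub>j = 2\<close>, so the full curvature
  contributes 1/4 * 2 = 1/2 of the square of Ricci.\<close>

lemma quadratic_curvature_vanishes:
  assumes p: "p \<in> fst c \<inter> W"
  shows "- 1 / 2 * contract \<Omega> 2 (ricci G) (ricci G) c p
     + 1 / 4 * contract \<Omega> 4 (riem_low \<Omega> G) (riem_low \<Omega> G) c p = 0"
  unfolding contract_2 contract_4 raise_2 raise_4 sum_2 up_eqs[OF p] riem_low_eqs[OF p] ricci_sym_21[OF p]
  using w_nz[OF p] by (simp add: field_simps)

text \<open>Only the double divergence of Ricci remains. Writing it as a curl of \<rho> over w
  reduces the invariance of K to the invariance of \<rho>, since a curl of a one-form involves no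
  Christoffel symbols.\<close>

lemma K_local:
  assumes p: "p \<in> fst c \<inter> W"
  shows "(\<Sum>i\<in>UNIV. \<Sum>j\<in>UNIV. raise \<Omega> (cov G (cov G (ricci G))) c p [i, j] [i, j])
     - 1 / 2 * contract \<Omega> 2 (ricci G) (ricci G) c p
     + 1 / 4 * contract \<Omega> 4 (riem_low \<Omega> G) (riem_low \<Omega> G) c p
   = inverse (w p) / 2 * (pd c 2 (\<lambda>q. rho \<Omega> G c q [] [1]) p - pd c 1 (\<lambda>q. rho \<Omega> G c q [] [2]) p)"
proof -
  let ?C = "cov G (ricci G)"
  have rho: "pd c k (\<lambda>q. rho \<Omega> G c q [] [i]) p =
      - 2 * inverse (w p) * (G c p k 1 1 + G c p k 2 2) * (?C c p [] [2, i, 1] - ?C c p [] [1, i, 2])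
      + 2 * inverse (w p) * (pd c k (\<lambda>q. ?C c q [] [2, i, 1]) p - pd c k (\<lambda>q. ?C c q [] [1, i, 2]) p)" for k i
  proof -
    have "pd c k (\<lambda>q. rho \<Omega> G c q [] [i]) p =
        pd c k (\<lambda>q. 2 * inverse (w q) * (?C c q [] [2, i, 1] - ?C c q [] [1, i, 2])) p"
      by (rule cong_W[OF p]) (simp add: rho_eq dric_cov del: cov.simps)
    also have "\<dots> = - 2 * inverse (w p) * (G c p k 1 1 + G c p k 2 2) * (?C c p [] [2, i, 1] - ?C c p [] [1, i, 2])
      + 2 * inverse (w p) * (pd c k (\<lambda>q. ?C c q [] [2, i, 1]) p - pd c k (\<lambda>q. ?C c q [] [1, i, 2]) p)"
      using p w_nz[OF p]
      by (simp add: pd_rules dif_rules dif_smc smc_w smc_cov_ricci pd_w power2_eq_square del: cov.simps)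
    finally show ?thesis .
  qed
  have C21: "?C c p [] [i, 2, 1] = ?C c p [] [i, 1, 2]" for i
    by (rule cov_ricci_sym[OF p])
  have dC21: "pd c k (\<lambda>q. ?C c q [] [i, 2, 1]) p = pd c k (\<lambda>q. ?C c q [] [i, 1, 2]) p" for k i
    by (rule cong_W[OF p]) (rule cov_ricci_sym)
  have "(\<Sum>i\<in>UNIV. \<Sum>j\<in>UNIV. raise \<Omega> (cov G ?C) c p [i, j] [i, j])
   = inverse (w p) / 2 * (pd c 2 (\<lambda>q. rho \<Omega> G c q [] [1]) p - pd c 1 (\<lambda>q. rho \<Omega> G c q [] [2]) p)"
    unfolding rho raise_2 sum_2 up_eqs[OF p] cov_0_3 C21 dC21 G_sym_21[OF p]
    by (simp add: algebra_simps del: cov.simps)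
  then show ?thesis using quadratic_curvature_vanishes[OF p] by simp
qed

end

section \<open>Changes of charts\<close>

definition curl :: "'a chart \<Rightarrow> (2 \<Rightarrow> 'a \<Rightarrow> real) \<Rightarrow> 'a \<Rightarrow> real" where
  "curl c \<alpha> p = pd c 1 (\<alpha> 2) p - pd c 2 (\<alpha> 1) p"

context surface
begin

definition jdet :: "'a chart \<Rightarrow> 'a chart \<Rightarrow> 'a \<Rightarrow> real" where
  "jdet c d p = jac c d p 1 1 * jac c d p 2 2 - jac c d p 1 2 * jac c d p 2 1"

lemma jdet_nz: "c \<in> A \<Longrightarrow> d \<in> A \<Longrightarrow> p \<in> fst c \<inter> fst d \<Longrightarrow> jdet c d p \<noteq> 0"
  unfolding jdet_def by (rule det_jac_nonzero)

text \<open>Naturality of the exterior derivative: the second derivatives of the coordinate change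
  are symmetric and cancel, leaving the Jacobian determinant.\<close>

lemma curl_transition:
  assumes cd: "c \<in> A" "d \<in> A" and W: "open W" and p: "p \<in> fst c \<inter> fst d \<inter> W"
    and law: "\<And>q i. q \<in> fst c \<inter> fst d \<inter> W \<Longrightarrow> \<alpha> i q = (\<Sum>a\<in>UNIV. jac c d q a i * \<beta> a q)"
    and dif: "\<And>a. dif d (\<beta> a) p"
  shows "curl c \<alpha> p = jdet c d p * curl d \<beta> p"
proof -
  interpret c: chart c by (rule chart[OF cd(1)])
  interpret d: chart d by (rule chart[OF cd(2)])
  have U: "open (fst d \<inter> W)" and p': "p \<in> fst c \<inter> (fst d \<inter> W)" "p \<in> fst c \<inter> fst d" "p \<in> fst c"
    using W d.open_dom p by auto
  have "pd c k (\<alpha> i) p = pd c k (\<lambda>q. \<Sum>a\<in>UNIV. jac c d q a i * \<beta> a q) p" for k i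
    by (rule c.pd_cong[OF U p'(1)]) (use law in auto)
  then have "pd c k (\<alpha> i) p = (\<Sum>a\<in>UNIV. jac c d p a i * (\<Sum>e\<in>UNIV. jac c d p e k * pd d e (\<beta> a) p)
      + pd c k (\<lambda>q. jac c d q a i) p * \<beta> a p)" for k i
    using p'(3)
    by (simp add: sum_2 c.pd_rules c.dif_rules dif_jac[OF cd p'(2)] dif_transition[OF cd p'(2) dif]
        pd_transition[OF cd p'(2) dif])
  then show ?thesis
    using pd_jac_commute[OF cd p'(2), of 1 _ 2]
    by (simp add: curl_def jdet_def sum_2 algebra_simps)
qed

end

locale symp_surface = surface M A for M :: "'a::{t2_space,second_countable_topology} set" and A +
  fixes \<Omega> :: "'a tensor"
  assumes symplectic_form: "symplectic_form A M \<Omega>"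
begin

lemma tensor_Omega: "tensor_field A M 0 2 \<Omega>"
  using symplectic_form by (simp add: symplectic_form_def)

lemma Omega_nonzero:
  assumes "c \<in> A" "p \<in> fst c"
  shows "\<Omega> c p [] [1, 2] \<noteq> 0"
proof
  assume 0: "\<Omega> c p [] [1, 2] = 0"
  have pM: "p \<in> fst c \<inter> M" using assms M_eq by auto
  have sk: "\<Omega> c p [] [i, j] = - \<Omega> c p [] [j, i]" for i j
    using symplectic_form assms(1) pM unfolding symplectic_form_def by blast
  have "\<Omega> c p [] [i, j] = 0" for i j
    using sk[of 1 1] sk[of 2 2] sk[of 2 1] 0 exhaust_2[of i] exhaust_2[of j] by auto
  then have "(\<chi> i j. \<Omega> c p [] [i, j]) = 0" by (simp add: vec_eq_iff)
  moreover have "invertible (\<chi> i j. \<Omega> c p [] [i, j])"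
    using symplectic_form assms(1) pM unfolding symplectic_form_def by blast
  ultimately have "invertible (0 :: real^2^2)" by simp
  then obtain B :: "real^2^2" where "0 ** B = mat 1" by (auto simp: invertible_def)
  then have "(0 ** B) $ 1 $ 1 = (mat 1 :: real^2^2) $ 1 $ 1" by simp
  then show False by (simp add: matrix_matrix_mult_def mat_def)
qed

lemma symp_chart:
  assumes "c \<in> A" "open W" "W \<subseteq> M"
  shows "symp_chart c W \<Omega>"
proof -
  interpret c: chart c by (rule chart[OF assms(1)])
  show ?thesis
  proof
    show "smc c W (\<lambda>p. \<Omega> c p [] [i, j])" for i j
      using tensor_Omega assms(1) c.smc_mono[OF _ assms(3)] by (simp add: tensor_field_2)
    show "\<Omega> c p [] [i, j] = - \<Omega> c p [] [j, i]" if "p \<in> fst c \<inter> W" for p i j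
    proof -
      have "p \<in> fst c \<inter> M" using that assms(3) by blast
      then show ?thesis using symplectic_form assms(1) unfolding symplectic_form_def by blast
    qed
    show "\<Omega> c p [] [1, 2] \<noteq> 0" if "p \<in> fst c \<inter> W" for p
      using Omega_nonzero[OF assms(1)] that by blast
  qed (rule assms(2))
qed

lemma symp_conn:
  assumes "c \<in> A" "open W" "W \<subseteq> M" "symplectic_connection A \<Omega> W G"
  shows "symp_conn c W \<Omega> G"
proof -
  interpret symp_chart c W \<Omega> by (rule symp_chart[OF assms(1-3)])
  show ?thesis
    by unfold_locales
       (use assms(1,4) in \<open>auto simp: symplectic_connection_def affine_connection_def smc_def\<close>)
qed

lemma Omega_transition:
  assumes cd: "c \<in> A" "d \<in> A" and p: "p \<in> fst c \<inter> fst d"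
  shows "\<Omega> c p [] [1, 2] = jdet c d p * \<Omega> d p [] [1, 2]"
proof -
  interpret d: symp_chart d M \<Omega> by (rule symp_chart[OF cd(2) open_M]) simp
  have pM: "p \<in> fst c \<inter> fst d \<inter> M" "p \<in> fst d \<inter> M" using p cd M_eq by auto
  have "\<Omega> c p [] [1, 2] = (\<Sum>a\<in>UNIV. \<Sum>b\<in>UNIV. jac c d p a 1 * jac c d p b 2 * \<Omega> d p [] [a, b])"
    using tensor_Omega cd pM unfolding tensor_field_2 by blast
  then show ?thesis by (simp add: jdet_def sum_2 d.Omega_eqs[OF pM(2)] algebra_simps)
qed

end

text \<open>The hypotheses are instances of \<open>riem_transition\<close> rewritten by
  \<open>riem_ricci\<close>: a, b, c, d are the Jacobian entries, y, x, z the Ricci components 11,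
  12, 22 in one chart and r, s, u those in the other. Cramer's rule isolates one component at a
  time; the determinant stays as a common factor and is cancelled by the caller.\<close>

lemma jacobian_solve:
  fixes a b c d :: real
  shows "x * a + - y * b = (a * d - b * c) * (a * s + c * u) \<Longrightarrow>
    x * c + - y * d = (a * d - b * c) * (a * - r + c * - s) \<Longrightarrow>
    (a * d - b * c) * y = (a * d - b * c) * (a * a * r + a * c * s + (c * a * s + c * c * u))"
  and "x * a + - y * b = (a * d - b * c) * (a * s + c * u) \<Longrightarrow>
    x * c + - y * d = (a * d - b * c) * (a * - r + c * - s) \<Longrightarrow>
    (a * d - b * c) * x = (a * d - b * c) * (a * b * r + a * d * s + (c * b * s + c * d * u))"
  and "z * a + - x * b = (a * d - b * c) * (b * s + d * u) \<Longrightarrow>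
    z * c + - x * d = (a * d - b * c) * (b * - r + d * - s) \<Longrightarrow>
    (a * d - b * c) * z = (a * d - b * c) * (b * b * r + b * d * s + (d * b * s + d * d * u))"
proof -
  have solve: "(a * d - b * c) * y = c * (x * a + - y * b) - a * (x * c + - y * d)"
    "(a * d - b * c) * x = d * (x * a + - y * b) - b * (x * c + - y * d)" for x y
    by (simp_all add: algebra_simps)
  show "x * a + - y * b = (a * d - b * c) * (a * s + c * u) \<Longrightarrow>
    x * c + - y * d = (a * d - b * c) * (a * - r + c * - s) \<Longrightarrow>
    (a * d - b * c) * y = (a * d - b * c) * (a * a * r + a * c * s + (c * a * s + c * c * u))"
    apply (subst solve(1)[of y x]) apply (simp only:) by (simp add: algebra_simps)
  show "x * a + - y * b = (a * d - b * c) * (a * s + c * u) \<Longrightarrow>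
    x * c + - y * d = (a * d - b * c) * (a * - r + c * - s) \<Longrightarrow>
    (a * d - b * c) * x = (a * d - b * c) * (a * b * r + a * d * s + (c * b * s + c * d * u))"
    apply (subst solve(2)[of x y]) apply (simp only:) by (simp add: algebra_simps)
  show "z * a + - x * b = (a * d - b * c) * (b * s + d * u) \<Longrightarrow>
    z * c + - x * d = (a * d - b * c) * (b * - r + d * - s) \<Longrightarrow>
    (a * d - b * c) * z = (a * d - b * c) * (b * b * r + b * d * s + (d * b * s + d * d * u))"
    apply (subst solve(2)[of z x]) apply (simp only:) by (simp add: algebra_simps)
qed

section \<open>Transformation laws of the curvature, the Ricci tensor, \<rho> and K\<close>

locale symp_overlap = symp_surface M A \<Omega> + c: symp_conn c W \<Omega> G + d: symp_conn d W \<Omega> G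
  for M :: "'a::{t2_space,second_countable_topology} set" and A \<Omega> W G c d +
  assumes c_in: "c \<in> A" and d_in: "d \<in> A" and conn: "symplectic_connection A \<Omega> W G"
begin

abbreviation J where "J p a i \<equiv> jac c d p a i"
abbreviation V where "V \<equiv> fst c \<inter> fst d \<inter> W"

lemma O_mem:
  assumes "p \<in> V"
  shows "p \<in> fst c" "p \<in> fst d" "p \<in> fst c \<inter> fst d" "p \<in> fst c \<inter> W" "p \<in> fst d \<inter> W"
    "p \<in> fst c \<inter> (fst d \<inter> W)"
  using assms by auto

lemma open_dW: "open (fst d \<inter> W)"
  using c.open_W d.open_dom by auto

lemma cong_O: "p \<in> V \<Longrightarrow> (\<And>q. q \<in> V \<Longrightarrow> f q = g q) \<Longrightarrow> pd c i f p = pd c i g p"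
  by (rule c.pd_cong[OF open_dW]) auto

lemma difs:
  assumes "p \<in> V"
  shows "dif c (\<lambda>q. J q a i) p" "smc d W f \<Longrightarrow> dif c f p" "smc c W f \<Longrightarrow> dif c f p"
    "smc d W f \<Longrightarrow> pd c i f p = (\<Sum>a\<in>UNIV. J p a i * pd d a f p)"
  using dif_jac[OF c_in d_in O_mem(3)[OF assms]] dif_transition[OF c_in d_in O_mem(3)[OF assms]]
    pd_transition[OF c_in d_in O_mem(3)[OF assms]] d.dif_smc c.dif_smc O_mem(4,5)[OF assms] by blast+

lemma christoffel:
  assumes "p \<in> V"
  shows "(\<Sum>k\<in>UNIV. G c p i j k * J p l k) = pd c i (\<lambda>q. J q l j) p +
          (\<Sum>a\<in>UNIV. \<Sum>b\<in>UNIV. J p a i * J p b j * G d p a b l)"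
  using conn c_in d_in assms unfolding symplectic_connection_def affine_connection_def by blast

lemma pd_J:
  assumes "p \<in> V"
  shows "pd c i (\<lambda>q. J q l j) p = (\<Sum>k\<in>UNIV. G c p i j k * J p l k) -
          (\<Sum>a\<in>UNIV. \<Sum>b\<in>UNIV. J p a i * J p b j * G d p a b l)"
  using christoffel[OF assms] by simp

lemma christoffel_derivative:
  assumes p: "p \<in> V"
  shows "(\<Sum>k\<in>UNIV. G c p i j k * pd c m (\<lambda>q. J q l k) p + pd c m (\<lambda>q. G c q i j k) p * J p l k) =
    pd c m (pd c i (\<lambda>q. J q l j)) p +
    (\<Sum>a\<in>UNIV. \<Sum>b\<in>UNIV. J p a i * J p b j * (\<Sum>e\<in>UNIV. J p e m * pd d e (\<lambda>q. G d q a b l) p)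
      + (J p a i * pd c m (\<lambda>q. J q b j) p + pd c m (\<lambda>q. J q a i) p * J p b j) * G d p a b l)"
proof -
  have "pd c m (\<lambda>p. \<Sum>k\<in>UNIV. G c p i j k * J p l k) p = pd c m (\<lambda>p. pd c i (\<lambda>q. J q l j) p +
          (\<Sum>a\<in>UNIV. \<Sum>b\<in>UNIV. J p a i * J p b j * G d p a b l)) p"
    by (rule cong_O[OF p christoffel])
  moreover have "dif c (pd c i (\<lambda>q. J q l j)) p"
    using c.smc_dif[OF c.smc_pd[OF d.open_dom smc_jac[OF c_in d_in]] d.open_dom O_mem(3)[OF p]] .
  ultimately show ?thesis
    using O_mem[OF p]
    by (simp add: sum_2 c.pd_rules c.dif_rules difs[OF p] c.smc_G d.smc_G)
qed

text \<open>Differentiate the law of the Christoffel symbols and antisymmetrize: third derivatives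
  of the coordinate change cancel because they commute, second derivatives are eliminated by
  \<open>pd_J\<close>.\<close>

lemma riem_transition:
  assumes p: "p \<in> V"
  shows "(\<Sum>k\<in>UNIV. riem G c p 1 2 j k * J p l k) = jdet c d p * (\<Sum>b\<in>UNIV. J p b j * riem G d p 1 2 b l)"
proof -
  have "pd c 1 (pd c 2 (\<lambda>q. J q l j)) p = pd c 2 (pd c 1 (\<lambda>q. J q l j)) p"
    by (rule pd_pd_jac_commute[OF c_in d_in O_mem(3)[OF p]])
  then show ?thesis
    using christoffel_derivative[OF p, of 2 j 1 l] christoffel_derivative[OF p, of 1 j 2 l]
    unfolding c.riem_eq[OF O_mem(4)[OF p]] d.riem_eq[OF O_mem(5)[OF p]] sum_2 pd_J[OF p] jdet_def
      c.G_sym_21[OF O_mem(4)[OF p]] d.G_sym_21[OF O_mem(5)[OF p]]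
    by (simp add: algebra_simps)
qed

lemma ricci_transition:
  assumes p: "p \<in> V"
  shows "ricci G c p [] [i, j] = (\<Sum>a\<in>UNIV. \<Sum>b\<in>UNIV. J p a i * J p b j * ricci G d p [] [a, b])"
proof -
  note rt = riem_transition[OF p]
  note rr = c.riem_ricci[OF O_mem(4)[OF p]] d.riem_ricci[OF O_mem(5)[OF p]]
  note sym = c.ricci_sym_21[OF O_mem(4)[OF p]] d.ricci_sym_21[OF O_mem(5)[OF p]]
  let ?r = "\<lambda>i j. \<Sum>a\<in>UNIV. \<Sum>b\<in>UNIV. J p a i * J p b j * ricci G d p [] [a, b]"
  have "jdet c d p * ricci G c p [] [1, 1] = jdet c d p * ?r 1 1"
    using rt[of 1 1] rt[of 1 2] unfolding sum_2 rr jdet_def by (rule jacobian_solve(1))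
  moreover have "jdet c d p * ricci G c p [] [1, 2] = jdet c d p * ?r 1 2"
    using rt[of 1 1] rt[of 1 2] unfolding sum_2 rr jdet_def by (rule jacobian_solve(2))
  moreover have "jdet c d p * ricci G c p [] [2, 2] = jdet c d p * ?r 2 2"
    using rt[of 2 1] rt[of 2 2] unfolding sum_2 rr jdet_def by (rule jacobian_solve(3))
  moreover have "?r 2 1 = ?r 1 2" unfolding sum_2 sym by (simp add: algebra_simps)
  ultimately show ?thesis
    using exhaust_2[of i] exhaust_2[of j] jdet_nz[OF c_in d_in O_mem(3)[OF p]] sym(1) by auto
qed

text \<open>Second derivatives of the coordinate change disappear in two ways: those attached to the
  index i against the inhomogeneous part of the Christoffel law (\<open>GR\<close>), those attached
  to the form index by symmetry (\<open>comm\<close>).\<close>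

lemma dric_transition:
  assumes p: "p \<in> V"
  shows "dric G (ricci G) c i p = jdet c d p * (\<Sum>a\<in>UNIV. J p a i * dric G (ricci G) d a p)"
proof -
  have R: "pd c k (\<lambda>q. ricci G c q [] [m, j]) p = (\<Sum>a\<in>UNIV. \<Sum>b\<in>UNIV.
      J p a m * J p b j * (\<Sum>e\<in>UNIV. J p e k * pd d e (\<lambda>q. ricci G d q [] [a, b]) p)
      + (J p a m * pd c k (\<lambda>q. J q b j) p + pd c k (\<lambda>q. J q a m) p * J p b j) * ricci G d p [] [a, b])"
    for k m j
  proof -
    have "pd c k (\<lambda>q. ricci G c q [] [m, j]) p =
      pd c k (\<lambda>q. \<Sum>a\<in>UNIV. \<Sum>b\<in>UNIV. J q a m * J q b j * ricci G d q [] [a, b]) p"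
      by (rule cong_O[OF p ricci_transition])
    also have "\<dots> = (\<Sum>a\<in>UNIV. \<Sum>b\<in>UNIV. J p a m * J p b j * pd c k (\<lambda>q. ricci G d q [] [a, b]) p
      + (J p a m * pd c k (\<lambda>q. J q b j) p + pd c k (\<lambda>q. J q a m) p * J p b j) * ricci G d p [] [a, b])"
      using O_mem(1)[OF p]
      by (simp add: sum_2 c.pd_rules c.dif_rules difs(1)[OF p] difs(2)[OF p d.smc_ricci])
    finally show ?thesis by (simp only: difs(4)[OF p d.smc_ricci])
  qed
  have GR: "(\<Sum>m\<in>UNIV. G c p k i m * ricci G c p [] [j, m]) = (\<Sum>a\<in>UNIV. \<Sum>b\<in>UNIV. J p a j * ricci G d p [] [a, b] *
      (pd c k (\<lambda>q. J q b i) p + (\<Sum>e\<in>UNIV. \<Sum>f\<in>UNIV. J p e k * J p f i * G d p e f b)))" for k j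
    unfolding ricci_transition[OF p] christoffel[OF p, symmetric]
    by (simp add: sum_2 algebra_simps)
  have comm: "pd c 2 (\<lambda>q. J q a 1) p = pd c 1 (\<lambda>q. J q a 2) p" for a
    by (rule pd_jac_commute[OF c_in d_in O_mem(3)[OF p]])
  show ?thesis
    unfolding dric_def R GR sum_2 comm jdet_def
      d.G_sym_21[OF O_mem(5)[OF p]] d.ricci_sym_21[OF O_mem(5)[OF p]] d.pd_ricci_21[OF O_mem(5)[OF p]]
    by (simp add: algebra_simps)
qed

lemma rho_transition:
  assumes p: "p \<in> V"
  shows "rho \<Omega> G c p [] [i] = (\<Sum>a\<in>UNIV. J p a i * rho \<Omega> G d p [] [a])"
proof -
  have "c.w p = jdet c d p * d.w p" "d.w p \<noteq> 0" "jdet c d p \<noteq> 0"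
    using Omega_transition[OF c_in d_in O_mem(3)[OF p]] d.w_nz[OF O_mem(5)[OF p]] jdet_nz[OF c_in d_in O_mem(3)[OF p]]
    by (simp_all add: c.w_def d.w_def)
  then show ?thesis
    unfolding c.rho_eq[OF O_mem(4)[OF p]] d.rho_eq[OF O_mem(5)[OF p]] dric_transition[OF p]
    by (simp add: sum_2 field_simps)
qed

lemma K_transition:
  assumes p: "p \<in> V"
  shows "curl c (\<lambda>i q. rho \<Omega> G c q [] [i]) p / c.w p = curl d (\<lambda>i q. rho \<Omega> G d q [] [i]) p / d.w p"
proof -
  have "c.w p = jdet c d p * d.w p" "jdet c d p \<noteq> 0"
    using Omega_transition[OF c_in d_in O_mem(3)[OF p]] jdet_nz[OF c_in d_in O_mem(3)[OF p]]
    by (simp_all add: c.w_def d.w_def)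
  moreover have "curl c (\<lambda>i q. rho \<Omega> G c q [] [i]) p = jdet c d p * curl d (\<lambda>i q. rho \<Omega> G d q [] [i]) p"
    by (rule curl_transition[OF c_in d_in c.open_W p rho_transition]) (assumption, rule d.dif_smc[OF d.smc_rho O_mem(5)[OF p]])
  ultimately show ?thesis by simp
qed

end

section \<open>Invariance of K, and the affine space of symplectic connections\<close>

context symp_surface
begin

text \<open>K is a quotient of two 2-forms, so its expression may be read off in any chart, not only
  in the one chosen by \<open>scalar\<close>.\<close>

lemma Kfun_eq:
  assumes W: "open W" "W \<subseteq> M" and G: "symplectic_connection A \<Omega> W G" and c: "c \<in> A" "p \<in> fst c \<inter> W"
  shows "Kfun A \<Omega> G p = - 1 / 2 * (curl c (\<lambda>i q. rho \<Omega> G c q [] [i]) p / \<Omega> c p [] [1, 2])"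
proof -
  let ?K = "\<lambda>c p. (\<Sum>i\<in>UNIV. \<Sum>j\<in>UNIV. raise \<Omega> (cov G (cov G (ricci G))) c p [i, j] [i, j])
     - 1 / 2 * contract \<Omega> 2 (ricci G) (ricci G) c p
     + 1 / 4 * contract \<Omega> 4 (riem_low \<Omega> G) (riem_low \<Omega> G) c p"
  have K: "?K d p = - 1 / 2 * (curl d (\<lambda>i q. rho \<Omega> G d q [] [i]) p / \<Omega> d p [] [1, 2])"
    if d: "d \<in> A" "p \<in> fst d" for d
  proof -
    interpret d: symp_conn d W \<Omega> G by (rule symp_conn[OF d(1) W G])
    have "p \<in> fst d \<inter> W" using d c by auto
    have "inverse w / 2 * (a - b) = - 1 / 2 * ((b - a) / w)" for w a b :: real
      by (cases "w = 0") (simp_all add: field_simps)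
    with d.K_local[OF \<open>p \<in> fst d \<inter> W\<close>] show ?thesis
      unfolding curl_def d.w_def by (rule trans)
  qed
  have "Kfun A \<Omega> G p = ?K c p"
    unfolding Kfun_def
  proof (rule scalar_eqI)
    fix d assume d: "d \<in> A" "p \<in> fst d"
    interpret symp_overlap M A \<Omega> W G c d
      by (intro symp_overlap.intro symp_overlap_axioms.intro symp_surface_axioms symp_conn assms d)
    show "?K c p = ?K d p"
      using K[OF d] K[of c] K_transition[of p] c d unfolding c.w_def d.w_def by auto
  qed (use c in auto)
  then show ?thesis using K c by auto
qed

lemma smooth_Kfun:
  assumes W: "open W" "W \<subseteq> M" and G: "symplectic_connection A \<Omega> W G"
  shows "smooth_fun A W (Kfun A \<Omega> G)"
proof (rule smooth_funI)
  fix c assume c: "c \<in> A"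
  interpret c: symp_conn c W \<Omega> G by (rule symp_conn[OF c W G])
  have "smc c W (\<lambda>p. - 1 / 2 * ((pd c 1 (\<lambda>q. rho \<Omega> G c q [] [2]) p - pd c 2 (\<lambda>q. rho \<Omega> G c q [] [1]) p) *
      inverse (c.w p)))"
    by (intro c.smc_simps c.smc_rho c.smc_w c.w_nz)
  then show "smc c W (Kfun A \<Omega> G)"
    by (rule c.smc_cong[OF W(1)]) (simp only: Kfun_eq[OF W G c] curl_def c.w_def divide_inverse)
qed

text \<open>The tensor law of \<open>\<Omega>\<^sup>k\<^sup>q\<close>, stated after contraction with
  a pulled-back covector because this is how it meets the last index of \<Phi> in
  \<open>translate\<close>.\<close>

lemma up_transition:
  assumes cd: "c \<in> A" "d \<in> A" and p: "p \<in> fst c \<inter> fst d"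
  shows "(\<Sum>k\<in>UNIV. (\<Sum>q\<in>UNIV. up \<Omega> c p k q * (\<Sum>e\<in>UNIV. jac c d p e q * \<beta> e)) * jac c d p l k)
    = (\<Sum>e\<in>UNIV. up \<Omega> d p l e * \<beta> e)"
proof -
  interpret c: symp_chart c M \<Omega> by (rule symp_chart[OF cd(1) open_M]) simp
  interpret d: symp_chart d M \<Omega> by (rule symp_chart[OF cd(2) open_M]) simp
  have pM: "p \<in> fst c \<inter> M" "p \<in> fst d \<inter> M" using p cd M_eq by auto
  have w: "c.w p = jdet c d p * d.w p" "d.w p \<noteq> 0" "jdet c d p \<noteq> 0"
    using Omega_transition[OF cd p] jdet_nz[OF cd p] d.w_nz[OF pM(2)]
    by (simp_all add: c.w_def d.w_def)
  show ?thesis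
    using exhaust_2[of l] w(2,3) unfolding sum_2
    by (auto simp: c.up_eqs[OF pM(1)] d.up_eqs[OF pM(2)] w(1) field_simps)
       (simp_all add: jdet_def algebra_simps)
qed

text \<open>Symmetry in the first two indices keeps the torsion zero, symmetry in the last two keeps
  \<Omega> parallel, and the tensor law of \<Phi> preserves the inhomogeneous Christoffel
  law.\<close>

lemma symplectic_connection_translate:
  assumes W: "open W" "W \<subseteq> M" and G: "symplectic_connection A \<Omega> W G" and \<Phi>: "sym3_field A W \<Phi>"
  shows "symplectic_connection A \<Omega> W (translate \<Omega> G t \<Phi>)"
proof -
  have T: "tensor_field A W 0 3 \<Phi>" using \<Phi> by (simp add: sym3_field_iff)
  have sym: "\<Phi> c p [] [i, j, k] = \<Phi> c p [] [j, i, k]" "\<Phi> c p [] [i, j, k] = \<Phi> c p [] [i, k, j]"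
    if "c \<in> A" "p \<in> fst c \<inter> W" for c p i j k
    using \<Phi> that unfolding sym3_field_iff by blast+
  show ?thesis
    unfolding symplectic_connection_def affine_connection_def
  proof (intro conjI ballI allI)
    fix c i j k assume c: "c \<in> A"
    interpret c: symp_conn c W \<Omega> G by (rule symp_conn[OF c W G])
    have s\<Phi>: "smc c W (\<lambda>p. \<Phi> c p [] [i, j, k])" for i j k
      using T c unfolding tensor_field_3 by blast
    have "smc c W (\<lambda>p. G c p i j 1 + t * (inverse (c.w p) * \<Phi> c p [] [i, j, 2]))"
      by (intro c.smc_simps c.smc_G c.smc_w c.w_nz s\<Phi>)
    then have 1: "smc c W (\<lambda>p. translate \<Omega> G t \<Phi> c p i j 1)"
      by (rule c.smc_cong[OF W(1)]) (simp add: translate_def sum_2 c.up_eqs)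
    have "smc c W (\<lambda>p. G c p i j 2 + (- t) * (inverse (c.w p) * \<Phi> c p [] [i, j, 1]))"
      by (intro c.smc_simps c.smc_G c.smc_w c.w_nz s\<Phi>)
    then have "smc c W (\<lambda>p. translate \<Omega> G t \<Phi> c p i j 2)"
      by (rule c.smc_cong[OF W(1)]) (simp add: translate_def sum_2 c.up_eqs)
    with 1 have "smc c W (\<lambda>p. translate \<Omega> G t \<Phi> c p i j k)"
      using exhaust_2[of k] by auto
    then show "smooth_on (\<lambda>x. translate \<Omega> G t \<Phi> c (chart_inv c x) i j k) (snd c ` (fst c \<inter> W))"
      by (simp add: smc_def)
  next
    fix c d p i j l assume c: "c \<in> A" and d: "d \<in> A" and p: "p \<in> fst c \<inter> fst d \<inter> W"
    interpret symp_overlap M A \<Omega> W G c d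
      by (intro symp_overlap.intro symp_overlap_axioms.intro symp_surface_axioms symp_conn W G c d)
    have law: "\<Phi> c p [] [i, j, q] = (\<Sum>e\<in>UNIV. J p e q * (\<Sum>a\<in>UNIV. \<Sum>b\<in>UNIV. J p a i * J p b j * \<Phi> d p [] [a, b, e]))" for q
    proof -
      have "\<Phi> c p [] [i, j, q] = (\<Sum>a\<in>UNIV. \<Sum>b\<in>UNIV. \<Sum>e\<in>UNIV.
         jac c d p a i * jac c d p b j * jac c d p e q * \<Phi> d p [] [a, b, e])"
        using T c d p unfolding tensor_field_3 by blast
      then show ?thesis by (simp add: sum_2 algebra_simps)
    qed
    have "(\<Sum>k\<in>UNIV. (\<Sum>q\<in>UNIV. up \<Omega> c p k q * \<Phi> c p [] [i, j, q]) * J p l k) =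
      (\<Sum>e\<in>UNIV. up \<Omega> d p l e * (\<Sum>a\<in>UNIV. \<Sum>b\<in>UNIV. J p a i * J p b j * \<Phi> d p [] [a, b, e]))"
      unfolding law by (rule up_transition[OF c d O_mem(3)[OF p]])
    then show "(\<Sum>k\<in>UNIV. translate \<Omega> G t \<Phi> c p i j k * J p l k) = pd c i (\<lambda>q. J q l j) p +
          (\<Sum>a\<in>UNIV. \<Sum>b\<in>UNIV. J p a i * J p b j * translate \<Omega> G t \<Phi> d p a b l)"
      using christoffel[OF p, of i j l] unfolding translate_def sum_2 by algebra
  next
    fix c p i j k assume c: "c \<in> A" and p: "p \<in> fst c \<inter> W"
    interpret c: symp_conn c W \<Omega> G by (rule symp_conn[OF c W G])
    show "translate \<Omega> G t \<Phi> c p i j k = translate \<Omega> G t \<Phi> c p j i k"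
      using c.G_sym[OF p, of i j k] sym(1)[OF c p, of i j] by (simp add: translate_def)
    have 0: "cov G \<Omega> c p [] [i, j, k] = 0" by (rule c.cov_Omega[OF p])
    have s: "\<Phi> c p [] [i, 2, 1] = \<Phi> c p [] [i, 1, 2]" by (rule sym(2)[OF c p])
    show "cov (translate \<Omega> G t \<Phi>) \<Omega> c p [] [i, j, k] = 0"
      using 0 exhaust_2[of j] exhaust_2[of k]
      unfolding cov_0_2 translate_def sum_2 c.up_eqs[OF p]
      by (auto simp: c.Omega_eqs[OF p] s algebra_simps)
  qed
qed

end

section \<open>Variations of a symplectic connection\<close>

lemma (in symp_conn) pd_G_21:
  "p \<in> fst c \<inter> W \<Longrightarrow> pd c i (\<lambda>q. G c q 2 1 k) p = pd c i (\<lambda>q. G c q 1 2 k) p"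
  by (rule cong_W) (auto intro: G_sym)

lemma ricci_pair: "ricci G c p us [i, j] = (\<Sum>q\<in>UNIV. riem G c p q i j q)"
  by (simp add: ricci_def)

locale symp_variation = symp_conn c W \<Omega> G
  for c :: "'a::{t2_space,second_countable_topology} chart" and W \<Omega> G +
  fixes \<Phi> :: "'a tensor"
  assumes smc_Phi: "smc c W (\<lambda>p. \<Phi> c p [] [i, j, k])"
    and Phi_sym: "p \<in> fst c \<inter> W \<Longrightarrow> \<Phi> c p [] [i, j, k] = \<Phi> c p [] [j, i, k]"
      "p \<in> fst c \<inter> W \<Longrightarrow> \<Phi> c p [] [i, j, k] = \<Phi> c p [] [i, k, j]"
    and conn_translate: "symp_conn c W \<Omega> (translate \<Omega> G t \<Phi>)"
begin

text \<open>The difference tensor \<open>\<Phi>\<^sub>i\<^sub>j\<^sup>k\<close> with its index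
  already raised, written out by means of w.\<close>

definition P :: "2 \<Rightarrow> 2 \<Rightarrow> 2 \<Rightarrow> 'a \<Rightarrow> real" where
  "P i j k p = (if k = 1 then inverse (w p) * \<Phi> c p [] [i, j, 2] else - inverse (w p) * \<Phi> c p [] [i, j, 1])"

lemma translate_eq: "p \<in> fst c \<inter> W \<Longrightarrow> translate \<Omega> G t \<Phi> c p i j k = G c p i j k + t * P i j k p"
  using exhaust_2[of k] by (auto simp: translate_def P_def sum_2 up_eqs)

lemma smc_P: "smc c W (P i j k)"
proof -
  have 1: "smc c W (\<lambda>p. inverse (w p) * \<Phi> c p [] [i, j, 2])"
    by (intro smc_simps smc_w w_nz smc_Phi)
  have 2: "smc c W (\<lambda>p. - inverse (w p) * \<Phi> c p [] [i, j, 1])"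
    by (intro smc_simps smc_w w_nz smc_Phi)
  have "smc c W (P i j 1)" "smc c W (P i j 2)"
    by (rule smc_cong[OF open_W 1], simp add: P_def) (rule smc_cong[OF open_W 2], simp add: P_def)
  then show ?thesis using exhaust_2[of k] by auto
qed

text \<open>Full symmetry of \<Phi> makes the difference tensor trace-free; used as rewrite rules,
  these equations leave four independent components.\<close>

lemma P_rules:
  assumes "p \<in> fst c \<inter> W"
  shows "P 2 1 k p = P 1 2 k p" "P 1 2 2 p = - P 1 1 1 p" "P 2 2 2 p = - P 1 2 1 p"
  using Phi_sym(1)[OF assms, of 2 1] Phi_sym(2)[OF assms, of 1 2 1] Phi_sym(2)[OF assms, of 2 2 1]
  by (simp_all add: P_def)

lemma pd_P_rules:
  assumes p: "p \<in> fst c \<inter> W"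
  shows "pd c i (P 2 1 k) p = pd c i (P 1 2 k) p" "pd c i (P 1 2 2) p = - pd c i (P 1 1 1) p"
    "pd c i (P 2 2 2) p = - pd c i (P 1 2 1) p"
proof -
  have "pd c i (P 1 2 2) p = pd c i (\<lambda>q. - P 1 1 1 q) p" "pd c i (P 2 2 2) p = pd c i (\<lambda>q. - P 1 2 1 q) p"
    by (rule cong_W[OF p], simp add: P_rules)+
  then show "pd c i (P 1 2 2) p = - pd c i (P 1 1 1) p" "pd c i (P 2 2 2) p = - pd c i (P 1 2 1) p"
    using p by (simp_all add: pd_uminus dif_smc smc_P)
  show "pd c i (P 2 1 k) p = pd c i (P 1 2 k) p"
    by (rule cong_W[OF p], rule P_rules, assumption)
qed

text \<open>\<open>S\<^sub>i\<^sub>j = \<nabla>\<^sub>k \<Phi>\<^sub>i\<^sub>j\<^sup>k\<close>, the first variation of the Ricci tensor, and its second variation.\<close>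

definition S :: "2 \<Rightarrow> 2 \<Rightarrow> 'a \<Rightarrow> real" where
  "S i j p = (\<Sum>k\<in>UNIV. pd c k (P i j k) p
     + (\<Sum>m\<in>UNIV. G c p k m k * P i j m p - G c p k i m * P m j k p - G c p k j m * P i m k p))"

definition T :: "2 \<Rightarrow> 2 \<Rightarrow> 'a \<Rightarrow> real" where
  "T i j p = - (\<Sum>k\<in>UNIV. \<Sum>m\<in>UNIV. P k i m p * P m j k p)"

lemma smc_S: "smc c W (S i j)"
  unfolding S_def[abs_def] sum_2 by (intro smc_simps smc_P smc_G)

lemma smc_T: "smc c W (T i j)"
  unfolding T_def[abs_def] sum_2 by (intro smc_simps smc_P)

lemma pd_translate:
  assumes p: "p \<in> fst c \<inter> W"
  shows "pd c l (\<lambda>q. translate \<Omega> G t \<Phi> c q i j k) p = pd c l (\<lambda>q. G c q i j k) p + t * pd c l (P i j k) p"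
proof -
  have "pd c l (\<lambda>q. translate \<Omega> G t \<Phi> c q i j k) p = pd c l (\<lambda>q. G c q i j k + t * P i j k q) p"
    by (rule cong_W[OF p]) (rule translate_eq)
  then show ?thesis using p by (simp add: pd_rules dif_rules dif_smc smc_G smc_P)
qed

text \<open>In general there would also be the gradient of the trace
  \<open>P\<^sub>k\<^sub>j\<^sup>k\<close> and a quadratic term containing it; both vanish by
  \<open>P_rules\<close>.\<close>

lemma ricci_translate:
  assumes p: "p \<in> fst c \<inter> W"
  shows "ricci (translate \<Omega> G t \<Phi>) c p [] [i, j] = ricci G c p [] [i, j] + t * S i j p + t\<^sup>2 * T i j p"
proof -
  interpret t: symp_conn c W \<Omega> "translate \<Omega> G t \<Phi>" by (rule conn_translate)
  note eqs = ricci_pair t.riem_eq[OF p] riem_eq[OF p] pd_translate[OF p] translate_eq[OF p] S_def T_def sum_2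
    P_rules[OF p] pd_P_rules[OF p] G_sym_21[OF p] pd_G_21[OF p]
  have "ricci (translate \<Omega> G t \<Phi>) c p [] [1, 1] = ricci G c p [] [1, 1] + t * S 1 1 p + t\<^sup>2 * T 1 1 p"
    by (simp only: eqs) (simp add: power2_eq_square algebra_simps)
  moreover have "ricci (translate \<Omega> G t \<Phi>) c p [] [1, 2] = ricci G c p [] [1, 2] + t * S 1 2 p + t\<^sup>2 * T 1 2 p"
    by (simp only: eqs) (simp add: power2_eq_square algebra_simps)
  moreover have "ricci (translate \<Omega> G t \<Phi>) c p [] [2, 1] = ricci G c p [] [2, 1] + t * S 2 1 p + t\<^sup>2 * T 2 1 p"
    by (simp only: eqs) (simp add: power2_eq_square algebra_simps)
  moreover have "ricci (translate \<Omega> G t \<Phi>) c p [] [2, 2] = ricci G c p [] [2, 2] + t * S 2 2 p + t\<^sup>2 * T 2 2 p"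
    by (simp only: eqs) (simp add: power2_eq_square algebra_simps)
  ultimately show ?thesis using exhaust_2[of i] exhaust_2[of j] by auto
qed

end

section \<open>Skew one-forms\<close>

locale killing = symp_surface M A \<Omega> for M :: "'a::{t2_space,second_countable_topology} set" and A \<Omega> +
  fixes D :: "'a connection" and Z :: "'a tensor" and \<gamma> \<nu> :: "'a \<Rightarrow> real" and Mhat :: "'a set"
  assumes connected_M: "connected M"
    and conn_D: "symplectic_connection A \<Omega> M D"
    and parallel: "parallel_ricci A M D"
    and tensor_Z: "tensor_field A M 0 1 Z"
    and skew: "\<forall>c\<in>A. \<forall>p\<in>fst c. \<forall>i j. symmetrize (cov D Z) c p [] [i, j] = 0"
    and gamma_eq: "\<gamma> = scalar A (\<lambda>c p. \<Sum>q\<in>UNIV. cov D (raise \<Omega> Z) c p [q] [q])"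
    and nu_eq: "\<nu> = (\<lambda>p. (\<gamma> p)\<^sup>2 + 4 * scalar A (\<lambda>c p. \<Sum>a\<in>UNIV. \<Sum>b\<in>UNIV.
               raise \<Omega> Z c p [a] [] * raise \<Omega> Z c p [b] [] * ricci D c p [] [a, b]) p)"
    and Mhat_eq: "Mhat = {p\<in>M. (\<gamma> p)\<^sup>2 \<noteq> \<nu> p}"

locale killing_chart = killing M A \<Omega> D Z \<gamma> \<nu> Mhat + symp_conn c M \<Omega> D
  for M :: "'a::{t2_space,second_countable_topology} set" and A \<Omega> D Z \<gamma> \<nu> Mhat c +
  assumes c_in: "c \<in> A"
begin

abbreviation z where "z i \<equiv> (\<lambda>p. Z c p [] [i])"

lemma dom_M: "p \<in> fst c \<Longrightarrow> p \<in> fst c \<inter> M"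
  using c_in M_eq by auto

lemma smc_z: "smc c M (z i)"
  using tensor_Z c_in unfolding tensor_field_1 by blast

lemma raise_Z:
  assumes "p \<in> fst c"
  shows "raise \<Omega> Z c p [1] [] = inverse (w p) * z 2 p" "raise \<Omega> Z c p [2] [] = - inverse (w p) * z 1 p"
  unfolding raise_1 sum_2 by (simp_all add: up_eqs[OF dom_M[OF assms]])

text \<open>As for K, writing the divergence as a curl over w makes the chart independence of
  \<gamma> an instance of \<open>curl_transition\<close>.\<close>

lemma div_Z:
  assumes "p \<in> fst c"
  shows "(\<Sum>q\<in>UNIV. cov D (raise \<Omega> Z) c p [q] [q]) = curl c z p / w p"
proof -
  note p = dom_M[OF assms]
  have 1: "pd c i (\<lambda>q. raise \<Omega> Z c q [1] []) p = pd c i (\<lambda>q. inverse (w q) * z 2 q) p" for i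
    by (rule cong_W[OF p]) (simp add: raise_Z)
  have 2: "pd c i (\<lambda>q. raise \<Omega> Z c q [2] []) p = pd c i (\<lambda>q. - inverse (w q) * z 1 q) p" for i
    by (rule cong_W[OF p]) (simp add: raise_Z)
  show ?thesis
    unfolding cov_1_0 sum_2 1 2 raise_Z[OF assms] curl_def
    using p w_nz[OF p]
    by (simp add: pd_rules dif_rules dif_smc smc_z smc_w pd_w G_sym_21[OF p] power2_eq_square)
       (simp add: field_simps)
qed

end

context killing
begin

lemma killing_chart: "c \<in> A \<Longrightarrow> killing_chart M A \<Omega> D Z \<gamma> \<nu> Mhat c"
  by (intro killing_chart.intro killing_chart_axioms.intro killing_axioms symp_conn open_M subset_refl conn_D)

lemma Z_transition:
  "c \<in> A \<Longrightarrow> d \<in> A \<Longrightarrow> p \<in> fst c \<inter> fst d \<Longrightarrow> Z c p [] [i] = (\<Sum>a\<in>UNIV. jac c d p a i * Z d p [] [a])"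
  using tensor_Z M_eq unfolding tensor_field_1 by blast

lemma gamma_curl:
  assumes c: "c \<in> A" "p \<in> fst c"
  shows "\<gamma> p = curl c (\<lambda>i q. Z c q [] [i]) p / \<Omega> c p [] [1, 2]"
proof -
  interpret c: killing_chart M A \<Omega> D Z \<gamma> \<nu> Mhat c by (rule killing_chart[OF c(1)])
  have "\<gamma> p = (\<Sum>q\<in>UNIV. cov D (raise \<Omega> Z) c p [q] [q])"
    unfolding gamma_eq
  proof (rule scalar_eqI[OF c])
    fix d assume d: "d \<in> A" "p \<in> fst d"
    interpret d: killing_chart M A \<Omega> D Z \<gamma> \<nu> Mhat d by (rule killing_chart[OF d(1)])
    have p: "p \<in> fst c \<inter> fst d" using c d by auto
    have "curl c c.z p = jdet c d p * curl d d.z p"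
      using p c.dom_M by (intro curl_transition[OF c(1) d(1) open_M] Z_transition c d d.dif_smc d.smc_z d.dom_M) auto
    then show "(\<Sum>q\<in>UNIV. cov D (raise \<Omega> Z) c p [q] [q]) = (\<Sum>q\<in>UNIV. cov D (raise \<Omega> Z) d p [q] [q])"
      unfolding c.div_Z[OF c(2)] d.div_Z[OF d(2)] c.w_def d.w_def Omega_transition[OF c(1) d(1) p]
      using jdet_nz[OF c(1) d(1) p] by simp
  qed
  then show ?thesis unfolding c.div_Z[OF c(2)] c.w_def .
qed

end

context killing_chart
begin

lemma gamma_w:
  assumes "p \<in> fst c"
  shows "\<gamma> p * w p = curl c z p"
  using gamma_curl[OF c_in assms] w_nz[OF dom_M[OF assms]] by (simp add: w_def)

lemma smc_gamma: "smc c M \<gamma>"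
proof (rule smc_cong[OF open_W])
  show "smc c M (\<lambda>p. (pd c 1 (z 2) p - pd c 2 (z 1) p) * inverse (w p))"
    by (intro smc_simps smc_z smc_w w_nz)
qed (simp add: gamma_curl[OF c_in] curl_def w_def divide_inverse)

text \<open>A skew tensor in dimension two is a multiple of \<Omega>. The multiple is half the curl
  over w, because the curl counts the 12-component of DZ twice.\<close>

lemma pd_z:
  assumes "p \<in> fst c"
  shows "pd c i (z j) p = (\<Sum>m\<in>UNIV. D c p i j m * z m p) + \<gamma> p / 2 * \<Omega> c p [] [i, j]"
proof -
  note p = dom_M[OF assms]
  have s: "cov D Z c p [] [i, j] + cov D Z c p [] [j, i] = 0" for i j
    using skew c_in assms unfolding symmetrize_2 by auto
  have "cov D Z c p [] [1, 2] - cov D Z c p [] [2, 1] = \<gamma> p * w p"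
    unfolding gamma_w[OF assms] cov_0_1 curl_def sum_2 by (simp add: G_sym_21[OF p])
  then have "cov D Z c p [] [i, j] = \<gamma> p / 2 * \<Omega> c p [] [i, j]"
    using s[of 1 2] s[of 1 1] s[of 2 2] exhaust_2[of i] exhaust_2[of j]
    by (auto simp: Omega_eqs[OF p] simp del: cov.simps)
  then show ?thesis unfolding cov_0_1 by simp
qed

text \<open>The integrability condition of \<open>pd_z\<close>: mixed second derivatives of the
  components of Z commute, and what remains is the curvature acting on Z against d\<gamma>.\<close>

lemma pd_gamma:
  assumes "p \<in> fst c"
  shows "pd c i \<gamma> p = 2 * inverse (w p) * (ricci D c p [] [i, 2] * z 1 p - ricci D c p [] [i, 1] * z 2 p)"
proof -
  note p = dom_M[OF assms]
  have pdpd: "pd c k (pd c i (z j)) p = (\<Sum>m\<in>UNIV. D c p i j m * pd c k (z m) p + pd c k (\<lambda>q. D c q i j m) p * z m p)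
      + \<gamma> p / 2 * pd c k (\<lambda>q. \<Omega> c q [] [i, j]) p + pd c k \<gamma> p / 2 * \<Omega> c p [] [i, j]" for k i j
  proof -
    have "pd c k (pd c i (z j)) p = pd c k (\<lambda>q. (\<Sum>m\<in>UNIV. D c q i j m * z m q) + 1 / 2 * \<gamma> q * \<Omega> c q [] [i, j]) p"
      by (rule cong_W[OF p]) (simp add: pd_z)
    then show ?thesis
      using p by (simp add: sum_2 pd_rules dif_rules dif_smc smc_z smc_G smc_gamma smc_Omega)
  qed
  have dO: "pd c k (\<lambda>q. \<Omega> c q [] [1, 1]) p = 0" "pd c k (\<lambda>q. \<Omega> c q [] [2, 2]) p = 0"
    "pd c k (\<lambda>q. \<Omega> c q [] [1, 2]) p = w p * (D c p k 1 1 + D c p k 2 2)"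
    "pd c k (\<lambda>q. \<Omega> c q [] [2, 1]) p = - w p * (D c p k 1 1 + D c p k 2 2)" for k
  proof -
    have "pd c k (\<lambda>q. \<Omega> c q [] [1, 1]) p = pd c k (\<lambda>q. 0) p" "pd c k (\<lambda>q. \<Omega> c q [] [2, 2]) p = pd c k (\<lambda>q. 0) p"
      "pd c k (\<lambda>q. \<Omega> c q [] [1, 2]) p = pd c k w p" "pd c k (\<lambda>q. \<Omega> c q [] [2, 1]) p = pd c k (\<lambda>q. - w q) p"
      by (rule cong_W[OF p], simp add: Omega_eqs)+
    then show "pd c k (\<lambda>q. \<Omega> c q [] [1, 1]) p = 0" "pd c k (\<lambda>q. \<Omega> c q [] [2, 2]) p = 0"
      "pd c k (\<lambda>q. \<Omega> c q [] [1, 2]) p = w p * (D c p k 1 1 + D c p k 2 2)"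
      "pd c k (\<lambda>q. \<Omega> c q [] [2, 1]) p = - w p * (D c p k 1 1 + D c p k 2 2)"
      using assms p by (simp_all add: pd_rules dif_smc smc_w pd_w)
  qed
  note comm = pd_commute[OF open_W smc_z p, of 1 2]
  have "w p * pd c 1 \<gamma> p = 2 * (riem D c p 1 2 1 1 * z 1 p + riem D c p 1 2 1 2 * z 2 p)"
    using comm[of 1] unfolding pdpd riem_eq[OF p] sum_2 pd_z[OF assms] dO Omega_eqs[OF p] G_sym_21[OF p] pd_G_21[OF p]
    by (simp add: algebra_simps)
  moreover have "w p * pd c 2 \<gamma> p = 2 * (riem D c p 1 2 2 1 * z 1 p + riem D c p 1 2 2 2 * z 2 p)"
    using comm[of 2] unfolding pdpd riem_eq[OF p] sum_2 pd_z[OF assms] dO Omega_eqs[OF p] G_sym_21[OF p] pd_G_21[OF p]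
    by (simp add: algebra_simps)
  ultimately show ?thesis
    using exhaust_2[of i] w_nz[OF p]
    by (auto simp: riem_ricci[OF p] field_simps)
qed

lemma pd_ricci:
  assumes "p \<in> fst c"
  shows "pd c k (\<lambda>q. ricci D c q [] [i, j]) p =
    (\<Sum>m\<in>UNIV. D c p k i m * ricci D c p [] [m, j] + D c p k j m * ricci D c p [] [i, m])"
proof -
  have "cov D (ricci D) c p [] [k, i, j] = 0"
    using parallel c_in dom_M[OF assms] unfolding parallel_ricci_def by blast
  then show ?thesis unfolding cov_0_2 by (simp add: sum.distrib)
qed

text \<open>The Ricci tensor is parallel, so in \<open>pd_gamma\<close> only Z is differentiated and
  D d\<gamma> = - \<gamma> Ric. The differential system for Z and \<gamma> is thereby
  closed.\<close>

lemma pd_pd_gamma: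
  assumes "p \<in> fst c"
  shows "pd c j (pd c i \<gamma>) p = (\<Sum>m\<in>UNIV. D c p j i m * pd c m \<gamma> p) - \<gamma> p * ricci D c p [] [j, i]"
proof -
  note p = dom_M[OF assms]
  have "pd c j (pd c i \<gamma>) p = pd c j (\<lambda>q. 2 * inverse (w q) *
      (ricci D c q [] [i, 2] * z 1 q - ricci D c q [] [i, 1] * z 2 q)) p"
    by (rule cong_W[OF p]) (simp add: pd_gamma)
  also have "\<dots> = 2 * inverse (w p) * (ricci D c p [] [i, 2] * pd c j (z 1) p
        + pd c j (\<lambda>q. ricci D c q [] [i, 2]) p * z 1 p
        - ricci D c p [] [i, 1] * pd c j (z 2) p - pd c j (\<lambda>q. ricci D c q [] [i, 1]) p * z 2 p)
      - (D c p j 1 1 + D c p j 2 2) * pd c i \<gamma> p"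
    using p w_nz[OF p] unfolding pd_gamma[OF assms]
    by (simp add: pd_rules dif_rules dif_smc smc_z smc_w smc_ricci pd_w power2_eq_square) (simp add: field_simps)
  also have "\<dots> = (\<Sum>m\<in>UNIV. D c p j i m * pd c m \<gamma> p) - \<gamma> p * ricci D c p [] [j, i]"
    using w_nz[OF p] exhaust_2[of i] exhaust_2[of j]
    unfolding pd_z[OF assms] pd_ricci[OF assms] sum_2 pd_gamma[OF assms]
    by (auto simp: Omega_eqs[OF p] ricci_sym_21[OF p] field_simps)
  finally show ?thesis .
qed

text \<open>Differentiation along the vector field \<open>Z\<^sup>i\<close>.\<close>

definition Zd :: "('a \<Rightarrow> real) \<Rightarrow> 'a \<Rightarrow> real" where
  "Zd f p = inverse (w p) * (z 2 p * pd c 1 f p - z 1 p * pd c 2 f p)"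

lemma smc_Zd: "open W \<Longrightarrow> W \<subseteq> M \<Longrightarrow> smc c W f \<Longrightarrow> smc c W (Zd f)"
  unfolding Zd_def[abs_def]
  using w_nz by (intro smc_mult smc_diff smc_inverse smc_pd smc_mono[OF smc_w] smc_mono[OF smc_z]) auto

lemma ricci_ZZ:
  assumes "p \<in> fst c"
  shows "(\<Sum>a\<in>UNIV. \<Sum>b\<in>UNIV. raise \<Omega> Z c p [a] [] * raise \<Omega> Z c p [b] [] * ricci D c p [] [a, b]) = - 1 / 2 * Zd \<gamma> p"
  unfolding sum_2 raise_Z[OF assms] Zd_def pd_gamma[OF assms]
  using w_nz[OF dom_M[OF assms]] ricci_sym_21[OF dom_M[OF assms]] by (simp add: field_simps)

end

context killing
begin

lemma Zd_transition:
  assumes c: "c \<in> A" "p \<in> fst c" and d: "d \<in> A" "p \<in> fst d" and f: "dif d f p"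
  shows "killing_chart.Zd \<Omega> Z c f p = killing_chart.Zd \<Omega> Z d f p"
proof -
  interpret c: killing_chart M A \<Omega> D Z \<gamma> \<nu> Mhat c by (rule killing_chart[OF c(1)])
  interpret d: killing_chart M A \<Omega> D Z \<gamma> \<nu> Mhat d by (rule killing_chart[OF d(1)])
  have p: "p \<in> fst c \<inter> fst d" using c d by auto
  have w: "c.w p = jdet c d p * d.w p" "d.w p \<noteq> 0" "jdet c d p \<noteq> 0"
    using Omega_transition[OF c(1) d(1) p] jdet_nz[OF c(1) d(1) p] d.w_nz[OF d.dom_M[OF d(2)]]
    by (simp_all add: c.w_def d.w_def)
  have zd: "c.z 2 p * pd c 1 f p - c.z 1 p * pd c 2 f p = jdet c d p * (d.z 2 p * pd d 1 f p - d.z 1 p * pd d 2 f p)"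
    unfolding Z_transition[OF c(1) d(1) p] pd_transition[OF c(1) d(1) p f] sum_2 jdet_def
    by (simp add: algebra_simps)
  show ?thesis unfolding c.Zd_def d.Zd_def zd w(1) using w(2,3) by simp
qed

text \<open>All later statements about \<nu> go through this form: smoothness, constancy and the
  relation between \<nu> - \<gamma>^2 and the derivative of \<gamma> along Z.\<close>

lemma nu_Zd:
  assumes c: "c \<in> A" "p \<in> fst c"
  shows "\<nu> p = (\<gamma> p)\<^sup>2 - 2 * killing_chart.Zd \<Omega> Z c \<gamma> p"
proof -
  interpret c: killing_chart M A \<Omega> D Z \<gamma> \<nu> Mhat c by (rule killing_chart[OF c(1)])
  have "scalar A (\<lambda>c p. \<Sum>a\<in>UNIV. \<Sum>b\<in>UNIV.
      raise \<Omega> Z c p [a] [] * raise \<Omega> Z c p [b] [] * ricci D c p [] [a, b]) p = - 1 / 2 * c.Zd \<gamma> p"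
    unfolding c.ricci_ZZ[OF c(2), symmetric]
  proof (rule scalar_eqI[OF c])
    fix d assume d: "d \<in> A" "p \<in> fst d"
    interpret d: killing_chart M A \<Omega> D Z \<gamma> \<nu> Mhat d by (rule killing_chart[OF d(1)])
    show "(\<Sum>a\<in>UNIV. \<Sum>b\<in>UNIV. raise \<Omega> Z c p [a] [] * raise \<Omega> Z c p [b] [] * ricci D c p [] [a, b]) =
      (\<Sum>a\<in>UNIV. \<Sum>b\<in>UNIV. raise \<Omega> Z d p [a] [] * raise \<Omega> Z d p [b] [] * ricci D d p [] [a, b])"
      unfolding c.ricci_ZZ[OF c(2)] d.ricci_ZZ[OF d(2)]
      using Zd_transition[OF c d d.dif_smc[OF d.smc_gamma d.dom_M[OF d(2)]]] by simp
  qed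
  then show ?thesis unfolding nu_eq by simp
qed

end

section \<open>Constancy of \<nu>\<close>

lemma (in surface) chart_at: "p \<in> M \<Longrightarrow> \<exists>c\<in>A. p \<in> fst c"
  by (simp add: M_eq)

text \<open>A vanishing derivative makes f constant on the preimage of a ball in a chart, by
  convexity; connectedness of M does the rest.\<close>

lemma (in surface) constant_on_if_pd_zero:
  assumes "connected M" "\<And>c p. c \<in> A \<Longrightarrow> p \<in> fst c \<Longrightarrow> dif c f p"
    and "\<And>c p i. c \<in> A \<Longrightarrow> p \<in> fst c \<Longrightarrow> pd c i f p = 0"
  shows "f constant_on M"
proof -
  have "\<forall>\<^sub>F q in at p within M. f p = f q" if "p \<in> M" for p
  proof -
    obtain c where c: "c \<in> A" "p \<in> fst c" using \<open>p \<in> M\<close> chart_at by blast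
    interpret c: chart c by (rule chart[OF c(1)])
    obtain r where r: "r > 0" "ball (snd c p) r \<subseteq> snd c ` fst c"
      using c.open_img c(2) by (meson image_eqI openE)
    let ?B = "ball (snd c p) r"
    have "((\<lambda>x. f (chart_inv c x)) has_derivative (\<lambda>h. 0)) (at x within ?B)" if x: "x \<in> ?B" for x
    proof -
      have q: "chart_inv c x \<in> fst c" "snd c (chart_inv c x) = x" using x r by auto
      have "(\<lambda>x. f (chart_inv c x)) differentiable (at x)"
        using assms(2)[OF c(1) q(1)] q by (simp add: dif_def)
      from partial_has_derivative[OF this]
      have "((\<lambda>x. f (chart_inv c x)) has_derivative (\<lambda>v. 0)) (at x)"
        using assms(3)[OF c(1) q(1)] q by (simp add: pd_def)
      then show ?thesis by (rule has_derivative_at_withinI)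
    qed
    then obtain k where k: "\<And>x. x \<in> ?B \<Longrightarrow> f (chart_inv c x) = k"
      using has_derivative_zero_constant[of ?B "\<lambda>x. f (chart_inv c x)"] by auto
    have const: "f q = f p" if "q \<in> fst c" "snd c q \<in> ?B" for q
      using k[of "snd c q"] k[of "snd c p"] that c(2) r(1) by simp
    have "continuous_on (fst c) (snd c)" using c.homeo by (simp add: homeomorphism_def)
    then have "open (snd c -` ?B \<inter> fst c)"
      using c.open_dom by (simp add: continuous_on_open_vimage)
    moreover have "p \<in> snd c -` ?B \<inter> fst c" using c(2) r(1) by simp
    ultimately show ?thesis
      unfolding eventually_at_topological by (intro exI[of _ "snd c -` ?B \<inter> fst c"]) (auto dest: const)
  qed
  then have "\<forall>a\<in>M. \<forall>b\<in>M. f a = f b" using connected_local_const[OF assms(1)] by blast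
  then show ?thesis unfolding constant_on_def by blast
qed

context killing_chart
begin

lemma smc_nu: "smc c M \<nu>"
proof (rule smc_cong[OF open_W])
  show "smc c M (\<lambda>p. (\<gamma> p)\<^sup>2 - 2 * Zd \<gamma> p)"
    by (intro smc_simps smc_gamma smc_Zd open_M subset_refl)
qed (simp add: nu_Zd[OF c_in])

text \<open>Two equal contributions of \<gamma>/2 d\<gamma>: the Hessian - \<gamma> Ric contracted
  with Z, and DZ contracted with d\<gamma>. Hence \<gamma>^2 - 2 Z(\<gamma>) has zero
  differential.\<close>

lemma pd_Zd_gamma:
  assumes "p \<in> fst c"
  shows "pd c i (Zd \<gamma>) p = \<gamma> p * pd c i \<gamma> p"
proof -
  note p = dom_M[OF assms]
  have "pd c i (Zd \<gamma>) p = inverse (w p) * (z 2 p * pd c i (pd c 1 \<gamma>) p + pd c i (z 2) p * pd c 1 \<gamma> p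
      - z 1 p * pd c i (pd c 2 \<gamma>) p - pd c i (z 1) p * pd c 2 \<gamma> p)
      - inverse (w p) * (D c p i 1 1 + D c p i 2 2) * (z 2 p * pd c 1 \<gamma> p - z 1 p * pd c 2 \<gamma> p)"
    unfolding Zd_def[abs_def] using p w_nz[OF p] smc_pd[OF open_W smc_gamma]
    by (simp add: pd_rules dif_rules dif_smc smc_z smc_w smc_gamma pd_w power2_eq_square) (simp add: field_simps)
  also have "\<dots> = \<gamma> p * pd c i \<gamma> p"
    unfolding pd_pd_gamma[OF assms] pd_z[OF assms] sum_2
    using w_nz[OF p] exhaust_2[of i]
    by (auto simp: Omega_eqs[OF p] pd_gamma[OF assms] ricci_sym_21[OF p] G_sym_21[OF p] field_simps)
  finally show ?thesis .
qed

lemma pd_nu: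
  assumes "p \<in> fst c"
  shows "pd c i \<nu> p = 0"
proof -
  note p = dom_M[OF assms]
  have "pd c i \<nu> p = pd c i (\<lambda>p. (\<gamma> p)\<^sup>2 - 2 * Zd \<gamma> p) p"
    by (rule cong_W[OF p]) (simp add: nu_Zd[OF c_in])
  also have "\<dots> = 0"
    using p smc_Zd[OF open_M subset_refl smc_gamma]
    by (simp add: pd_rules dif_rules dif_smc smc_gamma pd_Zd_gamma)
  finally show ?thesis .
qed

end

lemma smooth_fun_Int: "open V \<Longrightarrow> V \<subseteq> W \<Longrightarrow> smooth_fun A W f \<Longrightarrow> smooth_fun A V f"
  unfolding smooth_fun_def smooth_on_def by (meson Ck_on_subset Int_mono image_mono order_refl)

lemma (in surface) open_nonzero:
  assumes "open W" "W \<subseteq> M" "smooth_fun A W f"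
  shows "open {p \<in> W. f p \<noteq> 0}"
proof -
  have "open {p \<in> fst c \<inter> W. f p \<noteq> 0}" if c: "c \<in> A" for c
  proof -
    interpret c: chart c by (rule chart[OF c])
    have "continuous_on (fst c \<inter> W) f"
      by (rule c.smc_continuous[OF smooth_funD[OF assms(3) c] assms(1)])
    then have "open (f -` (- {0}) \<inter> (fst c \<inter> W))"
      using c.open_dom assms(1) by (intro continuous_on_open_vimage[THEN iffD1, rule_format]) auto
    moreover have "f -` (- {0}) \<inter> (fst c \<inter> W) = {p \<in> fst c \<inter> W. f p \<noteq> 0}" by auto
    ultimately show ?thesis by simp
  qed
  then have "open (\<Union>c\<in>A. {p \<in> fst c \<inter> W. f p \<noteq> 0})" by blast
  moreover have "(\<Union>c\<in>A. {p \<in> fst c \<inter> W. f p \<noteq> 0}) = {p \<in> W. f p \<noteq> 0}"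
    using assms(2) M_eq by auto
  ultimately show ?thesis by simp
qed

section \<open>The connections \<open>D + t \<Gamma>\<close>\<close>

context killing
begin

lemma smooth_gamma: "smooth_fun A M \<gamma>"
  by (rule smooth_funI) (use killing_chart killing_chart.smc_gamma in blast)

lemma smooth_nu: "smooth_fun A M \<nu>"
  by (rule smooth_funI) (use killing_chart killing_chart.smc_nu in blast)

lemma nu_constant: "\<nu> constant_on M"
proof (rule constant_on_if_pd_zero[OF connected_M])
  fix c p i assume c: "c \<in> A" "p \<in> fst c"
  interpret c: killing_chart M A \<Omega> D Z \<gamma> \<nu> Mhat c by (rule killing_chart[OF c(1)])
  show "dif c \<nu> p" by (rule c.dif_smc[OF c.smc_nu c.dom_M[OF c(2)]])
  show "pd c i \<nu> p = 0" for i by (rule c.pd_nu[OF c(2)])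
qed

definition y :: "'a \<Rightarrow> real" where "y p = inverse (\<nu> p - (\<gamma> p)\<^sup>2)"

definition Gam :: "'a tensor" where
  "Gam c p us ls = y p * Z c p [] [ls ! 0] * Z c p [] [ls ! 1] * Z c p [] [ls ! 2]"

abbreviation nabla where "nabla t \<equiv> translate \<Omega> D t Gam"

lemma open_Mhat: "open Mhat" and Mhat_M: "Mhat \<subseteq> M"
proof -
  have "smooth_fun A M (\<lambda>p. \<nu> p - (\<gamma> p)\<^sup>2)"
  proof (rule smooth_funI)
    fix c assume c: "c \<in> A"
    interpret c: killing_chart M A \<Omega> D Z \<gamma> \<nu> Mhat c by (rule killing_chart[OF c])
    show "smc c M (\<lambda>p. \<nu> p - (\<gamma> p)\<^sup>2)" by (intro c.smc_simps c.smc_nu c.smc_gamma)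
  qed
  from open_nonzero[OF open_M subset_refl this] show "open Mhat"
    unfolding Mhat_eq by (rule back_subst) auto
  show "Mhat \<subseteq> M" unfolding Mhat_eq by blast
qed

lemma u_nz: "p \<in> Mhat \<Longrightarrow> \<nu> p - (\<gamma> p)\<^sup>2 \<noteq> 0"
  unfolding Mhat_eq by auto

lemma y_u: "p \<in> Mhat \<Longrightarrow> y p * (\<nu> p - (\<gamma> p)\<^sup>2) = 1"
  using u_nz by (simp add: y_def)

lemma smooth_y: "smooth_fun A Mhat y"
proof (rule smooth_funI)
  fix c assume c: "c \<in> A"
  interpret c: killing_chart M A \<Omega> D Z \<gamma> \<nu> Mhat c by (rule killing_chart[OF c])
  have "smc c Mhat (\<lambda>p. \<nu> p - (\<gamma> p)\<^sup>2)"
    by (intro c.smc_mono[OF _ Mhat_M] c.smc_simps c.smc_nu c.smc_gamma)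
  then show "smc c Mhat y"
    unfolding y_def[abs_def] using u_nz by (intro c.smc_inverse open_Mhat) auto
qed

lemma conn_D_Mhat: "symplectic_connection A \<Omega> Mhat D"
proof -
  have "smooth_on (\<lambda>x. D c (chart_inv c x) i j k) (snd c ` (fst c \<inter> Mhat))" if "c \<in> A" for c i j k
  proof -
    interpret c: killing_chart M A \<Omega> D Z \<gamma> \<nu> Mhat c by (rule killing_chart[OF that])
    show ?thesis using c.smc_mono[OF c.smc_G Mhat_M] unfolding smc_def .
  qed
  moreover have "(\<Sum>k\<in>UNIV. D c p i j k * jac c d p l k) = pd c i (\<lambda>q. jac c d q l j) p +
      (\<Sum>a\<in>UNIV. \<Sum>b\<in>UNIV. jac c d p a i * jac c d p b j * D d p a b l)"
    if "c \<in> A" "d \<in> A" "p \<in> fst c \<inter> fst d \<inter> Mhat" for c d p i j l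
  proof -
    have "p \<in> fst c \<inter> fst d \<inter> M" using that Mhat_M by auto
    then show ?thesis
      using conn_D that(1,2) unfolding symplectic_connection_def affine_connection_def by blast
  qed
  moreover have "D c p i j k = D c p j i k \<and> cov D \<Omega> c p [] [i, j, k] = 0"
    if "c \<in> A" "p \<in> fst c \<inter> Mhat" for c p i j k
  proof -
    have "p \<in> fst c \<inter> M" using that Mhat_M by auto
    then show ?thesis using conn_D that(1) unfolding symplectic_connection_def by blast
  qed
  ultimately show ?thesis
    unfolding symplectic_connection_def affine_connection_def by blast
qed

lemma sym3_Gam: "sym3_field A Mhat Gam"
  unfolding sym3_field_iff tensor_field_3
proof (intro conjI ballI allI)
  fix c i j k assume c: "c \<in> A"
  interpret c: killing_chart M A \<Omega> D Z \<gamma> \<nu> Mhat c by (rule killing_chart[OF c])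
  show "smc c Mhat (\<lambda>p. Gam c p [] [i, j, k])"
    unfolding Gam_def
    by (simp, intro c.smc_mult open_Mhat c.smc_mono[OF c.smc_z Mhat_M] smooth_funD[OF smooth_y c])
next
  fix c d p i j k assume "c \<in> A" "d \<in> A" "p \<in> fst c \<inter> fst d \<inter> Mhat"
  then have "Z c p [] [i] = (\<Sum>a\<in>UNIV. jac c d p a i * Z d p [] [a])" for i
    by (intro Z_transition) auto
  then show "Gam c p [] [i, j, k] = (\<Sum>a\<in>UNIV. \<Sum>b\<in>UNIV. \<Sum>e\<in>UNIV.
      jac c d p a i * jac c d p b j * jac c d p e k * Gam d p [] [a, b, e])"
    by (simp add: Gam_def sum_2 algebra_simps)
qed (simp_all add: Gam_def)

lemma conn_nabla: "symplectic_connection A \<Omega> Mhat (nabla t)"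
  by (rule symplectic_connection_translate[OF open_Mhat Mhat_M conn_D_Mhat sym3_Gam])

end

text \<open>Two copies of the chart theory live side by side: unprefixed over M, where D, Z and
  \<gamma> are smooth, and with prefix \<open>h\<close> over Mhat, where \<Gamma> is.\<close>

sublocale killing_chart \<subseteq> h: symp_variation c Mhat \<Omega> D Gam
proof -
  interpret h: symp_conn c Mhat \<Omega> D by (rule symp_conn[OF c_in open_Mhat Mhat_M conn_D_Mhat])
  have "smc c Mhat (\<lambda>p. Gam c p [] [i, j, k])" for i j k
    using sym3_Gam c_in unfolding sym3_field_iff tensor_field_3 by blast
  moreover have "symp_conn c Mhat \<Omega> (nabla t)" for t
    by (rule symp_conn[OF c_in open_Mhat Mhat_M conn_nabla])
  ultimately show "symp_variation c Mhat \<Omega> D Gam"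
    by (intro symp_variation.intro symp_variation_axioms.intro h.symp_conn_axioms) (simp_all add: Gam_def)
qed

section \<open>Ricci tensor, \<rho>, K and \<tau> of D + t \<Gamma>\<close>

context killing_chart
begin

lemmas pd_ring_rules = pd_const pd_add pd_uminus pd_mult pd_diff pd_power2 pd_divide_const

lemma pd_inverse_w: "p \<in> fst c \<Longrightarrow>
    pd c i (\<lambda>q. inverse (w q)) p = - inverse (w p) * (D c p i 1 1 + D c p i 2 2)"
  using pd_inverse[of p w i] dif_smc[OF smc_w dom_M] w_nz[OF dom_M] pd_w[OF dom_M]
  by (simp add: power2_eq_square)

lemma w_nz': "p \<in> fst c \<Longrightarrow> w p \<noteq> 0"
  using w_nz dom_M by blast

lemma difs:
  assumes "p \<in> fst c"
  shows "dif c w p" "dif c (z i) p" "dif c \<gamma> p" "dif c \<nu> p" "dif c (\<lambda>q. ricci D c q [] [i, j]) p"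
    "dif c (pd c i \<gamma>) p"
  using dif_smc[OF _ dom_M[OF assms]] smc_w smc_z smc_gamma smc_nu smc_ricci smc_pd[OF open_W smc_gamma]
  by blast+

lemma Mhat_dom:
  assumes "p \<in> fst c \<inter> Mhat"
  shows "p \<in> fst c" "p \<in> fst c \<inter> M" "p \<in> Mhat"
  using assms dom_M by auto

lemma dif_y: "p \<in> fst c \<inter> Mhat \<Longrightarrow> dif c y p"
  using h.dif_smc smooth_funD[OF smooth_y c_in] by blast

lemma pd_y:
  assumes p: "p \<in> fst c \<inter> Mhat"
  shows "pd c i y p = 2 * \<gamma> p * (y p)\<^sup>2 * pd c i \<gamma> p"
  using u_nz[OF Mhat_dom(3)[OF p]] Mhat_dom[OF p]
  unfolding y_def[abs_def]
  by (simp add: pd_rules dif_rules difs pd_nu)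

text \<open>The identities \<open>2 Z\<^sup>i \<partial>\<^sub>i\<gamma> = \<gamma>\<^sup>2 - \<nu>\<close>, \<open>Z\<^sup>i\<Omega>\<^sub>i\<^sub>j = Z\<^sub>j\<close>, \<open>2 R\<^sub>i\<^sub>p Z\<^sup>p = - \<partial>\<^sub>i\<gamma>\<close> in coordinates.\<close>

lemma yB:
  assumes p: "p \<in> fst c \<inter> Mhat"
  shows "y p * (inverse (w p) * (z 2 p * pd c 1 \<gamma> p - z 1 p * pd c 2 \<gamma> p)) = - 1 / 2"
proof -
  have "inverse (w p) * (z 2 p * pd c 1 \<gamma> p - z 1 p * pd c 2 \<gamma> p) = - 1 / 2 * (\<nu> p - (\<gamma> p)\<^sup>2)"
    using nu_Zd[OF c_in Mhat_dom(1)[OF p]] by (simp add: Zd_def)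
  then have "y p * (inverse (w p) * (z 2 p * pd c 1 \<gamma> p - z 1 p * pd c 2 \<gamma> p)) = - 1 / 2 * (y p * (\<nu> p - (\<gamma> p)\<^sup>2))"
    by simp
  then show ?thesis using y_u[OF Mhat_dom(3)[OF p]] by simp
qed

lemma A_z:
  assumes p: "p \<in> fst c"
  shows "inverse (w p) * (z 2 p * \<Omega> c p [] [1, i] - z 1 p * \<Omega> c p [] [2, i]) = z i p"
  using exhaust_2[of i] w_nz'[OF p] by (auto simp: Omega_eqs[OF dom_M[OF p]])

lemma ricci_Z:
  assumes p: "p \<in> fst c"
  shows "inverse (w p) * (z 2 p * ricci D c p [] [1, i] - z 1 p * ricci D c p [] [2, i]) = - 1 / 2 * pd c i \<gamma> p"
  using ricci_sym[OF dom_M[OF p], of 1 i] ricci_sym[OF dom_M[OF p], of 2 i]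
  by (simp add: pd_gamma[OF p] algebra_simps)

lemma P_Gam:
  "h.P i j 1 p = inverse (w p) * y p * z i p * z j p * z 2 p"
  "h.P i j 2 p = - (inverse (w p) * y p * z i p * z j p * z 1 p)"
  by (simp_all add: h.P_def Gam_def)

text \<open>S is the divergence of \<open>y Z\<^sub>i Z\<^sub>j Z\<^sup>k\<close> on k. The field y
  Z is divergence-free and \<open>Z\<^sup>k D\<^sub>k Z\<^sub>i = \<gamma>/2 Z\<^sub>i\<close>, so
  the two remaining factors give \<gamma>/2 each.\<close>

lemma S_Gam:
  assumes p: "p \<in> fst c \<inter> Mhat"
  shows "h.S i j p = \<gamma> p * y p * z i p * z j p"
proof -
  let ?v = "inverse (w p)"
  have dP: "pd c k (h.P i j 1) p = pd c k (\<lambda>q. inverse (w q) * y q * z i q * z j q * z 2 q) p"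
    "pd c k (h.P i j 2) p = pd c k (\<lambda>q. - (inverse (w q) * y q * z i q * z j q * z 1 q)) p" for k
    by (rule h.cong_W[OF p], simp add: P_Gam)+
  \<comment> \<open>The expression is arranged so that the left-hand sides of \<open>A_z\<close> and
    \<open>yB\<close> appear literally and can be replaced afterwards.\<close>
  have "h.S i j p = \<gamma> p / 2 * y p * (?v * (z 2 p * \<Omega> c p [] [1, i] - z 1 p * \<Omega> c p [] [2, i]) * z j p
      + z i p * (?v * (z 2 p * \<Omega> c p [] [1, j] - z 1 p * \<Omega> c p [] [2, j])))
    + 2 * \<gamma> p * y p * z i p * z j p * (y p * (?v * (z 2 p * pd c 1 \<gamma> p - z 1 p * pd c 2 \<gamma> p)))
    + \<gamma> p * y p * z i p * z j p * (?v * w p)"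
    using Mhat_dom[OF p] w_nz'[OF Mhat_dom(1)[OF p]] p
    unfolding h.S_def sum_2 dP P_Gam
    by (simp add: pd_ring_rules pd_inverse_w dif_rules difs dif_y pd_y pd_z G_sym_21 Omega_eqs power2_eq_square sum_2)
       (simp add: field_simps)
  also have "\<dots> = \<gamma> p * y p * z i p * z j p"
    unfolding A_z[OF Mhat_dom(1)[OF p]] yB[OF p] using w_nz'[OF Mhat_dom(1)[OF p]] by simp
  finally show ?thesis .
qed

text \<open>Every term contracts Z with itself, and \<open>Z\<^sup>p Z\<^sub>p = 0\<close>.\<close>

lemma T_Gam: "h.T i j p = 0"
  unfolding h.T_def sum_2 P_Gam by (simp add: algebra_simps)

lemma ricci_nabla:
  assumes p: "p \<in> fst c \<inter> Mhat"
  shows "ricci (nabla t) c p [] [i, j] = ricci D c p [] [i, j] + t * \<gamma> p * y p * z i p * z j p"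
  using h.ricci_translate[OF p, of t i j] unfolding S_Gam[OF p] T_Gam by simp

text \<open>The first summand is t \<Gamma> acting on the parallel tensor \<open>ricci D\<close>, by
  \<open>ricci_Z\<close>; on the Z Z part of the Ricci tensor \<Gamma> acts trivially. The other two
  are D applied to \<gamma> y and to Z Z.\<close>

lemma cov_ricci_nabla:
  assumes p: "p \<in> fst c \<inter> Mhat"
  shows "cov (nabla t) (ricci (nabla t)) c p [] [k, i, j] =
    t / 2 * y p * z k p * (z i p * pd c j \<gamma> p + z j p * pd c i \<gamma> p)
    + t * (\<nu> p + (\<gamma> p)\<^sup>2) * (y p)\<^sup>2 * pd c k \<gamma> p * z i p * z j p
    + t / 2 * (\<gamma> p)\<^sup>2 * y p * (\<Omega> c p [] [k, i] * z j p + \<Omega> c p [] [k, j] * z i p)"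
proof -
  have dR: "pd c k (\<lambda>q. ricci (nabla t) c q [] [i, j]) p =
      pd c k (\<lambda>q. ricci D c q [] [i, j] + t * \<gamma> q * y q * z i q * z j q) p"
    by (rule h.cong_W[OF p]) (rule ricci_nabla)
  \<comment> \<open>Bringing y and 2 \<gamma>^2 y^2 to the common power y^2 produces (\<nu> -
    \<gamma>^2) + 2 \<gamma>^2 = \<nu> + \<gamma>^2.\<close>
  have u: "y p * pd c k \<gamma> p = (y p)\<^sup>2 * (\<nu> p - (\<gamma> p)\<^sup>2) * pd c k \<gamma> p"
    using y_u[OF Mhat_dom(3)[OF p]] by (simp add: power2_eq_square mult.assoc)
  have "cov (nabla t) (ricci (nabla t)) c p [] [k, i, j] =
    - t * y p * z k p * z i p * (inverse (w p) * (z 2 p * ricci D c p [] [1, j] - z 1 p * ricci D c p [] [2, j]))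
    - t * y p * z k p * z j p * (inverse (w p) * (z 2 p * ricci D c p [] [1, i] - z 1 p * ricci D c p [] [2, i]))
    + t * (y p * pd c k \<gamma> p + 2 * (\<gamma> p)\<^sup>2 * (y p)\<^sup>2 * pd c k \<gamma> p) * z i p * z j p
    + t / 2 * (\<gamma> p)\<^sup>2 * y p * (\<Omega> c p [] [k, i] * z j p + \<Omega> c p [] [k, j] * z i p)"
    using Mhat_dom[OF p] p ricci_sym[OF Mhat_dom(2)[OF p], of i 1] ricci_sym[OF Mhat_dom(2)[OF p], of i 2]
    unfolding cov_0_2 dR ricci_nabla[OF p] h.translate_eq[OF p] sum_2 P_Gam
    by (simp add: pd_rules dif_rules difs dif_y pd_y pd_z pd_ricci power2_eq_square sum_2)
       (simp add: algebra_simps)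
  then show ?thesis
    unfolding ricci_Z[OF Mhat_dom(1)[OF p]] u by (simp add: algebra_simps)
qed

lemma rho_nabla:
  assumes p: "p \<in> fst c \<inter> Mhat"
  shows "rho \<Omega> (nabla t) c p [] [i] = 1 / 2 * t * (\<nu> p - 3 * (\<gamma> p)\<^sup>2) * y p * z i p"
proof -
  interpret n: symp_conn c Mhat \<Omega> "nabla t" by (rule h.conn_translate)
  let ?v = "inverse (w p)"
  let ?B = "y p * (?v * (z 2 p * pd c 1 \<gamma> p - z 1 p * pd c 2 \<gamma> p))"
  have vw: "?v * w p = 1" using w_nz'[OF Mhat_dom(1)[OF p]] by simp
  have "rho \<Omega> (nabla t) c p [] [i] = t * z i p * ?B - 2 * t * (\<nu> p + (\<gamma> p)\<^sup>2) * y p * z i p * ?B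
     + t * (\<gamma> p)\<^sup>2 * y p * (- (?v * (z 2 p * \<Omega> c p [] [1, i] - z 1 p * \<Omega> c p [] [2, i])) - 2 * z i p * (?v * w p))"
    unfolding n.rho_eq[OF p] n.dric_cov[OF p] cov_ricci_nabla[OF p]
    using w_nz'[OF Mhat_dom(1)[OF p]]
    by (simp add: Omega_eqs[OF Mhat_dom(2)[OF p]] power2_eq_square del: cov.simps) (simp add: field_simps)
  also have "\<dots> = - 1 / 2 * t * z i p + t * (\<nu> p + (\<gamma> p)\<^sup>2) * y p * z i p - 3 * t * (\<gamma> p)\<^sup>2 * y p * z i p"
    unfolding A_z[OF Mhat_dom(1)[OF p]] yB[OF p] vw by (simp add: algebra_simps)
  \<comment> \<open>Replacing 1 by y (\<nu> - \<gamma>^2) gives all terms the factor y; the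
    coefficient is - (\<nu> - \<gamma>^2)/2 + (\<nu> + \<gamma>^2) - 3 \<gamma>^2 = (\<nu> - 3
    \<gamma>^2)/2.\<close>
  also have "\<dots> = - 1 / 2 * t * z i p * (y p * (\<nu> p - (\<gamma> p)\<^sup>2)) + t * (\<nu> p + (\<gamma> p)\<^sup>2) * y p * z i p - 3 * t * (\<gamma> p)\<^sup>2 * y p * z i p"
    unfolding y_u[OF Mhat_dom(3)[OF p]] by simp
  finally show ?thesis by (simp add: algebra_simps)
qed

text \<open>The terms with \<Omega> are skew in two of the symmetrized indices and cancel. Those
  with d\<gamma> have total coefficient t y + t (\<nu> + \<gamma>^2) y^2 = 2 t \<nu> y^2, and
  \<open>d\<gamma>\<^sub>k = - 2 R\<^sub>k\<^sub>p Z\<^sup>p\<close> turns 2 into - 4.\<close>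

lemma symmetrize_cov_ricci_nabla:
  assumes p: "p \<in> fst c \<inter> Mhat"
  shows "symmetrize (cov (nabla t) (ricci (nabla t))) c p [] [i, j, k] = - 4 * t * \<nu> p * (y p)\<^sup>2 *
    symmetrize (\<lambda>c p us ls. Z c p [] [ls ! 0] * Z c p [] [ls ! 1] *
               (\<Sum>q\<in>UNIV. ricci D c p [] [ls ! 2, q] * raise \<Omega> Z c p [q] [])) c p [] [i, j, k]"
proof -
  have RZ: "(\<Sum>q\<in>UNIV. ricci D c p [] [k, q] * raise \<Omega> Z c p [q] []) = - 1 / 2 * pd c k \<gamma> p" for k
    unfolding ricci_Z[OF Mhat_dom(1)[OF p], symmetric] raise_Z[OF Mhat_dom(1)[OF p]] sum_2
    using ricci_sym[OF Mhat_dom(2)[OF p], of k 1] ricci_sym[OF Mhat_dom(2)[OF p], of k 2]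
    by (simp add: algebra_simps)
  have sk: "\<Omega> c p [] [j, i] = - \<Omega> c p [] [i, j]" "\<Omega> c p [] [k, i] = - \<Omega> c p [] [i, k]"
    "\<Omega> c p [] [k, j] = - \<Omega> c p [] [j, k]"
    by (rule Omega_skew[OF Mhat_dom(2)[OF p]])+
  let ?X = "(z i p * z j p * pd c k \<gamma> p + z i p * z k p * pd c j \<gamma> p + z j p * z k p * pd c i \<gamma> p) / 3"
  have "y p = y p * (y p * (\<nu> p - (\<gamma> p)\<^sup>2))" unfolding y_u[OF Mhat_dom(3)[OF p]] by simp
  then have "t * y p + t * (\<nu> p + (\<gamma> p)\<^sup>2) * (y p)\<^sup>2 = 
    t * (y p * (y p * (\<nu> p - (\<gamma> p)\<^sup>2))) + t * (\<nu> p + (\<gamma> p)\<^sup>2) * (y p)\<^sup>2" by simp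
  also have "\<dots> = 2 * t * \<nu> p * (y p)\<^sup>2" by (simp add: power2_eq_square algebra_simps)
  finally have e: "t * y p + t * (\<nu> p + (\<gamma> p)\<^sup>2) * (y p)\<^sup>2 = 2 * t * \<nu> p * (y p)\<^sup>2" .
  have "symmetrize (cov (nabla t) (ricci (nabla t))) c p [] [i, j, k] =
      (t * y p + t * (\<nu> p + (\<gamma> p)\<^sup>2) * (y p)\<^sup>2) * ?X"
    unfolding symmetrize_3 cov_ricci_nabla[OF p] sk by (simp add: algebra_simps)
  also have "\<dots> = - 4 * t * \<nu> p * (y p)\<^sup>2 *
    symmetrize (\<lambda>c p us ls. Z c p [] [ls ! 0] * Z c p [] [ls ! 1] *
               (\<Sum>q\<in>UNIV. ricci D c p [] [ls ! 2, q] * raise \<Omega> Z c p [q] [])) c p [] [i, j, k]"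
    unfolding e unfolding symmetrize_3 by (simp add: RZ) (simp add: field_simps)
  finally show ?thesis .
qed

lemma K_nabla_curl:
  assumes p: "p \<in> fst c \<inter> Mhat"
  shows "- 1 / 2 * (curl c (\<lambda>i q. rho \<Omega> (nabla t) c q [] [i]) p / w p) = - (3 / 4) * t * \<gamma> p"
proof -
  let ?b = "\<lambda>q. 1 / 2 * t * (\<nu> q - 3 * (\<gamma> q)\<^sup>2) * y q"
  let ?v = "inverse (w p)"
  let ?B = "y p * (?v * (z 2 p * pd c 1 \<gamma> p - z 1 p * pd c 2 \<gamma> p))"
  have d: "pd c k (\<lambda>q. rho \<Omega> (nabla t) c q [] [i]) p = pd c k (\<lambda>q. ?b q * z i q) p" for k i
    by (rule h.cong_W[OF p]) (simp add: rho_nabla)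
  \<comment> \<open>The curl of b Z over w is b \<gamma> + Z(b). With the value - 1/2 of
    \<open>?B\<close> the terms containing \<nu> - 3 \<gamma>^2 cancel and 3/2 t \<gamma> is
    left.\<close>
  have "curl c (\<lambda>i q. rho \<Omega> (nabla t) c q [] [i]) p / w p =
     ?b p * (curl c z p / w p) + t * (- 3 * \<gamma> p + (\<nu> p - 3 * (\<gamma> p)\<^sup>2) * \<gamma> p * y p) * ?B"
    using Mhat_dom[OF p] p w_nz'[OF Mhat_dom(1)[OF p]]
    unfolding curl_def d
    by (simp add: pd_rules dif_rules difs dif_y pd_y pd_nu power2_eq_square) (simp add: field_simps)
  also have "curl c z p / w p = \<gamma> p"
    using gamma_w[OF Mhat_dom(1)[OF p]] w_nz'[OF Mhat_dom(1)[OF p]] by (simp add: field_simps)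
  finally show ?thesis unfolding yB[OF p] by (simp add: algebra_simps)
qed

end

context killing
begin

lemma K_nabla:
  assumes p: "p \<in> Mhat"
  shows "Kfun A \<Omega> (nabla t) p = - (3 / 4) * t * \<gamma> p"
proof -
  obtain c where c: "c \<in> A" "p \<in> fst c" using chart_at[of p] p Mhat_M by blast
  interpret c: killing_chart M A \<Omega> D Z \<gamma> \<nu> Mhat c by (rule killing_chart[OF c(1)])
  have "p \<in> fst c \<inter> Mhat" using c p by blast
  then show ?thesis
    using Kfun_eq[OF open_Mhat Mhat_M conn_nabla c(1)] c.K_nabla_curl unfolding c.w_def by metis
qed

end

context killing_chart
begin

lemma pd_K_nabla:
  assumes p: "p \<in> fst c \<inter> Mhat"
  shows "pd c i (Kfun A \<Omega> (nabla t)) p = - (3 / 4) * t * pd c i \<gamma> p"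
proof -
  have "pd c i (Kfun A \<Omega> (nabla t)) p = pd c i (\<lambda>q. - (3 / 4) * t * \<gamma> q) p"
    by (rule h.cong_W[OF p]) (simp add: K_nabla)
  then show ?thesis using Mhat_dom[OF p] by (simp add: pd_rules dif_rules difs)
qed

lemma tau_nabla_local:
  assumes p: "p \<in> fst c \<inter> Mhat"
  shows "(Kfun A \<Omega> (nabla t) p)\<^sup>2 + (\<Sum>i\<in>UNIV. raise \<Omega> (rho \<Omega> (nabla t)) c p [i] [] * pd c i (Kfun A \<Omega> (nabla t)) p)
    = 3 / 16 * t\<^sup>2 * \<nu> p"
proof -
  let ?B = "y p * (inverse (w p) * (z 2 p * pd c 1 \<gamma> p - z 1 p * pd c 2 \<gamma> p))"
  have "(Kfun A \<Omega> (nabla t) p)\<^sup>2 + (\<Sum>i\<in>UNIV. raise \<Omega> (rho \<Omega> (nabla t)) c p [i] [] * pd c i (Kfun A \<Omega> (nabla t)) p)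
    = 9 / 16 * t\<^sup>2 * (\<gamma> p)\<^sup>2 - 3 / 8 * t\<^sup>2 * (\<nu> p - 3 * (\<gamma> p)\<^sup>2) * ?B"
    unfolding K_nabla[OF Mhat_dom(3)[OF p]] pd_K_nabla[OF p] raise_1 sum_2 rho_nabla[OF p] up_eqs[OF Mhat_dom(2)[OF p]]
    using w_nz'[OF Mhat_dom(1)[OF p]] by (simp add: power2_eq_square field_simps)
  also have "\<dots> = 3 / 16 * t\<^sup>2 * \<nu> p" unfolding yB[OF p] by (simp add: field_simps)
  finally show ?thesis .
qed

end

context killing
begin

text \<open>The local value is the same expression in every chart, so \<open>scalar_cases\<close>
  suffices and invariance of the defining sum need not be shown.\<close>

lemma tau_nabla:
  assumes p: "p \<in> Mhat"
  shows "tau A \<Omega> (nabla t) p = 3 / 16 * t\<^sup>2 * \<nu> p"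
proof -
  have "p \<in> M" using p Mhat_M by blast
  then obtain c where c: "c \<in> A" "p \<in> fst c" "tau A \<Omega> (nabla t) p = (Kfun A \<Omega> (nabla t) p)\<^sup>2 +
      (\<Sum>i\<in>UNIV. raise \<Omega> (rho \<Omega> (nabla t)) c p [i] [] * pd c i (Kfun A \<Omega> (nabla t)) p)"
    unfolding tau_def by (rule scalar_cases)
  interpret c: killing_chart M A \<Omega> D Z \<gamma> \<nu> Mhat c by (rule killing_chart[OF c(1)])
  show ?thesis unfolding c(3) using c.tau_nabla_local c(2) p by blast
qed

end

section \<open>The Hamiltonian field of \<gamma> as an infinitesimal symmetry\<close>

lemma (in symp_chart) ham_eqs:
  assumes "p \<in> fst c \<inter> W"
  shows "ham \<Omega> f c p [1] ls = - inverse (w p) * pd c 2 f p" "ham \<Omega> f c p [2] ls = inverse (w p) * pd c 1 f p"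
  by (simp_all add: ham_def sum_2 up_eqs[OF assms])

lemma (in symp_chart) smc_ham:
  assumes "smc c W f"
  shows "smc c W (\<lambda>p. ham \<Omega> f c p [i] [])"
proof -
  have 1: "smc c W (\<lambda>p. - inverse (w p) * pd c 2 f p)" by (intro smc_simps smc_w w_nz assms)
  have 2: "smc c W (\<lambda>p. inverse (w p) * pd c 1 f p)" by (intro smc_simps smc_w w_nz assms)
  have "smc c W (\<lambda>p. ham \<Omega> f c p [1] [])" by (rule smc_cong[OF open_W 1]) (simp add: ham_eqs)
  moreover have "smc c W (\<lambda>p. ham \<Omega> f c p [2] [])" by (rule smc_cong[OF open_W 2]) (simp add: ham_eqs)
  ultimately show ?thesis using exhaust_2[of i] by auto
qed

text \<open>The two-dimensional curvature as one formula for all indices,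
  \<open>R\<^sub>q\<^sub>i\<^sub>j\<^sup>k = \<Omega>\<^sub>q\<^sub>i \<Omega>\<^sup>k\<^sup>p
  R\<^sub>j\<^sub>p\<close>.\<close>

lemma (in symp_conn) riem_decomp:
  assumes p: "p \<in> fst c \<inter> W"
  shows "riem G c p q i j 1 = \<Omega> c p [] [q, i] * inverse (w p) * ricci G c p [] [j, 2]"
    "riem G c p q i j 2 = - (\<Omega> c p [] [q, i] * inverse (w p) * ricci G c p [] [j, 1])"
  using exhaust_2[of q] exhaust_2[of i] exhaust_2[of j] w_nz[OF p]
  by (auto simp: Omega_eqs[OF p] riem_ricci[OF p])

context killing_chart
begin

lemma pd_ham_gamma:
  assumes p: "p \<in> fst c"
  shows "pd c j (\<lambda>q. ham \<Omega> \<gamma> c q [1] []) p = \<gamma> p * inverse (w p) * ricci D c p [] [j, 2]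
      - (D c p j 1 1 * ham \<Omega> \<gamma> c p [1] [] + D c p j 2 1 * ham \<Omega> \<gamma> c p [2] [])"
    "pd c j (\<lambda>q. ham \<Omega> \<gamma> c q [2] []) p = - \<gamma> p * inverse (w p) * ricci D c p [] [j, 1]
      - (D c p j 1 2 * ham \<Omega> \<gamma> c p [1] [] + D c p j 2 2 * ham \<Omega> \<gamma> c p [2] [])"
proof -
  have 1: "pd c j (\<lambda>q. ham \<Omega> \<gamma> c q [1] []) p = pd c j (\<lambda>q. - (inverse (w q) * pd c 2 \<gamma> q)) p"
    by (rule cong_W[OF dom_M[OF p]]) (simp add: ham_eqs)
  have 2: "pd c j (\<lambda>q. ham \<Omega> \<gamma> c q [2] []) p = pd c j (\<lambda>q. inverse (w q) * pd c 1 \<gamma> q) p"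
    by (rule cong_W[OF dom_M[OF p]]) (simp add: ham_eqs)
  show "pd c j (\<lambda>q. ham \<Omega> \<gamma> c q [1] []) p = \<gamma> p * inverse (w p) * ricci D c p [] [j, 2]
      - (D c p j 1 1 * ham \<Omega> \<gamma> c p [1] [] + D c p j 2 1 * ham \<Omega> \<gamma> c p [2] [])"
    unfolding 1 ham_eqs[OF dom_M[OF p]] using p w_nz'[OF p]
    by (simp add: pd_ring_rules pd_inverse_w dif_rules difs pd_pd_gamma sum_2) (simp add: algebra_simps)
  show "pd c j (\<lambda>q. ham \<Omega> \<gamma> c q [2] []) p = - \<gamma> p * inverse (w p) * ricci D c p [] [j, 1]
      - (D c p j 1 2 * ham \<Omega> \<gamma> c p [1] [] + D c p j 2 2 * ham \<Omega> \<gamma> c p [2] [])"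
    unfolding 2 ham_eqs[OF dom_M[OF p]] using p w_nz'[OF p]
    by (simp add: pd_ring_rules pd_inverse_w dif_rules difs pd_pd_gamma sum_2) (simp add: algebra_simps)
qed

text \<open>The part with D is the raised Hessian - \<gamma> Ric. The part with t \<Gamma> contains
  the pairing of Z with the Hamiltonian field, which is Z(\<gamma>); multiplied by y it is the
  constant - 1/2.\<close>

lemma cov_ham_gamma:
  assumes p: "p \<in> fst c \<inter> Mhat"
  shows "cov (nabla t) (ham \<Omega> \<gamma>) c p [1] [j] = inverse (w p) * (\<gamma> p * ricci D c p [] [j, 2] - 1 / 2 * t * z j p * z 2 p)"
    "cov (nabla t) (ham \<Omega> \<gamma>) c p [2] [j] = - inverse (w p) * (\<gamma> p * ricci D c p [] [j, 1] - 1 / 2 * t * z j p * z 1 p)"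
proof -
  let ?B = "y p * (inverse (w p) * (z 2 p * pd c 1 \<gamma> p - z 1 p * pd c 2 \<gamma> p))"
  note eqs = cov_1_0 pd_ham_gamma[OF Mhat_dom(1)[OF p]] sum_2 h.translate_eq[OF p] P_Gam
    ham_eqs[OF Mhat_dom(2)[OF p]]
  have "cov (nabla t) (ham \<Omega> \<gamma>) c p [1] [j] = inverse (w p) * (\<gamma> p * ricci D c p [] [j, 2] + t * z j p * z 2 p * ?B)"
    unfolding eqs by (simp add: algebra_simps)
  then show "cov (nabla t) (ham \<Omega> \<gamma>) c p [1] [j] = inverse (w p) * (\<gamma> p * ricci D c p [] [j, 2] - 1 / 2 * t * z j p * z 2 p)"
    unfolding yB[OF p] by simp
  have "cov (nabla t) (ham \<Omega> \<gamma>) c p [2] [j] = - inverse (w p) * (\<gamma> p * ricci D c p [] [j, 1] + t * z j p * z 1 p * ?B)"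
    unfolding eqs by (simp add: algebra_simps)
  then show "cov (nabla t) (ham \<Omega> \<gamma>) c p [2] [j] = - inverse (w p) * (\<gamma> p * ricci D c p [] [j, 1] - 1 / 2 * t * z j p * z 1 p)"
    unfolding yB[OF p] by simp
qed

text \<open>For D alone the two terms cancel: \<open>D\<^sub>i D\<^sub>j H\<^sup>k =
  d\<gamma>\<^sub>i R\<^sub>j\<^sup>k\<close> since Ricci is parallel, and \<open>H\<^sup>p
  R\<^sub>p\<^sub>i\<^sub>j\<^sup>k = - d\<gamma>\<^sub>i R\<^sub>j\<^sup>k\<close> by
  \<open>riem_decomp\<close>. The terms in t vanish because of \<open>yB\<close>.\<close>

lemma lie_conn_gamma:
  assumes p: "p \<in> fst c \<inter> Mhat"
  shows "lie_conn (nabla t) (ham \<Omega> \<gamma>) c p i j k = 0"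
proof -
  interpret n: symp_conn c Mhat \<Omega> "nabla t" by (rule h.conn_translate)
  let ?v = "inverse (w p)"
  let ?B = "y p * (?v * (z 2 p * pd c 1 \<gamma> p - z 1 p * pd c 2 \<gamma> p))"
  note p' = Mhat_dom[OF p]
  have d1: "pd c i (\<lambda>q. cov (nabla t) (ham \<Omega> \<gamma>) c q [1] [j]) p =
     ?v * (\<gamma> p * pd c i (\<lambda>q. ricci D c q [] [j, 2]) p + pd c i \<gamma> p * ricci D c p [] [j, 2]
       - 1 / 2 * t * (z j p * pd c i (z 2) p + pd c i (z j) p * z 2 p))
     - ?v * (D c p i 1 1 + D c p i 2 2) * (\<gamma> p * ricci D c p [] [j, 2] - 1 / 2 * t * z j p * z 2 p)" for i j
  proof -
    have "pd c i (\<lambda>q. cov (nabla t) (ham \<Omega> \<gamma>) c q [1] [j]) p =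
        pd c i (\<lambda>q. inverse (w q) * (\<gamma> q * ricci D c q [] [j, 2] - 1 / 2 * t * z j q * z 2 q)) p"
      by (rule h.cong_W[OF p]) (rule cov_ham_gamma)
    then show ?thesis using p' w_nz'[OF p'(1)]
      by (simp add: pd_ring_rules pd_inverse_w dif_rules difs del: cov.simps) (simp add: field_simps)
  qed
  have d2: "pd c i (\<lambda>q. cov (nabla t) (ham \<Omega> \<gamma>) c q [2] [j]) p =
     - ?v * (\<gamma> p * pd c i (\<lambda>q. ricci D c q [] [j, 1]) p + pd c i \<gamma> p * ricci D c p [] [j, 1]
       - 1 / 2 * t * (z j p * pd c i (z 1) p + pd c i (z j) p * z 1 p))
     + ?v * (D c p i 1 1 + D c p i 2 2) * (\<gamma> p * ricci D c p [] [j, 1] - 1 / 2 * t * z j p * z 1 p)" for i j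
  proof -
    have "pd c i (\<lambda>q. cov (nabla t) (ham \<Omega> \<gamma>) c q [2] [j]) p =
        pd c i (\<lambda>q. - inverse (w q) * (\<gamma> q * ricci D c q [] [j, 1] - 1 / 2 * t * z j q * z 1 q)) p"
      by (rule h.cong_W[OF p]) (rule cov_ham_gamma)
    then show ?thesis using p' w_nz'[OF p'(1)]
      by (simp add: pd_ring_rules pd_inverse_w dif_rules difs del: cov.simps) (simp add: field_simps)
  qed
  note eqs = lie_conn_def cov_1_1 d1 d2 sum_2 n.riem_decomp[OF p] ricci_nabla[OF p] cov_ham_gamma[OF p]
    ham_eqs[OF p'(2)] h.translate_eq[OF p] P_Gam pd_ricci[OF p'(1)] pd_z[OF p'(1)]
  \<comment> \<open>The remainder is exhibited as a multiple of 1 + 2 \<open>?B\<close>, a rational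
    identity that is checked index by index; inserting \<open>yB\<close> afterwards makes it
    zero.\<close>
  have "lie_conn (nabla t) (ham \<Omega> \<gamma>) c p i j 1 =
      - 1 / 4 * t * \<gamma> p * (\<Omega> c p [] [i, j] * ?v * z 2 p + (if i = 1 then z j p else 0)) * (1 + 2 * ?B)"
    using exhaust_2[of i] exhaust_2[of j] w_nz'[OF p'(1)]
    unfolding eqs
    by (elim disjE)
       (simp_all add: Omega_eqs[OF p'(2)] G_sym_21[OF p'(2)] ricci_sym_21[OF p'(2)] pd_gamma[OF p'(1)] field_simps)
  moreover have "lie_conn (nabla t) (ham \<Omega> \<gamma>) c p i j 2 =
      - 1 / 4 * t * \<gamma> p * (- \<Omega> c p [] [i, j] * ?v * z 1 p + (if i = 2 then z j p else 0)) * (1 + 2 * ?B)"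
    using exhaust_2[of i] exhaust_2[of j] w_nz'[OF p'(1)]
    unfolding eqs
    by (elim disjE)
       (simp_all add: Omega_eqs[OF p'(2)] G_sym_21[OF p'(2)] ricci_sym_21[OF p'(2)] pd_gamma[OF p'(1)] field_simps)
  ultimately show ?thesis
    using exhaust_2[of k] unfolding yB[OF p] by auto
qed

lemma Hop_gamma:
  assumes p: "p \<in> fst c \<inter> Mhat"
  shows "Hop \<Omega> (nabla t) \<gamma> c p us [i, j, k] = 0"
  unfolding Hop_def by (simp add: lie_conn_gamma[OF p])

text \<open>The Lie derivative of Z is \<open>H\<^sup>q D\<^sub>q Z\<^sub>i + Z\<^sub>q D\<^sub>i
  H\<^sup>q\<close>, and the two terms are - \<gamma>/2 d\<gamma> and \<gamma>/2 d\<gamma>.\<close>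

lemma lie_Z_gamma:
  assumes p: "p \<in> fst c"
  shows "(\<Sum>q\<in>UNIV. ham \<Omega> \<gamma> c p [q] [] * pd c q (z i) p) + (\<Sum>q\<in>UNIV. pd c i (\<lambda>r. ham \<Omega> \<gamma> c r [q] []) p * z q p) = 0"
  using exhaust_2[of i] w_nz'[OF p]
  unfolding sum_2 pd_ham_gamma[OF p] pd_z[OF p] ham_eqs[OF dom_M[OF p]]
  by (elim disjE) (simp_all add: pd_gamma[OF p] Omega_eqs[OF dom_M[OF p]] G_sym_21[OF dom_M[OF p]]
      ricci_sym_21[OF dom_M[OF p]] field_simps)

text \<open>\<open>Kfun\<close> and \<open>Hadj\<close> are known to be multiples of \<gamma> only
  on Mhat; this is why f = a \<gamma> is assumed there and passed on through germs.\<close>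

lemma pd_cmult_ham:
  assumes "\<And>q. q \<in> fst c \<inter> Mhat \<Longrightarrow> f q = a * \<gamma> q" and p: "p \<in> fst c \<inter> Mhat"
  shows "ham \<Omega> f c p [k] [] = a * ham \<Omega> \<gamma> c p [k] []"
    "pd c j (\<lambda>q. ham \<Omega> f c q [k] []) p = a * pd c j (\<lambda>q. ham \<Omega> \<gamma> c q [k] []) p"
proof -
  have *: "ham \<Omega> f c p [k] [] = a * ham \<Omega> \<gamma> c p [k] []" if p: "p \<in> fst c \<inter> Mhat" for p
  proof -
    have "pd c i f p = pd c i (\<lambda>q. a * \<gamma> q) p" for i
      by (rule h.cong_W[OF p]) (rule assms)
    then have "pd c i f p = a * pd c i \<gamma> p" for i
      using Mhat_dom[OF p] by (simp add: pd_ring_rules dif_rules difs)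
    then show ?thesis by (simp add: ham_def sum_2 algebra_simps)
  qed
  show "ham \<Omega> f c p [k] [] = a * ham \<Omega> \<gamma> c p [k] []" by (rule *[OF p])
  have d: "dif c (\<lambda>q. ham \<Omega> \<gamma> c q [k] []) p"
    by (rule h.dif_smc[OF h.smc_ham[OF smc_mono[OF smc_gamma Mhat_M]] p])
  have "pd c j (\<lambda>q. ham \<Omega> f c q [k] []) p = pd c j (\<lambda>q. a * ham \<Omega> \<gamma> c q [k] []) p"
    by (rule h.cong_W[OF p *])
  then show "pd c j (\<lambda>q. ham \<Omega> f c q [k] []) p = a * pd c j (\<lambda>q. ham \<Omega> \<gamma> c q [k] []) p"
    using d Mhat_dom[OF p] by (simp add: pd_ring_rules dif_rules)
qed

lemma lie_deriv_Gam:
  assumes f: "\<And>q. q \<in> fst c \<inter> Mhat \<Longrightarrow> f q = a * \<gamma> q" and p: "p \<in> fst c \<inter> Mhat"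
  shows "lie_deriv (ham \<Omega> f) Gam c p [] [i, j, k] = 0"
proof -
  note p' = Mhat_dom[OF p]
  let ?L = "\<lambda>i. (\<Sum>q\<in>UNIV. ham \<Omega> \<gamma> c p [q] [] * pd c q (z i) p) + (\<Sum>q\<in>UNIV. pd c i (\<lambda>r. ham \<Omega> \<gamma> c r [q] []) p * z q p)"
  have y0: "ham \<Omega> \<gamma> c p [1] [] * pd c 1 \<gamma> p + ham \<Omega> \<gamma> c p [2] [] * pd c 2 \<gamma> p = 0"
    unfolding ham_eqs[OF p'(2)] by simp
  have G: "pd c q (\<lambda>r. Gam c r [] [i, j, k]) p =
      2 * \<gamma> p * (y p)\<^sup>2 * pd c q \<gamma> p * z i p * z j p * z k p + y p * (pd c q (z i) p * z j p * z k p
        + z i p * pd c q (z j) p * z k p + z i p * z j p * pd c q (z k) p)" for q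
    unfolding Gam_def using p p'
    by (simp add: pd_ring_rules dif_rules difs dif_y pd_y) (simp add: algebra_simps)
  have h1: "ham \<Omega> f c p [k] [] = a * ham \<Omega> \<gamma> c p [k] []" for k
    by (rule pd_cmult_ham(1)[OF _ p]) (rule f)
  have h2: "pd c j (\<lambda>q. ham \<Omega> f c q [k] []) p = a * pd c j (\<lambda>q. ham \<Omega> \<gamma> c q [k] []) p" for j k
    by (rule pd_cmult_ham(2)[OF _ p]) (rule f)
  have "lie_deriv (ham \<Omega> f) Gam c p [] [i, j, k] =
      a * (2 * \<gamma> p * (y p)\<^sup>2 * z i p * z j p * z k p *
          (ham \<Omega> \<gamma> c p [1] [] * pd c 1 \<gamma> p + ham \<Omega> \<gamma> c p [2] [] * pd c 2 \<gamma> p)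
        + y p * (?L i * z j p * z k p + z i p * ?L j * z k p + z i p * z j p * ?L k))"
    unfolding lie_deriv_def by (simp add: h1 h2 G sum_2) (simp add: Gam_def algebra_simps)
  then show ?thesis unfolding y0 lie_Z_gamma[OF p'(1)] by simp
qed

end

section \<open>Integration in the coordinate plane\<close>

text \<open>A bridge between the extended integral in \<open>symplectic_measure\<close> and the
  gauge integral for which the change of variables is stated. The case of value infinity is included
  because chart domains may have infinite area.\<close>

lemma nn_integral_set_lebesgue:
  fixes g :: "real^2 \<Rightarrow> real"
  assumes "T \<in> sets borel" "(\<lambda>x. indicator T x * g x) \<in> borel_measurable borel" "\<And>x. x \<in> T \<Longrightarrow> g x \<ge> 0"
  shows "(\<integral>\<^sup>+x\<in>T. ennreal (g x) \<partial>lborel) = (if g absolutely_integrable_on T then ennreal (integral T g) else \<infinity>)"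
proof -
  let ?h = "\<lambda>x. indicator T x * g x"
  have nonneg: "?h x \<ge> 0" for x using assms(3) by (auto simp: indicator_def)
  have eq: "(\<integral>\<^sup>+x\<in>T. ennreal (g x) \<partial>lborel) = (\<integral>\<^sup>+x. ennreal (?h x) \<partial>lborel)"
    by (intro nn_integral_cong) (auto simp: indicator_def)
  have int: "g absolutely_integrable_on T \<longleftrightarrow> integrable lborel ?h"
    unfolding set_integrable_def real_scaleR_def using assms(2) by (subst integrable_completion) simp_all
  show ?thesis
  proof (cases "integrable lborel ?h")
    case True
    then have "integral T g = integral\<^sup>L lborel ?h"
      using set_lebesgue_integral_eq_integral(2)[of T g] int assms(2)
      unfolding set_lebesgue_integral_def real_scaleR_def by (simp add: integral_completion)
    then show ?thesis
      unfolding eq using nn_integral_eq_integral[OF True] nonneg True int by simp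
  next
    case False
    then have "\<not> (\<integral>\<^sup>+x. ennreal (?h x) \<partial>lborel) < \<infinity>"
      using assms(2) nonneg by (simp add: integrable_iff_bounded)
    then have "(\<integral>\<^sup>+x. ennreal (?h x) \<partial>lborel) = \<infinity>"
      unfolding infinity_ennreal_def by (metis top.not_eq_extremum)
    then show ?thesis unfolding eq using False int by simp
  qed
qed

lemma nn_integral_change_of_variables:
  fixes g k :: "real^2 \<Rightarrow> real" and \<phi> :: "real^2 \<Rightarrow> real^2"
  assumes "S \<in> sets borel" "\<phi> ` S \<in> sets borel" "inj_on \<phi> S"
    and "\<And>x. x \<in> S \<Longrightarrow> (\<phi> has_derivative \<phi>' x) (at x within S)"
    and "(\<lambda>x. indicator (\<phi> ` S) x * g x) \<in> borel_measurable borel"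
    and "(\<lambda>x. indicator S x * k x) \<in> borel_measurable borel"
    and "\<And>x. x \<in> \<phi> ` S \<Longrightarrow> g x \<ge> 0"
    and "\<And>x. x \<in> S \<Longrightarrow> k x = \<bar>det (matrix (\<phi>' x))\<bar> * g (\<phi> x)"
  shows "(\<integral>\<^sup>+x\<in>\<phi> ` S. ennreal (g x) \<partial>lborel) = (\<integral>\<^sup>+x\<in>S. ennreal (k x) \<partial>lborel)"
proof -
  let ?D = "\<lambda>x. \<bar>det (matrix (\<phi>' x))\<bar> * g (\<phi> x)"
  \<comment> \<open>The change of variables is stated for vector-valued integrands, so real
    functions are passed through \<open>real^1\<close>.\<close>
  have "(\<lambda>x. \<bar>det (matrix (\<phi>' x))\<bar> *\<^sub>R (vec (g (\<phi> x)) :: real^1)) absolutely_integrable_on S \<and>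
      integral S (\<lambda>x. \<bar>det (matrix (\<phi>' x))\<bar> *\<^sub>R (vec (g (\<phi> x)) :: real^1)) = vec b
     \<longleftrightarrow> (\<lambda>x. vec (g x) :: real^1) absolutely_integrable_on (\<phi> ` S) \<and> integral (\<phi> ` S) (\<lambda>x. vec (g x) :: real^1) = vec b" for b
    by (rule has_absolute_integral_change_of_variables) (use assms(1,3,4) in auto)
  then have cv: "?D absolutely_integrable_on S \<and> integral S ?D = b
     \<longleftrightarrow> g absolutely_integrable_on (\<phi> ` S) \<and> integral (\<phi> ` S) g = b" for b
    unfolding absolutely_integrable_on_1_iff integral_on_1_eq by (simp add: vec_eq_iff)
  have "(\<lambda>x. indicator S x *\<^sub>R k x) = (\<lambda>x. indicator S x *\<^sub>R ?D x)"
    using assms(8) by (auto simp: indicator_def)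
  then have kD: "k absolutely_integrable_on S \<longleftrightarrow> ?D absolutely_integrable_on S" "integral S k = integral S ?D"
    unfolding set_integrable_def using assms(8) by (auto intro!: integral_cong)
  have "k x \<ge> 0" if "x \<in> S" for x using assms(7)[of "\<phi> x"] assms(8)[OF that] that by simp
  then show ?thesis
    using nn_integral_set_lebesgue[OF assms(2,5,7)] nn_integral_set_lebesgue[OF assms(1,6)] cv kD
    by (metis (no_types, lifting))
qed

text \<open>Difference quotients integrate to zero by translation invariance of Lebesgue measure,
  and they converge boundedly to the derivative, so neither Fubini nor an iterated integral
  enters.\<close>

lemma integral_partial_eq_0:
  fixes v :: "real^2 \<Rightarrow> real"
  assumes d: "\<And>x. v differentiable (at x)" and cont: "continuous_on UNIV (partial i v)"
    and supp: "\<And>x. x \<notin> cball x0 r \<Longrightarrow> v x = 0"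
  shows "(\<integral>x. partial i v x \<partial>lborel) = 0"
proof -
  define e where "e = (axis i 1 :: real^2)"
  have ne: "norm e = 1" by (simp add: e_def)
  have dv: "((\<lambda>s. v (x + s *\<^sub>R e)) has_real_derivative partial i v (x + s *\<^sub>R e)) (at s)" for x s
    unfolding e_def by (rule axis_line_derivative[OF d])
  have cv: "continuous_on UNIV v"
    using d by (simp add: continuous_at_imp_continuous_on differentiable_imp_continuous_within)
  have "bounded (partial i v ` cball x0 (r + 1))"
    by (intro compact_imp_bounded compact_continuous_image compact_cball continuous_on_subset[OF cont]) simp
  then obtain B where B0: "\<forall>u\<in>partial i v ` cball x0 (r + 1). norm u \<le> B" by (auto simp: bounded_iff)
  have B: "\<bar>partial i v x\<bar> \<le> B" if "x \<in> cball x0 (r + 1)" for x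
    using bspec[OF B0 imageI[OF that]] by simp
  have p0: "partial i v x = 0" if "x \<notin> cball x0 r" for x
  proof -
    have "partial i v x = partial i (\<lambda>x. 0) x"
      by (rule partial_cong[of "- cball x0 r"]) (use that supp in auto)
    then show ?thesis by (simp add: partial_const)
  qed
  define a where "a n x = real (Suc n) * (v (x + (1 / real (Suc n)) *\<^sub>R e) - v x)" for n x
  have v_int: "integrable lborel v"
  proof -
    have "integrable lborel (\<lambda>x. indicator (cball x0 r) x *\<^sub>R v x)"
      by (rule borel_integrable_compact) (auto intro: continuous_on_subset[OF cv])
    moreover have "(\<lambda>x. indicator (cball x0 r) x *\<^sub>R v x) = v"
    proof
      show "indicator (cball x0 r) x *\<^sub>R v x = v x" for x using supp[of x] by (cases "x \<in> cball x0 r") auto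
    qed
    ultimately show ?thesis by simp
  qed
  have shift: "integrable lborel (\<lambda>x. v (x + h))" "(\<integral>x. v (x + h) \<partial>lborel) = (\<integral>x. v x \<partial>lborel)" for h
  proof -
    have m: "v \<in> borel_measurable borel" using cv by (rule borel_measurable_continuous_onI)
    have "integrable (distr lborel borel ((+) h)) v" using v_int by (simp only: lborel_distr_plus)
    then show "integrable lborel (\<lambda>x. v (x + h))"
      using m by (subst (asm) integrable_distr_eq) (auto simp: add.commute)
    have "(\<integral>x. v x \<partial>lborel) = (\<integral>x. v x \<partial>distr lborel borel ((+) h))" by (simp only: lborel_distr_plus)
    also have "\<dots> = (\<integral>x. v (x + h) \<partial>lborel)" using m by (subst integral_distr) (auto simp: add.commute)
    finally show "(\<integral>x. v (x + h) \<partial>lborel) = (\<integral>x. v x \<partial>lborel)" by simp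
  qed
  have a0: "(\<integral>x. a n x \<partial>lborel) = 0" for n
    unfolding a_def using shift v_int by simp
  \<comment> \<open>The steps of the quotients \<open>a n\<close> are at most 1, so all of them
    vanish outside the ball of radius r + 1, on which the bound B of the derivative
    dominates.\<close>
  have lim: "(\<lambda>n. \<integral>x. a n x \<partial>lborel) \<longlonglongrightarrow> (\<integral>x. partial i v x \<partial>lborel)"
  proof (rule integral_dominated_convergence[where w="\<lambda>x. indicator (cball x0 (r + 1)) x * B"])
    show "partial i v \<in> borel_measurable lborel"
      using borel_measurable_continuous_onI[OF cont] by simp
    show "a n \<in> borel_measurable lborel" for n
      unfolding a_def[abs_def] using shift(1) v_int by (intro borel_measurable_integrable) simp
    show "integrable lborel (\<lambda>x. indicator (cball x0 (r + 1)) x * B)"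
      using borel_integrable_compact[of "cball x0 (r + 1)" "\<lambda>_. B"] by simp
    show "AE x in lborel. (\<lambda>n. a n x) \<longlonglongrightarrow> partial i v x"
    proof (rule AE_I2)
      fix x
      have "((\<lambda>h. (v (x + h *\<^sub>R e) - v x) / h) \<longlongrightarrow> partial i v x) (at 0)"
        using dv[of x 0] by (simp add: has_field_derivative_iff)
      moreover have "filterlim (\<lambda>n. 1 / real (Suc n)) (at 0) sequentially"
        unfolding filterlim_at using LIMSEQ_Suc[OF lim_1_over_n] by auto
      ultimately have "(\<lambda>n. (v (x + (1 / real (Suc n)) *\<^sub>R e) - v x) / (1 / real (Suc n))) \<longlonglongrightarrow> partial i v x"
        by (rule filterlim_compose)
      then show "(\<lambda>n. a n x) \<longlonglongrightarrow> partial i v x" by (simp add: a_def mult.commute)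
    qed
    show "AE x in lborel. norm (a n x) \<le> indicator (cball x0 (r + 1)) x * B" for n
    proof (rule AE_I2)
      fix x
      let ?h = "1 / real (Suc n)"
      have h: "0 < ?h" "?h \<le> 1" by auto
      obtain s where s: "0 < s" "s < ?h" "v (x + ?h *\<^sub>R e) - v (x + 0 *\<^sub>R e) = (?h - 0) * partial i v (x + s *\<^sub>R e)"
        using MVT2[OF h(1), of "\<lambda>s. v (x + s *\<^sub>R e)" "\<lambda>s. partial i v (x + s *\<^sub>R e)"] dv by blast
      have ax: "a n x = partial i v (x + s *\<^sub>R e)"
        using s(3) by (simp add: a_def field_simps)
      have "s \<le> 1" using s(2) h(2) by linarith
      then have ds: "dist x (x + s *\<^sub>R e) \<le> 1" using s(1) by (simp add: dist_norm ne)
      show "norm (a n x) \<le> indicator (cball x0 (r + 1)) x * B"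
      proof (cases "x + s *\<^sub>R e \<in> cball x0 r")
        case True
        have "dist x0 x \<le> dist x0 (x + s *\<^sub>R e) + dist x (x + s *\<^sub>R e)" by (rule dist_triangle2)
        then have "x \<in> cball x0 (r + 1)" using ds True by simp
        moreover have "x + s *\<^sub>R e \<in> cball x0 (r + 1)" using True by auto
        ultimately show ?thesis using B ax by simp
      next
        case False
        have "B \<ge> 0" if "x \<in> cball x0 (r + 1)" using B[OF that] by linarith
        then show ?thesis using p0[OF False] ax by (auto simp: indicator_def)
      qed
    qed
  qed
  then show ?thesis unfolding a0 using LIMSEQ_unique tendsto_const by blast
qed

section \<open>The symplectic measure\<close>

context symp_surface
begin

definition dens :: "'a chart \<Rightarrow> real^2 \<Rightarrow> real" where
  "dens c x = \<bar>\<Omega> c (chart_inv c x) [] [1, 2]\<bar>"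

text \<open>Unlike \<open>chart_inv c\<close>, this is constant outside the coordinate domain and hence measurable.\<close>

definition coord_inv :: "'a chart \<Rightarrow> real^2 \<Rightarrow> 'a" where
  "coord_inv c x = (if x \<in> snd c ` fst c then chart_inv c x else undefined)"

definition chart_measure :: "'a chart \<Rightarrow> 'a measure" where
  "chart_measure c = distr (density lborel (\<lambda>x. ennreal (indicator (snd c ` fst c) x * dens c x))) borel (coord_inv c)"

lemma chart_image_eq:
  assumes "c \<in> A"
  shows "snd c ` (B \<inter> fst c) = coord_inv c -` B \<inter> snd c ` fst c"
proof -
  interpret c: chart c by (rule chart[OF assms])
  show ?thesis by (auto simp: coord_inv_def)
qed

lemma measurable_coord_inv:
  assumes "c \<in> A"
  shows "coord_inv c \<in> borel_measurable borel"
proof -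
  interpret c: chart c by (rule chart[OF assms])
  have "continuous_on (snd c ` fst c) (chart_inv c)"
    using c.homeo by (simp add: homeomorphism_def)
  then show ?thesis unfolding coord_inv_def[abs_def]
    by (intro borel_measurable_continuous_on_if) (simp_all add: c.open_img)
qed

lemma borel_chart_image: "c \<in> A \<Longrightarrow> B \<in> sets borel \<Longrightarrow> snd c ` (B \<inter> fst c) \<in> sets borel"
  unfolding chart_image_eq using measurable_sets[OF measurable_coord_inv, of c B] chart.open_img[OF chart]
  by auto

lemma measurable_on_chart:
  fixes f :: "'a \<Rightarrow> real"
  assumes "c \<in> A" "open W" "continuous_on (fst c \<inter> W) f"
  shows "(\<lambda>x. indicator (snd c ` (fst c \<inter> W)) x * f (chart_inv c x)) \<in> borel_measurable borel"
proof -
  interpret c: chart c by (rule chart[OF assms(1)])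
  have "continuous_on (snd c ` (fst c \<inter> W)) (\<lambda>x. f (chart_inv c x))"
    using c.homeo
    by (intro continuous_on_compose2[OF assms(3)]) (auto simp: homeomorphism_def intro: continuous_on_subset)
  then have "(\<lambda>x. indicator (snd c ` (fst c \<inter> W)) x *\<^sub>R f (chart_inv c x)) \<in> borel_measurable borel"
    using c.open_chart_image[OF assms(2)] by (intro borel_measurable_continuous_on_indicator) auto
  then show ?thesis by simp
qed

lemma continuous_Omega: "c \<in> A \<Longrightarrow> continuous_on (fst c) (\<lambda>p. \<bar>\<Omega> c p [] [1, 2]\<bar>)"
proof -
  assume c: "c \<in> A"
  interpret c: symp_chart c M \<Omega> by (rule symp_chart[OF c open_M]) simp
  have "fst c \<inter> M = fst c" using c M_eq by auto
  then show ?thesis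
    using c.smc_continuous[OF c.smc_Omega[of 1 2] open_M] by (intro continuous_intros) simp
qed

lemma measurable_dens: "c \<in> A \<Longrightarrow> (\<lambda>x. indicator (snd c ` fst c) x * dens c x) \<in> borel_measurable borel"
  using measurable_on_chart[of c UNIV "\<lambda>p. \<bar>\<Omega> c p [] [1, 2]\<bar>"] continuous_Omega by (simp add: dens_def)

lemma emeasure_chart_measure:
  assumes c: "c \<in> A" and B: "B \<in> sets borel"
  shows "emeasure (chart_measure c) B = (\<integral>\<^sup>+ x \<in> snd c ` (B \<inter> fst c). ennreal (dens c x) \<partial>lborel)"
proof -
  have m: "coord_inv c \<in> measurable (density lborel (\<lambda>x. ennreal (indicator (snd c ` fst c) x * dens c x))) borel"
    using measurable_coord_inv[OF c] by simp
  have "coord_inv c -` B \<in> sets lborel"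
    using measurable_sets[OF measurable_coord_inv[OF c] B] by simp
  then have "emeasure (chart_measure c) B = (\<integral>\<^sup>+ x. ennreal (indicator (snd c ` fst c) x * dens c x) * indicator (coord_inv c -` B) x \<partial>lborel)"
    unfolding chart_measure_def using measurable_dens[OF c]
    by (simp add: emeasure_distr[OF m B] emeasure_density)
  also have "\<dots> = (\<integral>\<^sup>+ x \<in> snd c ` (B \<inter> fst c). ennreal (dens c x) \<partial>lborel)"
    unfolding chart_image_eq[OF c] by (intro nn_integral_cong) (auto simp: indicator_def)
  finally show ?thesis .
qed

text \<open>The density |\<open>\<Omega>\<^sub>1\<^sub>2\<close>| changes by the absolute Jacobian
  determinant, which is the factor in the change of variables.\<close>

lemma chart_measure_transition:
  assumes c: "c \<in> A" and d: "d \<in> A" and B: "B \<in> sets borel" "B \<subseteq> fst c \<inter> fst d"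
  shows "emeasure (chart_measure c) B = emeasure (chart_measure d) B"
proof -
  interpret c: chart c by (rule chart[OF c])
  interpret d: chart d by (rule chart[OF d])
  let ?\<phi> = "\<lambda>x. snd d (chart_inv c x)"
  let ?S = "snd c ` B"
  let ?\<phi>' = "\<lambda>x v. \<chi> a. \<Sum>i\<in>UNIV. jac c d (chart_inv c x) a i * v $ i"
  have BB: "B \<inter> fst c = B" "B \<inter> fst d = B" using B by auto
  have "snd d (chart_inv c (snd c p)) = snd d p" if "p \<in> B" for p
    using that B(2) c.chart_inv_snd[of p] by auto
  then have im: "?\<phi> ` ?S = snd d ` B" unfolding image_image by (intro image_cong) auto
  have S: "?S \<in> sets borel" "?\<phi> ` ?S \<in> sets borel"
    unfolding im using borel_chart_image[OF c B(1)] borel_chart_image[OF d B(1)] BB by simp_all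
  have "(\<integral>\<^sup>+x\<in>?\<phi> ` ?S. ennreal (dens d x) \<partial>lborel) = (\<integral>\<^sup>+x\<in>?S. ennreal (dens c x) \<partial>lborel)"
  proof (rule nn_integral_change_of_variables[OF S, where \<phi>'="?\<phi>'"])
    show "inj_on ?\<phi> ?S"
    proof (rule inj_onI)
      fix x x' assume "x \<in> ?S" "x' \<in> ?S" "?\<phi> x = ?\<phi> x'"
      then obtain p q where pq: "x = snd c p" "x' = snd c q" "p \<in> B" "q \<in> B" by blast
      then have in_dom: "p \<in> fst c" "q \<in> fst c" "p \<in> fst d" "q \<in> fst d" using B(2) by auto
      have "snd d p = snd d q"
        using \<open>?\<phi> x = ?\<phi> x'\<close> unfolding pq(1,2) by (simp only: c.chart_inv_snd in_dom)
      then have "chart_inv d (snd d p) = chart_inv d (snd d q)" by (rule arg_cong)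
      then have "p = q" by (simp only: d.chart_inv_snd in_dom)
      then show "x = x'" using pq by (simp only:)
    qed
    fix x assume "x \<in> ?S"
    then obtain p where p: "p \<in> B" "x = snd c p" by auto
    have pcd: "p \<in> fst c \<inter> fst d" "p \<in> fst c" using p B by auto
    have "((\<lambda>x. ?\<phi> x $ a) has_derivative (\<lambda>v. \<Sum>i\<in>UNIV. jac c d p a i * v $ i)) (at x)" for a
    proof -
      have "dif c (\<lambda>q. snd d q $ a) p"
        by (rule c.smc_dif[OF smc_coordinate[OF c d] d.open_dom pcd(1)])
      then show ?thesis
        using partial_has_derivative[of "\<lambda>x. ?\<phi> x $ a" x] p pcd by (simp add: dif_def jac_def pd_def)
    qed
    then have "(?\<phi> has_derivative ?\<phi>' x) (at x)"
      using p pcd by (subst has_derivative_componentwise_within) (auto simp: Basis_vec_def inner_axis)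
    then show "(?\<phi> has_derivative ?\<phi>' x) (at x within ?S)" by (rule has_derivative_at_withinI)
    have "det (matrix (?\<phi>' x)) = jdet c d p"
      using p pcd by (simp add: det_2 matrix_def axis_def jdet_def sum_2)
    then show "dens c x = \<bar>det (matrix (?\<phi>' x))\<bar> * dens d (?\<phi> x)"
      using Omega_transition[OF c d pcd(1)] p pcd by (simp add: dens_def abs_mult)
  next
    have "(\<lambda>x. indicator (snd d ` B) x * (indicator (snd d ` fst d) x * dens d x)) \<in> borel_measurable borel"
      using measurable_dens[OF d] S(2) unfolding im by measurable
    moreover have "(\<lambda>x. indicator (snd d ` B) x * (indicator (snd d ` fst d) x * dens d x)) = (\<lambda>x. indicator (?\<phi> ` ?S) x * dens d x)"
      unfolding im using B by (auto simp: indicator_def fun_eq_iff)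
    ultimately show "(\<lambda>x. indicator (?\<phi> ` ?S) x * dens d x) \<in> borel_measurable borel" by simp
    have "(\<lambda>x. indicator ?S x * (indicator (snd c ` fst c) x * dens c x)) \<in> borel_measurable borel"
      using measurable_dens[OF c] S(1) by measurable
    moreover have "(\<lambda>x. indicator ?S x * (indicator (snd c ` fst c) x * dens c x)) = (\<lambda>x. indicator ?S x * dens c x)"
      using B by (auto simp: indicator_def fun_eq_iff)
    ultimately show "(\<lambda>x. indicator ?S x * dens c x) \<in> borel_measurable borel" by simp
  qed (simp add: dens_def)
  then show ?thesis
    unfolding emeasure_chart_measure[OF c B(1)] emeasure_chart_measure[OF d B(1)] BB im by simp
qed


text \<open>The Lindelof property of a second countable space. The charts are listed with
  repetitions over all natural numbers to fit \<open>disjointed\<close>; \<open>c0\<close> keeps the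
  list nonempty when the subcover is empty.\<close>

lemma countable_atlas:
  assumes "A \<noteq> {}"
  obtains cn :: "nat \<Rightarrow> 'a chart" where "\<And>n. cn n \<in> A" "M = (\<Union>n. fst (cn n))"
proof -
  have "open U" if "U \<in> fst ` A" for U using that chart.open_dom[OF chart] by blast
  then obtain F where F: "F \<subseteq> fst ` A" "countable F" "\<Union>F = \<Union>(fst ` A)"
    by (rule Lindelof)
  obtain c0 where c0: "c0 \<in> A" using assms by auto
  define pick where "pick U = (SOME c. c \<in> A \<and> fst c = U)" for U
  have pick: "pick U \<in> A" "fst (pick U) = U" if "U \<in> F" for U
  proof -
    have "\<exists>c. c \<in> A \<and> fst c = U" using F(1) that by (metis imageE subsetD)
    from someI_ex[OF this] show "pick U \<in> A" "fst (pick U) = U" by (simp_all add: pick_def)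
  qed
  let ?A = "insert c0 (pick ` F)"
  have A: "countable ?A" "?A \<noteq> {}" "?A \<subseteq> A" using F(2) c0 pick by auto
  then have r: "range (from_nat_into ?A) = ?A" by simp
  have "(\<Union>n. fst (from_nat_into ?A n)) = (\<Union>c\<in>range (from_nat_into ?A). fst c)" by simp
  also have "\<dots> = M"
  proof
    show "(\<Union>c\<in>range (from_nat_into ?A). fst c) \<subseteq> M" unfolding r M_eq using A(3) by blast
    have "fst c \<subseteq> (\<Union>c\<in>pick ` F. fst c)" if "c \<in> A" for c
    proof -
      have "fst c \<subseteq> \<Union>F" using that F(3) by blast
      also have "\<Union>F = (\<Union>c\<in>pick ` F. fst c)" using pick(2) by simp
      finally show ?thesis .
    qed
    then show "M \<subseteq> (\<Union>c\<in>range (from_nat_into ?A). fst c)" unfolding r M_eq by blast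
  qed
  finally show ?thesis using that[of "from_nat_into ?A"] r A(3) by (metis rangeI subsetD)
qed

definition is_symplectic_measure :: "'a measure \<Rightarrow> bool" where
  "is_symplectic_measure \<mu> \<longleftrightarrow> sets \<mu> = sets borel \<and>
     emeasure \<mu> (- (\<Union>c\<in>A. fst c)) = 0 \<and>
     (\<forall>c\<in>A. \<forall>B\<in>sets borel. B \<subseteq> fst c \<longrightarrow>
        emeasure \<mu> B = (\<integral>\<^sup>+ x \<in> snd c ` B. ennreal \<bar>\<Omega> c (chart_inv c x) [] [1, 2]\<bar> \<partial>lborel))"

lemma is_symplectic_measure_chart:
  assumes "is_symplectic_measure \<mu>" "c \<in> A" "B \<in> sets borel" "B \<subseteq> fst c"
  shows "emeasure \<mu> B = emeasure (chart_measure c) B"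
proof -
  have "B \<inter> fst c = B" using assms(4) by auto
  then show ?thesis
    using assms unfolding is_symplectic_measure_def by (simp add: emeasure_chart_measure dens_def)
qed

text \<open>Cut M into countably many disjoint Borel pieces, each inside one chart. A symplectic
  measure is null off M and prescribed on each piece, hence unique; conversely the prescribed values
  add up to a measure, and \<open>chart_measure_transition\<close> shows that it has the right
  density in every other chart as well.\<close>

lemma ex1_symplectic_measure:
  assumes "A \<noteq> {}"
  shows "\<exists>!\<mu>. is_symplectic_measure \<mu>"
proof -
  obtain cn :: "nat \<Rightarrow> 'a chart" where cn: "\<And>n. cn n \<in> A" "M = (\<Union>n. fst (cn n))"
    using countable_atlas[OF assms] by metis
  define P where "P = disjointed (\<lambda>n. fst (cn n))"
  have dP: "disjoint_family P" unfolding P_def by (rule disjoint_family_disjointed)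
  have PM: "(\<Union>n. P n) = M" unfolding P_def UN_disjointed_eq cn(2) ..
  have Pn: "P n \<subseteq> fst (cn n)" for n unfolding P_def by (rule disjointed_subset)
  have "fst (cn n) \<in> sets borel" for n using chart.open_dom[OF chart[OF cn(1)]] by simp
  then have bP: "P n \<in> sets borel" for n
    using sets.range_disjointed_sets[of "\<lambda>n. fst (cn n)" borel] unfolding P_def by blast
  \<comment> \<open>The only possible value, since the n-th piece lies in the n-th chart.\<close>
  define N where "N B = (\<Sum>n. emeasure (chart_measure (cn n)) (B \<inter> P n))" for B
  have disj: "disjoint_family (\<lambda>n. B \<inter> P n)" for B
    using dP by (auto simp: disjoint_family_on_def)
  have unions: "(\<Union>n. B \<inter> P n) = B \<inter> M" for B using PM by auto
  have unique: "emeasure \<mu> B = N B" if \<mu>: "is_symplectic_measure \<mu>" and B: "B \<in> sets borel" for \<mu> B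
  proof -
    have s: "sets \<mu> = sets borel" using \<mu> by (simp add: is_symplectic_measure_def)
    have Mb: "M \<in> sets borel" using open_M by simp
    have "emeasure \<mu> (- M) = 0" using \<mu> unfolding is_symplectic_measure_def M_eq by blast
    moreover have "- M \<in> sets \<mu>" unfolding s using Mb by (rule borel_comp)
    ultimately have null: "- M \<in> null_sets \<mu>" by (rule null_setsI)
    have "emeasure \<mu> (B \<union> - M) = emeasure \<mu> (B \<inter> M \<union> - M)" by (intro arg_cong[of _ _ "emeasure \<mu>"]) auto
    then have "emeasure \<mu> B = emeasure \<mu> (B \<inter> M)"
      using emeasure_Un_null_set[OF _ null] B Mb s by simp
    also have "\<dots> = (\<Sum>n. emeasure \<mu> (B \<inter> P n))"
      unfolding unions[symmetric] by (rule suminf_emeasure[symmetric]) (use B bP s disj in auto)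
    also have "\<dots> = N B"
      unfolding N_def using B bP Pn by (intro suminf_cong is_symplectic_measure_chart[OF \<mu> cn(1)]) auto
    finally show ?thesis .
  qed
  define \<mu> where "\<mu> = measure_of UNIV (sets borel) N"
  have sa: "sigma_algebra UNIV (sets (borel :: 'a measure))"
    using sets.sigma_algebra_axioms[of borel] by simp
  have sets_\<mu>: "sets \<mu> = sets borel"
    unfolding \<mu>_def by (rule sigma_algebra.sets_measure_of_eq[OF sa])
  have em: "emeasure \<mu> B = N B" if "B \<in> sets borel" for B
    unfolding \<mu>_def
  proof (rule emeasure_measure_of_sigma[OF sa _ _ that])
    show "positive (sets borel) N" by (simp add: positive_def N_def)
    show "countably_additive (sets borel) N"
      unfolding countably_additive_def
    proof (intro allI impI)
      fix B :: "nat \<Rightarrow> 'a set" assume B: "range B \<subseteq> sets borel" "disjoint_family B"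
      \<comment> \<open>The two infinite sums are exchanged by viewing the inner one as an integral
        over counting measure.\<close>
      have "(\<Sum>i. N (B i)) = (\<Sum>i. \<integral>\<^sup>+n. emeasure (chart_measure (cn n)) (B i \<inter> P n) \<partial>count_space UNIV)"
        unfolding N_def nn_integral_count_space_nat ..
      also have "\<dots> = (\<integral>\<^sup>+n. (\<Sum>i. emeasure (chart_measure (cn n)) (B i \<inter> P n)) \<partial>count_space UNIV)"
        by (rule nn_integral_suminf[symmetric]) simp
      also have "\<dots> = (\<integral>\<^sup>+n. emeasure (chart_measure (cn n)) ((\<Union>i. B i) \<inter> P n) \<partial>count_space UNIV)"
      proof (rule nn_integral_cong)
        fix n
        have "(\<Sum>i. emeasure (chart_measure (cn n)) (B i \<inter> P n)) = emeasure (chart_measure (cn n)) (\<Union>i. B i \<inter> P n)"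
          using B bP by (intro suminf_emeasure) (auto simp: chart_measure_def disjoint_family_on_def)
        also have "(\<Union>i. B i \<inter> P n) = (\<Union>i. B i) \<inter> P n" by auto
        finally show "(\<Sum>i. emeasure (chart_measure (cn n)) (B i \<inter> P n)) = emeasure (chart_measure (cn n)) ((\<Union>i. B i) \<inter> P n)" .
      qed
      also have "\<dots> = N (\<Union>i. B i)" unfolding N_def nn_integral_count_space_nat ..
      finally show "(\<Sum>i. N (B i)) = N (\<Union>i. B i)" .
    qed
  qed
  have sm: "is_symplectic_measure \<mu>"
    unfolding is_symplectic_measure_def
  proof (intro conjI ballI impI)
    have "- M \<in> sets borel" using open_M by (intro borel_comp) simp
    moreover have "- M \<inter> P n = {}" for n using PM by auto
    ultimately show "emeasure \<mu> (- (\<Union>c\<in>A. fst c)) = 0" unfolding M_eq[symmetric] by (simp add: em N_def)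
    fix c B assume c: "c \<in> A" and B: "B \<in> sets borel" "B \<subseteq> fst c"
    have "emeasure \<mu> B = (\<Sum>n. emeasure (chart_measure c) (B \<inter> P n))"
      unfolding em[OF B(1)] N_def
      using B bP Pn by (intro suminf_cong chart_measure_transition cn c) auto
    also have "\<dots> = emeasure (chart_measure c) (\<Union>n. B \<inter> P n)"
      by (rule suminf_emeasure) (use B bP disj in \<open>auto simp: chart_measure_def\<close>)
    also have "(\<Union>n. B \<inter> P n) = B" unfolding unions using B c M_eq by auto
    also have "emeasure (chart_measure c) B = (\<integral>\<^sup>+ x \<in> snd c ` (B \<inter> fst c). ennreal (dens c x) \<partial>lborel)"
      by (rule emeasure_chart_measure[OF c B(1)])
    also have "B \<inter> fst c = B" using B by auto
    finally show "emeasure \<mu> B = (\<integral>\<^sup>+ x \<in> snd c ` B. ennreal \<bar>\<Omega> c (chart_inv c x) [] [1, 2]\<bar> \<partial>lborel)"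
      by (simp add: dens_def)
  qed (rule sets_\<mu>)
  show ?thesis
  proof (rule ex1I)
    show "is_symplectic_measure \<mu>" by (rule sm)
    fix \<mu>' assume \<mu>': "is_symplectic_measure \<mu>'"
    show "\<mu>' = \<mu>"
    proof (rule measure_eqI)
      show "sets \<mu>' = sets \<mu>" using \<mu>' sets_\<mu> by (simp add: is_symplectic_measure_def)
      fix B assume "B \<in> sets \<mu>'"
      then have "B \<in> sets borel" using \<mu>' by (simp add: is_symplectic_measure_def)
      then show "emeasure \<mu>' B = emeasure \<mu> B" using unique[OF \<mu>'] unique[OF sm] by simp
    qed
  qed
qed

abbreviation vol :: "'a measure" where "vol \<equiv> symplectic_measure A \<Omega>"

lemma symplectic_measure: "A \<noteq> {} \<Longrightarrow> is_symplectic_measure vol"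
  unfolding symplectic_measure_def is_symplectic_measure_def[symmetric]
  by (rule theI'[OF ex1_symplectic_measure])

lemma sets_vol: "A \<noteq> {} \<Longrightarrow> sets vol = sets borel"
  using symplectic_measure by (simp add: is_symplectic_measure_def)

lemma density_vol:
  assumes c: "c \<in> A"
  shows "density vol (\<lambda>p. ennreal (indicator (fst c) p)) = chart_measure c"
proof (rule measure_eqI)
  have A: "A \<noteq> {}" using c by auto
  show "sets (density vol (\<lambda>p. ennreal (indicator (fst c) p))) = sets (chart_measure c)"
    by (simp add: chart_measure_def sets_vol[OF A])
  fix B assume "B \<in> sets (density vol (\<lambda>p. ennreal (indicator (fst c) p)))"
  then have B: "B \<in> sets borel" by (simp add: sets_vol[OF A])
  have oc: "fst c \<in> sets borel" using chart.open_dom[OF chart[OF c]] by simp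
  have m: "(\<lambda>p. ennreal (indicator (fst c) p)) \<in> borel_measurable vol"
    using oc by (simp add: sets_vol[OF A] borel_measurable_indicator)
  have "emeasure (density vol (\<lambda>p. ennreal (indicator (fst c) p))) B =
      (\<integral>\<^sup>+p. ennreal (indicator (fst c) p) * indicator B p \<partial>vol)"
    using B sets_vol[OF A] by (intro emeasure_density m) simp
  also have "\<dots> = (\<integral>\<^sup>+p. indicator (B \<inter> fst c) p \<partial>vol)"
    by (intro nn_integral_cong) (auto simp: indicator_def)
  also have "\<dots> = emeasure vol (B \<inter> fst c)"
    using B oc sets_vol[OF A] by simp
  also have "\<dots> = emeasure (chart_measure c) (B \<inter> fst c)"
    using B oc by (intro is_symplectic_measure_chart[OF symplectic_measure[OF A] c]) auto
  also have "\<dots> = emeasure (chart_measure c) B"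
    using B oc by (simp add: emeasure_chart_measure[OF c])
  finally show "emeasure (density vol (\<lambda>p. ennreal (indicator (fst c) p))) B = emeasure (chart_measure c) B" .
qed

text \<open>Since h vanishes off the chart, the measure may be replaced by its restriction, and by
  \<open>density_vol\<close> that is the image of a weighted Lebesgue measure.\<close>

lemma chart_integral:
  assumes c: "c \<in> A" and h: "h \<in> borel_measurable borel" "\<And>p. p \<notin> fst c \<Longrightarrow> h p = (0::real)"
  shows "integrable vol h \<longleftrightarrow> integrable lborel (\<lambda>x. indicator (snd c ` fst c) x * dens c x * h (coord_inv c x))"
    "integral\<^sup>L vol h = (\<integral>x. indicator (snd c ` fst c) x * dens c x * h (coord_inv c x) \<partial>lborel)"
proof -
  have A: "A \<noteq> {}" using c by auto
  have oc: "fst c \<in> sets borel" using chart.open_dom[OF chart[OF c]] by simp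
  have mh: "h \<in> borel_measurable vol" using h(1) sets_vol[OF A] by (simp cong: measurable_cong_sets)
  have mi: "(\<lambda>p. indicator (fst c) p :: real) \<in> borel_measurable vol"
    using oc sets_vol[OF A] by (intro borel_measurable_indicator) simp
  have hi: "(\<lambda>p. indicator (fst c) p *\<^sub>R h p) = h"
  proof
    show "indicator (fst c) p *\<^sub>R h p = h p" for p using h(2)[of p] by (cases "p \<in> fst c") simp_all
  qed
  have mc: "coord_inv c \<in> measurable (density lborel (\<lambda>x. ennreal (indicator (snd c ` fst c) x * dens c x))) borel"
    using measurable_coord_inv[OF c] by simp
  have md: "(\<lambda>x. indicator (snd c ` fst c) x * dens c x) \<in> borel_measurable lborel"
    using measurable_dens[OF c] by simp
  have mhc: "(\<lambda>x. h (coord_inv c x)) \<in> borel_measurable lborel"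
    using measurable_compose[OF measurable_coord_inv[OF c] h(1)] by simp
  have pos: "AE x in lborel. 0 \<le> indicator (snd c ` fst c) x * dens c x"
    by (simp add: dens_def)
  have "integrable vol h \<longleftrightarrow> integrable (density vol (\<lambda>p. ennreal (indicator (fst c) p))) h"
    using integrable_density[OF mh mi] unfolding hi by simp
  then show "integrable vol h \<longleftrightarrow> integrable lborel (\<lambda>x. indicator (snd c ` fst c) x * dens c x * h (coord_inv c x))"
    unfolding density_vol[OF c] chart_measure_def integrable_distr_eq[OF mc h(1)]
    using integrable_density[OF mhc md pos] by simp
  have "integral\<^sup>L vol h = integral\<^sup>L (density vol (\<lambda>p. ennreal (indicator (fst c) p))) h"
    using integral_density[OF mh mi] unfolding hi by simp
  then show "integral\<^sup>L vol h = (\<integral>x. indicator (snd c ` fst c) x * dens c x * h (coord_inv c x) \<partial>lborel)"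
    unfolding density_vol[OF c] chart_measure_def integral_distr[OF mc h(1)]
    using integral_density[OF mhc md pos] by simp
qed

section \<open>Integration over closed coordinate discs\<close>

definition disc :: "'a set \<Rightarrow> 'a chart \<Rightarrow> real^2 \<Rightarrow> real \<Rightarrow> bool" where
  "disc W c x0 r \<longleftrightarrow> c \<in> A \<and> 0 < r \<and> cball x0 r \<subseteq> snd c ` (fst c \<inter> W)"

lemma disc_integral:
  fixes f :: "'a \<Rightarrow> real"
  assumes W: "open W" "W \<subseteq> M" and D: "disc W c x0 r" and f: "continuous_on (fst c \<inter> W) f"
    and supp: "\<And>p. p \<in> W \<Longrightarrow> p \<notin> chart_inv c ` cball x0 r \<Longrightarrow> f p = 0"
  shows "set_integrable vol W f"
    "(LINT p:W|vol. f p) = (\<integral>x. indicator (cball x0 r) x * (dens c x * f (chart_inv c x)) \<partial>lborel)"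
proof -
  have c: "c \<in> A" and sub: "cball x0 r \<subseteq> snd c ` (fst c \<inter> W)" using D by (auto simp: disc_def)
  interpret c: chart c by (rule chart[OF c])
  let ?h = "\<lambda>p. indicator W p * f p"
  have K: "chart_inv c ` cball x0 r \<subseteq> fst c \<inter> W" using sub c.chart_inv_in by auto
  have "?h = (\<lambda>p. indicator (fst c \<inter> W) p *\<^sub>R f p)"
    using supp K by (fastforce simp: indicator_def)
  then have mh: "?h \<in> borel_measurable borel"
    using borel_measurable_continuous_on_indicator[OF _ f] c.open_dom W by simp
  have h0: "?h p = 0" if "p \<notin> fst c" for p using that supp K by (auto simp: indicator_def)
  have eq: "indicator (snd c ` fst c) x * dens c x * ?h (coord_inv c x) = indicator (cball x0 r) x * (dens c x * f (chart_inv c x))" for x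
  proof (cases "x \<in> snd c ` fst c")
    case True
    then obtain p where p: "p \<in> fst c" "x = snd c p" by auto
    have cx: "coord_inv c x = p" "chart_inv c x = p" using p by (auto simp: coord_inv_def)
    show ?thesis
    proof (cases "x \<in> cball x0 r")
      case True
      then have "p \<in> W" using K cx by (metis IntE image_eqI subsetD)
      then show ?thesis using True cx \<open>x \<in> snd c ` fst c\<close> by simp
    next
      case False
      have "p \<notin> chart_inv c ` cball x0 r"
      proof
        assume "p \<in> chart_inv c ` cball x0 r"
        then obtain x' where x': "p = chart_inv c x'" "x' \<in> cball x0 r" by auto
        then have "snd c p = x'" using sub c.snd_chart_inv by auto
        then show False using p x' False by simp
      qed
      then have "?h p = 0" using supp by (auto simp: indicator_def)
      then show ?thesis using False cx by simp
    qed
  next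
    case False
    then have "x \<notin> cball x0 r" using sub by blast
    then show ?thesis using False by simp
  qed
  have "continuous_on (cball x0 r) (\<lambda>x. f (chart_inv c x))"
    using c.homeo sub K by (intro continuous_on_compose2[OF f]) (auto simp: homeomorphism_def intro: continuous_on_subset)
  moreover have "continuous_on (cball x0 r) (dens c)"
    unfolding dens_def[abs_def] using c.homeo sub K
    by (intro continuous_on_compose2[OF continuous_Omega[OF c]]) (auto simp: homeomorphism_def intro: continuous_on_subset)
  ultimately have "integrable lborel (\<lambda>x. indicator (cball x0 r) x *\<^sub>R (dens c x * f (chart_inv c x)))"
    by (intro borel_integrable_compact compact_cball continuous_on_mult)
  then show "set_integrable vol W f"
    unfolding set_integrable_def using chart_integral(1)[OF c mh h0] unfolding eq by simp
  show "(LINT p:W|vol. f p) = (\<integral>x. indicator (cball x0 r) x * (dens c x * f (chart_inv c x)) \<partial>lborel)"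
    unfolding set_lebesgue_integral_def using chart_integral(2)[OF c mh h0] unfolding eq by simp
qed

end

text \<open>Extended by zero, g becomes differentiable on the whole plane, because S and the
  complement of the disc form an open cover on each of which the extension is known.\<close>

lemma integral_partial_disc:
  assumes g: "smooth_on g S" and S: "open S" "cball x0 r \<subseteq> S" and 0: "\<And>x. x \<in> S - cball x0 r \<Longrightarrow> g x = 0"
  shows "integrable lborel (\<lambda>x. indicator (cball x0 r) x * partial i g x)"
    "(\<integral>x. indicator (cball x0 r) x * partial i g x \<partial>lborel) = 0"
proof -
  define v where "v x = (if x \<in> S then g x else 0)" for x
  have gv: "g x = v x" if "x \<in> S" for x using that by (simp add: v_def)
  have v0: "v x = 0" if "x \<in> - cball x0 r" for x using that 0 by (auto simp: v_def)
  have pS: "partial i v x = partial i g x" if "x \<in> S" for x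
    by (rule partial_cong[OF S(1) that]) (simp add: gv)
  have p0: "partial i v x = 0" if "x \<in> - cball x0 r" for x
  proof -
    have "partial i v x = partial i (\<lambda>x. 0) x" by (rule partial_cong[OF _ that]) (auto intro: v0)
    then show ?thesis by (simp add: partial_const)
  qed
  have cov: "x \<in> S \<or> x \<in> - cball x0 r" for x using S(2) by auto
  have "v differentiable (at x)" for x
  proof (cases "x \<in> S")
    case True
    obtain F where "(g has_derivative F) (at x)"
      using smooth_on_differentiable[OF g S(1) True] unfolding differentiable_def by blast
    from has_derivative_transform_within_open[OF this S(1) True, of v] gv
    show ?thesis unfolding differentiable_def by blast
  next
    case False
    then have x: "x \<in> - cball x0 r" using cov by blast
    have "((\<lambda>x. 0) has_derivative (\<lambda>h. 0)) (at x)" by simp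
    from has_derivative_transform_within_open[OF this _ x, of v] v0
    show ?thesis unfolding differentiable_def by fastforce
  qed
  moreover have "continuous_on UNIV (partial i v)"
  proof -
    have "continuous_on S (partial i v)"
      using smooth_on_continuous[OF smooth_on_partial[OF g]] pS by (metis continuous_on_cong)
    moreover have "continuous_on (- cball x0 r) (partial i v)"
      using continuous_on_const[of "- cball x0 r" 0] p0 by (metis continuous_on_cong)
    ultimately have "continuous_on (S \<union> - cball x0 r) (partial i v)"
      using S(1) by (intro continuous_on_open_Un) auto
    moreover have "S \<union> - cball x0 r = UNIV" using cov by (metis UNIV_eq_I Un_iff)
    ultimately show ?thesis by simp
  qed
  ultimately have "(\<integral>x. partial i v x \<partial>lborel) = 0"
    using v0 by (intro integral_partial_eq_0[of v i x0 r]) auto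
  moreover have "partial i v x = indicator (cball x0 r) x * partial i g x" for x
    using p0[of x] pS[of x] S(2) by (auto simp: indicator_def)
  ultimately show "(\<integral>x. indicator (cball x0 r) x * partial i g x \<partial>lborel) = 0" by simp
  have "continuous_on (cball x0 r) (partial i g)"
    using smooth_on_continuous[OF smooth_on_partial[OF g]] S(2) continuous_on_subset by blast
  from borel_integrable_compact[OF _ this] show "integrable lborel (\<lambda>x. indicator (cball x0 r) x * partial i g x)"
    by simp
qed

lemma (in symp_surface) disc_divergence:
  assumes W: "open W" "W \<subseteq> M" and D: "disc W c x0 r" and f: "continuous_on (fst c \<inter> W) f"
    and supp: "\<And>p. p \<in> W \<Longrightarrow> p \<notin> chart_inv c ` cball x0 r \<Longrightarrow> f p = 0"
    and V: "smc c W V1" "smc c W V2"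
    and V0: "\<And>p. p \<in> fst c \<inter> W \<Longrightarrow> p \<notin> chart_inv c ` cball x0 r \<Longrightarrow> V1 p = 0 \<and> V2 p = 0"
    and div: "\<And>p. p \<in> fst c \<inter> W \<Longrightarrow> f p * \<Omega> c p [] [1, 2] = pd c 1 V1 p + pd c 2 V2 p"
  shows "(LINT p:W|vol. f p) = 0"
proof -
  have c: "c \<in> A" and sub: "cball x0 r \<subseteq> snd c ` (fst c \<inter> W)" using D by (auto simp: disc_def)
  interpret c: symp_chart c W \<Omega> by (rule symp_chart[OF c W])
  let ?S = "snd c ` (fst c \<inter> W)"
  let ?O = "\<lambda>x. \<Omega> c (chart_inv c x) [] [1, 2]"
  let ?v = "\<lambda>V x. V (chart_inv c x)"
  have K: "chart_inv c x \<in> fst c \<inter> W" "snd c (chart_inv c x) = x" if "x \<in> cball x0 r" for x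
    using sub that c.chart_inv_in c.snd_chart_inv by auto
  have nz: "?O x \<noteq> 0" if "x \<in> cball x0 r" for x using c.Omega_nz[OF K(1)[OF that]] .
  have cO: "continuous_on (cball x0 r) ?O"
    using continuous_on_subset[OF smooth_on_continuous[OF c.smc_Omega[unfolded smc_def]] sub] .
  \<comment> \<open>The measure has density |\<open>\<Omega>\<^sub>1\<^sub>2\<close>|, whereas
    \<open>div\<close> is stated with \<open>\<Omega>\<^sub>1\<^sub>2\<close>. On the connected disc
    this nonvanishing function has a constant sign \<sigma>, so charts of either orientation are
    covered.\<close>
  obtain \<sigma> where \<sigma>: "\<And>x. x \<in> cball x0 r \<Longrightarrow> \<bar>?O x\<bar> = \<sigma> * ?O x"
  proof (cases "\<exists>x\<in>cball x0 r. ?O x > 0")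
    case True
    have pos: "?O y > 0" if y: "y \<in> cball x0 r" for y
    proof (rule ccontr)
      assume "\<not> ?O y > 0"
      obtain x where x: "x \<in> cball x0 r" "?O x > 0" using True by auto
      have "connected (?O ` cball x0 r)" by (intro connected_continuous_image cO) simp
      then have "{?O y..?O x} \<subseteq> ?O ` cball x0 r"
        by (rule connected_contains_Icc) (use x y in auto)
      moreover have "0 \<in> {?O y..?O x}" using x(2) \<open>\<not> ?O y > 0\<close> by simp
      ultimately have "0 \<in> ?O ` cball x0 r" by blast
      then show False using nz by auto
    qed
    have "\<bar>?O x\<bar> = 1 * ?O x" if "x \<in> cball x0 r" for x using pos[OF that] by simp
    then show ?thesis by (rule that)
  next
    case False
    have "\<bar>?O x\<bar> = - 1 * ?O x" if "x \<in> cball x0 r" for x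
    proof -
      have "\<not> ?O x > 0" using False that by blast
      then show ?thesis by simp
    qed
    then show ?thesis by (rule that)
  qed
  have zero: "?v V x = 0" if V: "V = V1 \<or> V = V2" and x: "x \<in> ?S - cball x0 r" for V x
  proof -
    obtain p where p: "p \<in> fst c \<inter> W" "x = snd c p" using x by auto
    have "p \<notin> chart_inv c ` cball x0 r" using K x p by (metis DiffD2 imageE)
    then show ?thesis using V0[OF p(1)] p V by auto
  qed
  have zero1: "?v V1 x = 0" and zero2: "?v V2 x = 0" if "x \<in> ?S - cball x0 r" for x
    using zero[OF _ that] by auto
  note int1 = integral_partial_disc[OF V(1)[unfolded smc_def] c.open_chart_image[OF W(1)] sub zero1, of 1]
  note int2 = integral_partial_disc[OF V(2)[unfolded smc_def] c.open_chart_image[OF W(1)] sub zero2, of 2]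
  have "indicator (cball x0 r) x * (dens c x * f (chart_inv c x)) =
      \<sigma> * (indicator (cball x0 r) x * partial 1 (?v V1) x + indicator (cball x0 r) x * partial 2 (?v V2) x)" for x
  proof (cases "x \<in> cball x0 r")
    case True
    have "f (chart_inv c x) * ?O x = partial 1 (?v V1) x + partial 2 (?v V2) x"
      using div[OF K(1)[OF True]] K(2)[OF True] by (simp add: pd_def)
    then show ?thesis using \<sigma>[OF True] True by (simp add: dens_def mult.assoc) (simp add: mult.commute)
  qed simp
  then show ?thesis
    using disc_integral(2)[OF W D f supp] int1 int2 by simp
qed

section \<open>Partitions of unity\<close>

lemma (in chart) smc_local:
  assumes "open W" "\<And>p. p \<in> fst c \<inter> W \<Longrightarrow> \<exists>T. open T \<and> p \<in> T \<and> smc c T f"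
  shows "smc c W f"
  unfolding smc_def smooth_on_def
proof
  fix k
  show "Ck_on k (\<lambda>x. f (chart_inv c x)) (snd c ` (fst c \<inter> W))"
  proof (rule Ck_on_local[OF open_chart_image[OF assms(1)]])
    fix x assume "x \<in> snd c ` (fst c \<inter> W)"
    then obtain p where p: "p \<in> fst c \<inter> W" "x = snd c p" by auto
    obtain T where T: "open T" "p \<in> T" "smc c T f" using assms(2)[OF p(1)] by blast
    then show "\<exists>T. open T \<and> x \<in> T \<and> Ck_on k (\<lambda>x. f (chart_inv c x)) T"
      using p open_chart_image[OF T(1)]
      by (intro exI[of _ "snd c ` (fst c \<inter> T)"]) (auto simp: smc_def smooth_on_def)
  qed
qed

lemma (in chart) smc_flat: "open W \<Longrightarrow> smc c W f \<Longrightarrow> smc c W (\<lambda>q. flat 0 (f q))"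
  unfolding smc_def by (intro smooth_on_flat open_chart_image)

lemma dist_2: "(dist x y)\<^sup>2 = (x $ 1 - y $ 1)\<^sup>2 + (x $ 2 - y $ 2)\<^sup>2" for x y :: "real^2"
  by (simp add: dist_vec_def L2_set_def sum_2 dist_real_def)

text \<open>The squared distance to the centre, which unlike the distance is smooth at the
  centre.\<close>

definition sqd :: "'a chart \<Rightarrow> real^2 \<Rightarrow> 'a \<Rightarrow> real" where
  "sqd c x0 p = (snd c p $ 1 - x0 $ 1)\<^sup>2 + (snd c p $ 2 - x0 $ 2)\<^sup>2"

text \<open>The usual quotient of flat functions: the numerator vanishes from radius r outwards, the
  second term of the denominator up to radius r/2. They do not vanish together, so the denominator
  is positive.\<close>

definition plateau :: "'a chart \<Rightarrow> real^2 \<Rightarrow> real \<Rightarrow> 'a \<Rightarrow> real" where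
  "plateau c x0 r p = (if p \<in> fst c then flat 0 (r\<^sup>2 - sqd c x0 p) *
     inverse (flat 0 (r\<^sup>2 - sqd c x0 p) + flat 0 (sqd c x0 p - r\<^sup>2 / 4)) else 0)"

lemma sqd_dist: "sqd c x0 p = (dist x0 (snd c p))\<^sup>2"
  unfolding sqd_def dist_2[symmetric] by (simp add: dist_commute)

lemma plateau_denominator:
  assumes "0 < r"
  shows "flat 0 (r\<^sup>2 - sqd c x0 p) + flat 0 (sqd c x0 p - r\<^sup>2 / 4) > 0"
proof (cases "sqd c x0 p < r\<^sup>2")
  case True
  then have "flat 0 (r\<^sup>2 - sqd c x0 p) > 0" by (simp add: flat_pos_iff)
  then show ?thesis using flat_nonneg[of "sqd c x0 p - r\<^sup>2 / 4"] by linarith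
next
  case False
  have "r\<^sup>2 > 0" using assms by simp
  then have "sqd c x0 p - r\<^sup>2 / 4 > 0" using False by linarith
  then have "flat 0 (sqd c x0 p - r\<^sup>2 / 4) > 0" by (simp add: flat_pos_iff)
  then show ?thesis using flat_nonneg[of "r\<^sup>2 - sqd c x0 p"] by linarith
qed

lemma plateau_1:
  assumes "0 < r" "p \<in> fst c" "dist x0 (snd c p) \<le> r / 2"
  shows "plateau c x0 r p = 1"
proof -
  have "(dist x0 (snd c p))\<^sup>2 \<le> (r / 2)\<^sup>2" using assms by (intro power_mono) auto
  then have "sqd c x0 p - r\<^sup>2 / 4 \<le> 0" by (simp add: sqd_dist power_divide)
  then have "flat 0 (sqd c x0 p - r\<^sup>2 / 4) = 0"
    using flat_nonneg[of "sqd c x0 p - r\<^sup>2 / 4"] flat_pos_iff[of "sqd c x0 p - r\<^sup>2 / 4"] by linarith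
  then show ?thesis using plateau_denominator[OF assms(1), of c x0 p] assms(2) by (simp add: plateau_def)
qed

lemma plateau_0:
  assumes "0 < r" "dist x0 (snd c p) \<ge> r"
  shows "plateau c x0 r p = 0"
proof -
  have "(dist x0 (snd c p))\<^sup>2 \<ge> r\<^sup>2" using assms by (intro power_mono) auto
  then have "flat 0 (r\<^sup>2 - sqd c x0 p) = 0"
    using flat_nonneg[of "r\<^sup>2 - sqd c x0 p"] flat_pos_iff[of "r\<^sup>2 - sqd c x0 p"] by (simp add: sqd_dist)
  then show ?thesis by (simp add: plateau_def)
qed

context symp_surface
begin

lemma disc_dom:
  assumes "disc W c x0 r" "p \<in> chart_inv c ` cball x0 r"
  shows "p \<in> fst c" "p \<in> W" "snd c p \<in> cball x0 r"
proof -
  have c: "c \<in> A" using assms by (simp add: disc_def)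
  interpret c: chart c by (rule chart[OF c])
  show "p \<in> fst c" "p \<in> W" "snd c p \<in> cball x0 r"
    using assms by (auto simp: disc_def)
qed

lemma compact_disc: "disc W c x0 r \<Longrightarrow> compact (chart_inv c ` cball x0 r)"
proof -
  assume D: "disc W c x0 r"
  then have c: "c \<in> A" by (simp add: disc_def)
  interpret c: chart c by (rule chart[OF c])
  have "cball x0 r \<subseteq> snd c ` fst c" using D by (auto simp: disc_def)
  then have "continuous_on (cball x0 r) (chart_inv c)"
    using c.homeo by (auto simp: homeomorphism_def intro: continuous_on_subset)
  then show ?thesis by (intro compact_continuous_image) auto
qed

lemma plateau_support:
  assumes "disc W c x0 r" "p \<notin> chart_inv c ` cball x0 r"
  shows "plateau c x0 r p = 0"
proof (cases "p \<in> fst c")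
  case True
  have c: "c \<in> A" using assms by (simp add: disc_def)
  have "snd c p \<notin> cball x0 r" using assms(2) chart.chart_inv_snd[OF chart[OF c] True] by (metis imageI)
  then show ?thesis using assms(1) by (intro plateau_0) (auto simp: disc_def)
qed (simp add: plateau_def)

text \<open>Two open sets cover M: the chart domain, where the formula is smooth, and the complement
  of the disc, where the function is zero. The disc is closed because it is compact in a Hausdorff
  space.\<close>

lemma smooth_plateau:
  assumes D: "disc W c x0 r"
  shows "smooth_fun A M (plateau c x0 r)"
proof (rule smooth_funI)
  fix d assume d: "d \<in> A"
  interpret d: chart d by (rule chart[OF d])
  have c: "c \<in> A" and r: "0 < r" using D by (auto simp: disc_def)
  have oc: "open (fst c)" using chart.open_dom[OF chart[OF c]] .
  have s: "smc d (fst c) (sqd c x0)"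
    unfolding sqd_def[abs_def]
    by (intro d.smc_add d.smc_power d.smc_diff d.smc_const oc smc_coordinate[OF d c])
  have "smc d (fst c) (\<lambda>p. flat 0 (r\<^sup>2 - sqd c x0 p) * inverse (flat 0 (r\<^sup>2 - sqd c x0 p) + flat 0 (sqd c x0 p - r\<^sup>2 / 4)))"
    using plateau_denominator[OF r, of c x0]
    by (intro d.smc_mult d.smc_inverse d.smc_add d.smc_flat d.smc_diff d.smc_const oc s) (simp add: less_imp_neq[symmetric])
  then have 1: "smc d (fst c) (plateau c x0 r)"
    by (rule d.smc_cong[OF oc]) (simp add: plateau_def)
  have 2: "open (- chart_inv c ` cball x0 r)"
    using compact_imp_closed[OF compact_disc[OF D]] by (rule open_Compl)
  have 3: "smc d (- chart_inv c ` cball x0 r) (plateau c x0 r)"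
    by (rule d.smc_cong[OF 2 d.smc_const[of _ 0]]) (use plateau_support[OF D] in auto)
  show "smc d M (plateau c x0 r)"
  proof (rule d.smc_local[OF open_M])
    fix p assume "p \<in> fst d \<inter> M"
    have "p \<in> fst c \<or> p \<in> - chart_inv c ` cball x0 r" using disc_dom(1)[OF D] by blast
    then show "\<exists>T. open T \<and> p \<in> T \<and> smc d T (plateau c x0 r)" using 1 2 3 oc by blast
  qed
qed

lemma disc_at:
  assumes "open W" "W \<subseteq> M" "p \<in> W"
  obtains c r where "disc W c (snd c p) r" "p \<in> fst c"
proof -
  obtain c where c: "c \<in> A" "p \<in> fst c" using chart_at assms by blast
  interpret c: chart c by (rule chart[OF c(1)])
  have "snd c p \<in> snd c ` (fst c \<inter> W)" using c(2) assms(3) by blast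
  then obtain r where "0 < r" "cball (snd c p) r \<subseteq> snd c ` (fst c \<inter> W)"
    using open_contains_cball[THEN iffD1, OF c.open_chart_image[OF assms(1)]] by blast
  then have "disc W c (snd c p) r" using c(1) by (simp add: disc_def)
  then show ?thesis using c(2) by (rule that)
qed

definition subordinate_partition ::
    "'a set \<Rightarrow> 'a set \<Rightarrow> nat \<Rightarrow> (nat \<Rightarrow> 'a chart) \<Rightarrow> (nat \<Rightarrow> real^2) \<Rightarrow> (nat \<Rightarrow> real) \<Rightarrow> (nat \<Rightarrow> 'a \<Rightarrow> real) \<Rightarrow> bool" where
  "subordinate_partition W C n c x0 r \<psi> \<longleftrightarrow>
     (\<forall>k<n. disc W (c k) (x0 k) (r k) \<and> smooth_fun A M (\<psi> k) \<and>
        (\<forall>p. p \<notin> chart_inv (c k) ` cball (x0 k) (r k) \<longrightarrow> \<psi> k p = 0)) \<and>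
     (\<forall>p\<in>C. (\<Sum>k<n. \<psi> k p) = 1)"

lemma subordinate_partitionD:
  assumes "subordinate_partition W C n c x0 r \<psi>"
  shows "k < n \<Longrightarrow> disc W (c k) (x0 k) (r k)" "k < n \<Longrightarrow> smooth_fun A M (\<psi> k)"
    "k < n \<Longrightarrow> p \<notin> chart_inv (c k) ` cball (x0 k) (r k) \<Longrightarrow> \<psi> k p = 0"
    "p \<in> C \<Longrightarrow> (\<Sum>k<n. \<psi> k p) = 1"
  using assms unfolding subordinate_partition_def by blast+

text \<open>The products \<beta>_k (1 - \<beta>_0) ... (1 - \<beta>_(k-1)) telescope to 1 minus the
  product of all factors 1 - \<beta>_j. On C some \<beta>_j equals 1, so the sum is 1 there, with no
  normalizing division.\<close>

lemma partition_of_unity: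
  assumes W: "open W" "W \<subseteq> M" and C: "compact C" "C \<subseteq> W"
  obtains n c x0 r \<psi> where "subordinate_partition W C n c x0 r \<psi>"
proof -
  have "\<forall>p\<in>C. \<exists>cr. disc W (fst cr) (snd (fst cr) p) (snd cr) \<and> p \<in> fst (fst cr)"
    using disc_at[OF W] C(2) by (metis fst_conv snd_conv subsetD)
  then obtain cr where cr: "\<And>p. p \<in> C \<Longrightarrow> disc W (fst (cr p)) (snd (fst (cr p)) p) (snd (cr p)) \<and> p \<in> fst (fst (cr p))"
    by metis
  \<comment> \<open>Open discs of half the radius, on which the plateau functions equal 1; finitely
    many of them cover C.\<close>
  define B where "B p = {q \<in> fst (fst (cr p)). dist (snd (fst (cr p)) p) (snd (fst (cr p)) q) < snd (cr p) / 2}" for p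
  have oB: "open (B p)" if "p \<in> C" for p
  proof -
    have c: "fst (cr p) \<in> A" using cr[OF that] by (simp add: disc_def)
    interpret c: chart "fst (cr p)" by (rule chart[OF c])
    let ?U = "ball (snd (fst (cr p)) p) (snd (cr p) / 2)"
    have "continuous_on (fst (fst (cr p))) (snd (fst (cr p)))" using c.homeo by (simp add: homeomorphism_def)
    then have "open (snd (fst (cr p)) -` ?U \<inter> fst (fst (cr p)))"
      using c.open_dom by (simp add: continuous_on_open_vimage)
    moreover have "B p = snd (fst (cr p)) -` ?U \<inter> fst (fst (cr p))" by (auto simp: B_def)
    ultimately show ?thesis by simp
  qed
  have "C \<subseteq> (\<Union>p\<in>C. B p)" using cr by (fastforce simp: B_def disc_def)
  then obtain F where F: "F \<subseteq> C" "finite F" "C \<subseteq> (\<Union>p\<in>F. B p)"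
    using compactE_image[OF C(1), of C B] oB by metis
  obtain ps where ps: "set ps = F" using finite_list[OF F(2)] by auto
  let ?n = "length ps"
  define \<beta> where "\<beta> k = plateau (fst (cr (ps ! k))) (snd (fst (cr (ps ! k))) (ps ! k)) (snd (cr (ps ! k)))" for k
  define \<psi> where "\<psi> k p = \<beta> k p * (\<Prod>j<k. 1 - \<beta> j p)" for k p
  have inC: "ps ! k \<in> C" if "k < ?n" for k using that ps F(1) nth_mem by blast
  have sum: "(\<Sum>k<m. \<psi> k p) = 1 - (\<Prod>j<m. 1 - \<beta> j p)" for m p
    by (induction m) (simp_all add: \<psi>_def algebra_simps)
  have s\<beta>: "smooth_fun A M (\<beta> k)" if "k < ?n" for k
    unfolding \<beta>_def using smooth_plateau cr[OF inC[OF that]] by blast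
  have s\<psi>: "smooth_fun A M (\<psi> k)" if k: "k < ?n" for k
  proof (rule smooth_funI)
    fix d assume d: "d \<in> A"
    interpret d: chart d by (rule chart[OF d])
    have "smc d M (\<lambda>p. \<Prod>j<m. 1 - \<beta> j p)" if "m \<le> k" for m
      using that
    proof (induction m)
      case (Suc m)
      have IH: "smc d M (\<lambda>p. \<Prod>j<m. 1 - \<beta> j p)" using Suc by simp
      have "m < ?n" using Suc.prems k by simp
      then have sm: "smc d M (\<beta> m)" by (rule smooth_funD[OF s\<beta> d])
      have "smc d M (\<lambda>p. (\<Prod>j<m. 1 - \<beta> j p) * (1 - \<beta> m p))"
        by (intro d.smc_mult d.smc_diff d.smc_const open_M IH sm)
      then show ?case by simp
    qed (simp add: d.smc_const)
    from d.smc_mult[OF open_M smooth_funD[OF s\<beta>[OF k] d] this[OF order_refl]]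
    show "smc d M (\<psi> k)" unfolding \<psi>_def[abs_def] .
  qed
  have "subordinate_partition W C ?n (\<lambda>k. fst (cr (ps ! k))) (\<lambda>k. snd (fst (cr (ps ! k))) (ps ! k)) (\<lambda>k. snd (cr (ps ! k))) \<psi>"
    unfolding subordinate_partition_def
  proof (intro conjI allI impI ballI)
    fix k assume k: "k < ?n"
    show D: "disc W (fst (cr (ps ! k))) (snd (fst (cr (ps ! k))) (ps ! k)) (snd (cr (ps ! k)))"
      using cr[OF inC[OF k]] by blast
    show "smooth_fun A M (\<psi> k)" by (rule s\<psi>[OF k])
    show "\<psi> k p = 0" if "p \<notin> chart_inv (fst (cr (ps ! k))) ` cball (snd (fst (cr (ps ! k))) (ps ! k)) (snd (cr (ps ! k)))" for p
      unfolding \<psi>_def \<beta>_def using plateau_support[OF D that] by simp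
  next
    fix p assume "p \<in> C"
    then obtain q where q: "q \<in> F" "p \<in> B q" using F(3) by auto
    then obtain k where k: "k < ?n" "ps ! k = q" using ps by (metis in_set_conv_nth)
    have "0 < snd (cr q)" using cr[of q] q(1) F(1) by (auto simp: disc_def)
    then have "\<beta> k p = 1"
      unfolding \<beta>_def k(2) using q(2) by (intro plateau_1) (auto simp: B_def)
    then have "(\<Prod>j<?n. 1 - \<beta> j p) = 0" using k(1) by (intro prod_zero) auto
    then show "(\<Sum>k<?n. \<psi> k p) = 1" unfolding sum by simp
  qed
  then show ?thesis by (rule that)
qed

lemma smooth_continuous:
  assumes "open W" "c \<in> A" "smooth_fun A W f"
  shows "continuous_on (fst c \<inter> W) f"
proof -
  interpret chart c by (rule chart[OF assms(2)])
  show ?thesis by (rule smc_continuous[OF smooth_funD[OF assms(3,2)] assms(1)])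
qed

lemma smooth_fun_mult:
  assumes "open W" "smooth_fun A W f" "smooth_fun A W g"
  shows "smooth_fun A W (\<lambda>p. f p * g p)"
proof (rule smooth_funI)
  fix c assume c: "c \<in> A"
  show "smc c W (\<lambda>p. f p * g p)"
    by (rule chart.smc_mult[OF chart[OF c] assms(1) smooth_funD[OF assms(2) c] smooth_funD[OF assms(3) c]])
qed

lemma smooth_fun_add:
  assumes "open W" "smooth_fun A W f" "smooth_fun A W g"
  shows "smooth_fun A W (\<lambda>p. f p + g p)"
proof (rule smooth_funI)
  fix c assume c: "c \<in> A"
  show "smc c W (\<lambda>p. f p + g p)"
    by (rule chart.smc_add[OF chart[OF c] assms(1) smooth_funD[OF assms(2) c] smooth_funD[OF assms(3) c]])
qed

lemma smooth_fun_const: "smooth_fun A W (\<lambda>p. a)"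
  by (rule smooth_funI) (rule chart.smc_const[OF chart])

lemma smooth_integrable:
  assumes W: "open W" "W \<subseteq> M" and f: "smooth_fun A W f" and C: "compact C" "C \<subseteq> W"
    and supp: "\<And>p. p \<in> W - C \<Longrightarrow> f p = 0"
  shows "set_integrable vol W f"
proof -
  obtain n c x0 r \<psi> where "subordinate_partition W C n c x0 r \<psi>"
    by (rule partition_of_unity[OF W C])
  note pou = subordinate_partitionD[OF this]
  have "set_integrable vol W (\<lambda>p. \<psi> k p * f p)" if k: "k < n" for k
  proof (rule disc_integral(1)[OF W pou(1)[OF k]])
    show "continuous_on (fst (c k) \<inter> W) (\<lambda>p. \<psi> k p * f p)"
      using pou(1)[OF k]
      by (intro smooth_continuous smooth_fun_mult W f smooth_fun_Int[OF W pou(2)[OF k]]) (simp add: disc_def)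
  qed (simp add: pou(3)[OF k])
  then have "set_integrable vol W (\<lambda>p. \<Sum>k<n. \<psi> k p * f p)"
    unfolding set_integrable_def scaleR_sum_right by (intro Bochner_Integration.integrable_sum) auto
  moreover have "(\<lambda>p. indicator W p *\<^sub>R (\<Sum>k<n. \<psi> k p * f p)) = (\<lambda>p. indicator W p *\<^sub>R f p)"
  proof
    show "indicator W p *\<^sub>R (\<Sum>k<n. \<psi> k p * f p) = indicator W p *\<^sub>R f p" for p
      using pou(4)[of p] supp[of p] by (cases "p \<in> W"; cases "p \<in> C") (simp_all add: sum_distrib_right[symmetric])
  qed
  ultimately show ?thesis unfolding set_integrable_def by (simp only:)
qed

text \<open>The fundamental lemma of the calculus of variations. It makes the choice in
  \<open>Hadj\<close> determinate on W.\<close>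

lemma smooth_fun_eq_if_integrals_eq:
  assumes W: "open W" "W \<subseteq> M" and h: "smooth_fun A W h" "smooth_fun A W h'"
    and eq: "\<And>f. smooth_fun A W f \<Longrightarrow> compactly_supported_fun W f \<Longrightarrow>
      (LINT p:W|vol. f p * h p) = (LINT p:W|vol. f p * h' p)"
    and p: "p \<in> W"
  shows "h p = h' p"
proof (rule ccontr)
  assume ne: "h p \<noteq> h' p"
  obtain c r where D: "disc W c (snd c p) r" and pc: "p \<in> fst c" by (rule disc_at[OF W p])
  have c: "c \<in> A" and r: "0 < r" using D by (auto simp: disc_def)
  interpret c: chart c by (rule chart[OF c])
  let ?K = "chart_inv c ` cball (snd c p) r"
  let ?\<psi> = "plateau c (snd c p) r"
  let ?u = "\<lambda>q. h q - h' q"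
  have s\<psi>: "smooth_fun A W ?\<psi>" by (rule smooth_fun_Int[OF W smooth_plateau[OF D]])
  have su: "smooth_fun A W ?u"
  proof (rule smooth_funI)
    fix d assume d: "d \<in> A"
    show "smc d W ?u"
      by (rule chart.smc_diff[OF chart[OF d] W(1) smooth_funD[OF h(1) d] smooth_funD[OF h(2) d]])
  qed
  \<comment> \<open>Testing with the cut-off difference itself makes the integral that of \<psi> (h
    - h')^2, which is nonnegative.\<close>
  let ?f = "\<lambda>q. ?\<psi> q * ?u q"
  have sf: "smooth_fun A W ?f" by (rule smooth_fun_mult[OF W(1) s\<psi> su])
  have K: "compact ?K" "?K \<subseteq> W" using compact_disc[OF D] disc_dom[OF D] by auto
  have supp: "?\<psi> q = 0" if "q \<notin> ?K" for q by (rule plateau_support[OF D that])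
  have "compactly_supported_fun W ?f"
    unfolding compactly_supported_fun_def using K supp by (intro exI[of _ ?K]) auto
  note e = eq[OF sf this]
  have int: "set_integrable vol W (\<lambda>q. ?f q * g q)" if "smooth_fun A W g" for g
    by (rule smooth_integrable[OF W smooth_fun_mult[OF W(1) sf that] K]) (simp add: supp)
  have "(LINT q:W|vol. ?f q * ?u q) = 0"
    using set_integral_diff(2)[OF int[OF h(1)] int[OF h(2)]] e by (simp add: right_diff_distrib)
  then have 0: "(LINT q:W|vol. ?\<psi> q * (?u q)\<^sup>2) = 0" by (simp add: power2_eq_square mult.assoc)
  have s2: "smooth_fun A W (\<lambda>q. ?\<psi> q * (?u q)\<^sup>2)"
    using smooth_fun_mult[OF W(1) sf su] by (simp add: power2_eq_square mult.assoc)
  let ?F = "\<lambda>x. indicator (cball (snd c p) r) x * (dens c x * (?\<psi> (chart_inv c x) * (?u (chart_inv c x))\<^sup>2))"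
  have z: "(\<integral>x. ?F x \<partial>lborel) = 0"
    using disc_integral(2)[OF W D smooth_continuous[OF W(1) c s2]] supp 0 by simp
  have nonneg: "?F x \<ge> 0" for x
  proof -
    have "?\<psi> q \<ge> 0" for q
      using plateau_denominator[OF r, of c "snd c p" q] flat_nonneg by (simp add: plateau_def)
    then show ?thesis by (simp add: dens_def)
  qed
  have sub: "cball (snd c p) r \<subseteq> snd c ` (fst c \<inter> W)" using D by (simp add: disc_def)
  have Kin: "chart_inv c x \<in> fst c \<inter> W" if "x \<in> cball (snd c p) r" for x using sub that c.chart_inv_in by auto
  interpret s: symp_chart c W \<Omega> by (rule symp_chart[OF c W])
  have cont: "continuous_on (cball (snd c p) r) (\<lambda>x. dens c x * (?\<psi> (chart_inv c x) * (?u (chart_inv c x))\<^sup>2))"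
  proof -
    have "continuous_on (snd c ` (fst c \<inter> W)) (\<lambda>x. g (chart_inv c x))" if "smc c W g" for g
      using smooth_on_continuous[OF that[unfolded smc_def]] .
    note cc = continuous_on_subset[OF this sub]
    show ?thesis unfolding dens_def
      by (rule continuous_on_mult[OF continuous_on_rabs[OF cc[OF s.smc_Omega]] cc[OF smooth_funD[OF s2 c]]])
  qed
  have intF: "integrable lborel ?F"
    using borel_integrable_compact[OF compact_cball cont] by simp
  have "AE x in lborel. ?F x = 0"
    by (rule integral_nonneg_eq_0_iff_AE[OF intF, THEN iffD1, OF _ z]) (intro AE_I2 nonneg)
  then have ae: "AE x in lborel. x \<in> ball (snd c p) (r/2) \<longrightarrow> ?u (chart_inv c x) = 0"
  proof (rule AE_mp, intro AE_I2 impI)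
    fix x assume F0: "?F x = 0" and x: "x \<in> ball (snd c p) (r / 2)"
    then have xc: "x \<in> cball (snd c p) r" using r by auto
    have "x \<in> snd c ` fst c" using sub xc by auto
    then have "snd c (chart_inv c x) = x" by simp
    then have "?\<psi> (chart_inv c x) = 1" using Kin[OF xc] x r by (intro plateau_1) auto
    moreover have "dens c x \<noteq> 0" using s.Omega_nz[OF Kin[OF xc]] by (simp add: dens_def)
    ultimately show "?u (chart_inv c x) = 0" using F0 xc by simp
  qed
  \<comment> \<open>Open, nonempty if h and h' differ at p, and yet a null set.\<close>
  let ?N = "{x \<in> ball (snd c p) (r/2). ?u (chart_inv c x) \<noteq> 0}"
  have cu: "continuous_on (ball (snd c p) (r/2)) (\<lambda>x. ?u (chart_inv c x))"
    using smooth_on_continuous[OF smooth_funD[OF su c, unfolded smc_def]]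
    by (rule continuous_on_subset) (use sub r in auto)
  have "open ((\<lambda>x. ?u (chart_inv c x)) -` (- {0}) \<inter> ball (snd c p) (r/2))"
    by (rule continuous_on_open_vimage[THEN iffD1, rule_format, OF _ cu]) auto
  moreover have "?N = (\<lambda>x. ?u (chart_inv c x)) -` (- {0}) \<inter> ball (snd c p) (r/2)" by auto
  ultimately have oN: "open ?N" by simp
  have pN: "snd c p \<in> ?N" using ne pc r by simp
  have "AE x in lborel. x \<notin> ?N" using ae by (rule AE_mp) (auto intro!: AE_I2)
  then have "?N \<in> null_sets lborel"
    using oN by (subst AE_iff_null_sets) auto
  then have "negligible ?N"
    by (simp add: negligible_iff_null_sets null_sets_completionI)
  then show False using oN pN open_not_negligible by blast
qed

end

section \<open>The first variation of \<open>K\<close>\<close>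

context chart
begin

lemma dif_sum: "(\<And>k. k \<in> I \<Longrightarrow> dif c (f k) p) \<Longrightarrow> dif c (\<lambda>q. \<Sum>k\<in>I. f k q) p"
  by (induction I rule: infinite_finite_induct) (simp_all add: dif_const dif_add)

lemma pd_sum: "p \<in> fst c \<Longrightarrow> (\<And>k. k \<in> I \<Longrightarrow> dif c (f k) p) \<Longrightarrow>
    pd c i (\<lambda>q. \<Sum>k\<in>I. f k q) p = (\<Sum>k\<in>I. pd c i (f k) p)"
  by (induction I rule: infinite_finite_induct) (simp_all add: pd_const pd_add dif_sum)

end

text \<open>The linear operator that produces K from \<open>dric\<close>. The expansion in t is
  carried out for \<open>dric\<close>, where it is algebraic, and transferred by
  \<open>KK_sum\<close>.\<close>

definition (in symp_chart) KK :: "(2 \<Rightarrow> 'a \<Rightarrow> real) \<Rightarrow> 'a \<Rightarrow> real" where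
  "KK X p = - inverse (w p) * curl c (\<lambda>i q. inverse (w q) * X i q) p"

lemma (in symp_chart) KK_sum:
  assumes p: "p \<in> fst c \<inter> W" and X: "\<And>k i. k \<in> I \<Longrightarrow> smc c W (X k i)"
    and Y: "\<And>i q. q \<in> fst c \<inter> W \<Longrightarrow> Y i q = (\<Sum>k\<in>I. a k * X k i q)"
  shows "KK Y p = (\<Sum>k\<in>I. a k * KK (X k) p)"
proof -
  have d: "dif c (X k i) p" if "k \<in> I" for k i by (rule dif_smc[OF X[OF that] p])
  have di: "dif c (\<lambda>q. inverse (w q)) p" using p by (intro dif_smc smc_simps smc_w w_nz)
  have "pd c j (\<lambda>q. inverse (w q) * Y i q) p = pd c j (\<lambda>q. \<Sum>k\<in>I. a k * (inverse (w q) * X k i q)) p" for i j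
    by (rule cong_W[OF p]) (simp add: Y sum_distrib_left mult.left_commute)
  also have "pd c j (\<lambda>q. \<Sum>k\<in>I. a k * (inverse (w q) * X k i q)) p = (\<Sum>k\<in>I. a k * pd c j (\<lambda>q. inverse (w q) * X k i q) p)" for i j
    using p d di by (simp add: pd_sum dif_mult dif_const pd_mult pd_const)
  finally have *: "pd c j (\<lambda>q. inverse (w q) * Y i q) p = (\<Sum>k\<in>I. a k * pd c j (\<lambda>q. inverse (w q) * X k i q) p)" for i j .
  show ?thesis
    unfolding KK_def curl_def * by (simp add: sum_distrib_left sum_subtractf[symmetric] algebra_simps)
qed

lemma (in symp_chart) KK_zero:
  assumes "open U" "p \<in> fst c \<inter> U" "\<And>i q. q \<in> fst c \<inter> U \<Longrightarrow> X i q = 0"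
  shows "KK X p = 0"
proof -
  have "pd c j (\<lambda>q. inverse (w q) * X i q) p = pd c j (\<lambda>q. 0) p" for i j
    by (rule pd_cong[OF assms(1,2)]) (simp add: assms(3))
  then show ?thesis using assms(2) by (simp add: KK_def curl_def pd_const)
qed

text \<open>\<open>dric\<close> for a fixed connection with an arbitrary matrix of functions in
  place of the Ricci tensor, so that it can be applied to the variations S and T.\<close>

definition (in symp_conn) dcon :: "(2 \<Rightarrow> 2 \<Rightarrow> 'a \<Rightarrow> real) \<Rightarrow> 2 \<Rightarrow> 'a \<Rightarrow> real" where
  "dcon R i p = pd c 2 (R 1 i) p - pd c 1 (R 2 i) p
     - (\<Sum>m\<in>UNIV. G c p 2 i m * R 1 m p) + (\<Sum>m\<in>UNIV. G c p 1 i m * R 2 m p)"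

lemma (in symp_conn) smc_dcon: "(\<And>i j. smc c W (R i j)) \<Longrightarrow> smc c W (dcon R i)"
  unfolding dcon_def[abs_def] sum_2 by (intro smc_simps smc_G) blast+

context symp_variation
begin

abbreviation ric where "ric i j \<equiv> (\<lambda>p. ricci G c p [] [i, j])"

text \<open>The part of \<open>dric\<close> in which the varied Christoffel symbols act; each use
  raises the order in t by one.\<close>

definition dalg :: "(2 \<Rightarrow> 2 \<Rightarrow> 'a \<Rightarrow> real) \<Rightarrow> 2 \<Rightarrow> 'a \<Rightarrow> real" where
  "dalg R i p = (\<Sum>m\<in>UNIV. P 1 i m p * R 2 m p) - (\<Sum>m\<in>UNIV. P 2 i m p * R 1 m p)"

lemma smc_dalg: "(\<And>i j. smc c W (R i j)) \<Longrightarrow> smc c W (dalg R i)"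
  unfolding dalg_def[abs_def] sum_2 by (intro smc_simps smc_P) blast+

definition V1 where "V1 i p = dcon S i p + dalg ric i p"
definition V2 where "V2 i p = dcon T i p + dalg S i p"

lemma smc_V: "smc c W (V1 i)" "smc c W (V2 i)" "smc c W (dalg T i)"
  unfolding V1_def[abs_def] V2_def[abs_def]
  by (intro smc_simps smc_dcon smc_dalg smc_S smc_T smc_ricci)+

lemma dric_translate:
  assumes p: "p \<in> fst c \<inter> W"
  shows "dric (translate \<Omega> G t \<Phi>) (ricci (translate \<Omega> G t \<Phi>)) c i p =
    dric G (ricci G) c i p + t * V1 i p + t\<^sup>2 * V2 i p + t ^ 3 * dalg T i p"
proof -
  have "pd c k (\<lambda>q. ricci (translate \<Omega> G t \<Phi>) c q [] [i, j]) p =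
      pd c k (\<lambda>q. ricci G c q [] [i, j] + t * S i j q + t\<^sup>2 * T i j q) p" for k i j
    by (rule cong_W[OF p]) (rule ricci_translate)
  also have "pd c k (\<lambda>q. ricci G c q [] [i, j] + t * S i j q + t\<^sup>2 * T i j q) p =
      pd c k (ric i j) p + t * pd c k (S i j) p + t\<^sup>2 * pd c k (T i j) p" for k i j
    using p by (simp add: pd_add pd_mult pd_const dif_add dif_mult dif_const dif_smc smc_ricci smc_S smc_T)
  finally have *: "pd c k (\<lambda>q. ricci (translate \<Omega> G t \<Phi>) c q [] [i, j]) p =
      pd c k (ric i j) p + t * pd c k (S i j) p + t\<^sup>2 * pd c k (T i j) p" for k i j .
  show ?thesis
    unfolding dric_def * ricci_translate[OF p] translate_eq[OF p] V1_def V2_def dcon_def dalg_def sum_2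
    by (simp add: power2_eq_square power3_eq_cube algebra_simps)
qed

lemma K_translate:
  assumes p: "p \<in> fst c \<inter> W"
  shows "- 1 / 2 * (curl c (\<lambda>i q. rho \<Omega> (translate \<Omega> G t \<Phi>) c q [] [i]) p / \<Omega> c p [] [1, 2]) =
    KK (dric G (ricci G) c) p + t * KK V1 p + t\<^sup>2 * KK V2 p + t ^ 3 * KK (dalg T) p"
proof -
  interpret t: symp_conn c W \<Omega> "translate \<Omega> G t \<Phi>" by (rule conn_translate)
  let ?D = "dric (translate \<Omega> G t \<Phi>) (ricci (translate \<Omega> G t \<Phi>)) c"
  have "pd c k (\<lambda>q. rho \<Omega> (translate \<Omega> G t \<Phi>) c q [] [i]) p = pd c k (\<lambda>q. 2 * (inverse (w q) * ?D i q)) p" for k i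
    by (rule cong_W[OF p]) (simp add: t.rho_eq)
  also have "pd c k (\<lambda>q. 2 * (inverse (w q) * ?D i q)) p = 2 * pd c k (\<lambda>q. inverse (w q) * ?D i q) p" for k i
  proof -
    have "dif c (\<lambda>q. inverse (w q) * ?D i q) p"
      by (intro dif_smc[OF _ p] smc_simps smc_w w_nz t.smc_dric)
    then show ?thesis using p by (simp add: pd_mult[of p "\<lambda>_. 2"] dif_const pd_const)
  qed
  finally have "- 1 / 2 * (curl c (\<lambda>i q. rho \<Omega> (translate \<Omega> G t \<Phi>) c q [] [i]) p / \<Omega> c p [] [1, 2]) = KK ?D p"
    unfolding KK_def curl_def w_def[symmetric] by (cases "w p = 0") (simp_all add: field_simps)
  also have "KK ?D p = (\<Sum>k\<in>{0, 1, 2, 3::nat}. t ^ k * KK ((\<lambda>k. if k = 0 then dric G (ricci G) c else if k = 1 then V1 else if k = 2 then V2 else dalg T) k) p)"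
    by (rule KK_sum[OF p]) (auto simp: smc_dric smc_V dric_translate)
  finally show ?thesis by simp
qed

text \<open>The coefficients are differential expressions in \<Phi>, so their supports lie in the
  support of the variation.\<close>

lemma variation_zero:
  assumes U: "open U" and p: "p \<in> fst c \<inter> U" and 0: "\<And>q i j k. q \<in> fst c \<inter> U \<Longrightarrow> \<Phi> c q [] [i, j, k] = 0"
  shows "KK V1 p = 0" "KK V2 p = 0" "KK (dalg T) p = 0"
proof -
  have P0: "P i j k q = 0" if "q \<in> fst c \<inter> U" for i j k q using 0[OF that] by (simp add: P_def)
  have pd0: "pd c l f q = 0" if "\<And>r. r \<in> fst c \<inter> U \<Longrightarrow> f r = 0" "q \<in> fst c \<inter> U" for l f q
    using pd_cong[OF U that(2), of f "\<lambda>_. 0"] that by (simp add: pd_const)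
  have S0: "S i j q = 0" if "q \<in> fst c \<inter> U" for i j q
    unfolding S_def using P0[OF that] pd0[OF P0 that] by simp
  have T0: "T i j q = 0" if "q \<in> fst c \<inter> U" for i j q
    unfolding T_def using P0[OF that] by simp
  have dS: "dcon S i q = 0" "dcon T i q = 0" "dalg R i q = 0" if "q \<in> fst c \<inter> U" for i q R
    unfolding dcon_def dalg_def using S0[OF that] T0[OF that] P0[OF that] pd0[OF S0 that] pd0[OF T0 that] by simp_all
  show "KK V1 p = 0" "KK V2 p = 0" "KK (dalg T) p = 0"
    by (rule KK_zero[OF U p], simp add: V1_def V2_def dS)+
qed

text \<open>Integrating by parts three times moves all derivatives from the variation to \<open>f\<close>,
  where they assemble to \<open>\<H>(f)\<close>.\<close>

lemma variation_divergence:
  assumes f: "smc c W f" and H: "\<And>p i j k. p \<in> fst c \<inter> W \<Longrightarrow> lie_conn G (ham \<Omega> f) c p i j k = 0"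
  obtains U1 U2 where "smc c W U1" "smc c W U2"
    "\<And>p. p \<in> fst c \<inter> W \<Longrightarrow> f p * KK V1 p * w p = pd c 1 U1 p + pd c 2 U2 p"
    "\<And>U p. open U \<Longrightarrow> p \<in> fst c \<inter> U \<Longrightarrow> (\<And>q i j k. q \<in> fst c \<inter> U \<Longrightarrow> \<Phi> c q [] [i, j, k] = 0) \<Longrightarrow> U1 p = 0 \<and> U2 p = 0"
proof -
  define X where "X i = (\<lambda>p. ham \<Omega> f c p [i] [])" for i
  define Y where "Y j i = (\<lambda>p. cov G (ham \<Omega> f) c p [i] [j])" for j i
  have X_eq: "X 1 p = - inverse (w p) * pd c 2 f p" "X 2 p = inverse (w p) * pd c 1 f p" if "p \<in> fst c \<inter> W" for p
    unfolding X_def by (rule ham_eqs[OF that])+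
  have sX: "smc c W (X i)" for i unfolding X_def by (rule smc_ham[OF f])
  have Y_eq: "Y j i p = pd c j (X i) p + (\<Sum>m\<in>UNIV. G c p j m i * X m p)" for j i p
    unfolding Y_def X_def cov_1_0 ..
  have sY: "smc c W (Y j i)" for j i
    unfolding Y_eq[abs_def] sum_2 by (intro smc_simps smc_G sX)
  have dX: "pd c j (X i) p = Y j i p - (\<Sum>m\<in>UNIV. G c p j m i * X m p)" for j i p
    unfolding Y_eq by simp
  \<comment> \<open>Here \<H>(f) = 0 enters: second covariant derivatives of the Hamiltonian field X
    are replaced by curvature, so after all partial integrations only X, Y and the Ricci tensor are
    left.\<close>
  have dY: "pd c k (Y j i) p = (\<Sum>m\<in>UNIV. G c p k j m * Y m i p) - (\<Sum>m\<in>UNIV. G c p k m i * Y j m p)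
      - (\<Sum>q\<in>UNIV. X q p * riem G c p q k j i)" if "p \<in> fst c \<inter> W" for k j i p
    using H[OF that, of k j i] unfolding lie_conn_def cov_1_1 Y_def X_def by simp
  \<comment> \<open>Boundary terms: U1 and U2 record moving the curl of \<open>KK\<close> onto f,
    which creates X; R1 and R2 record moving the derivative of S onto X, which creates Y, and then
    the derivative of P inside S onto Y.\<close>
  define R1 where "R1 p = - (\<Sum>i\<in>UNIV. X i p * S 2 i p) + (\<Sum>i\<in>UNIV. Y 1 i p * P 2 i 1 p - Y 2 i p * P 1 i 1 p)" for p
  define R2 where "R2 p = (\<Sum>i\<in>UNIV. X i p * S 1 i p) + (\<Sum>i\<in>UNIV. Y 1 i p * P 2 i 2 p - Y 2 i p * P 1 i 2 p)" for p
  define U1 where "U1 p = R1 p - f p * (inverse (w p) * V1 2 p)" for p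
  define U2 where "U2 p = R2 p + f p * (inverse (w p) * V1 1 p)" for p
  have sR: "smc c W R1" "smc c W R2"
    unfolding R1_def[abs_def] R2_def[abs_def] sum_2 by (intro smc_simps sX sY smc_S smc_P)+
  have sl: "smc c W (\<lambda>q. inverse (w q) * V1 i q)" for i by (intro smc_simps smc_w w_nz smc_V)
  have "smc c W (\<lambda>p. R1 p - f p * (inverse (w p) * V1 2 p))" by (rule smc_diff[OF open_W sR(1) smc_mult[OF open_W f sl]])
  moreover have "smc c W (\<lambda>p. R2 p + f p * (inverse (w p) * V1 1 p))" by (rule smc_add[OF open_W sR(2) smc_mult[OF open_W f sl]])
  ultimately have sU: "smc c W U1" "smc c W U2" unfolding U1_def[abs_def] U2_def[abs_def] by simp_all
  have main: "pd c 1 R1 p + pd c 2 R2 p = X 1 p * V1 1 p + X 2 p * V1 2 p" if p: "p \<in> fst c \<inter> W" for p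
  proof -
    have d: "dif c (X i) p" "dif c (Y i j) p" "dif c (S i j) p" "dif c (P i j k) p" for i j k
      by (intro dif_smc[OF _ p] sX sY smc_S smc_P)+
    have e1: "pd c 1 R1 p = - (\<Sum>i\<in>UNIV. X i p * pd c 1 (S 2 i) p + pd c 1 (X i) p * S 2 i p)
      + (\<Sum>i\<in>UNIV. Y 1 i p * pd c 1 (P 2 i 1) p + pd c 1 (Y 1 i) p * P 2 i 1 p
         - (Y 2 i p * pd c 1 (P 1 i 1) p + pd c 1 (Y 2 i) p * P 1 i 1 p))"
      unfolding R1_def[abs_def] sum_2 using p by (simp add: pd_rules dif_rules d)
    have e2: "pd c 2 R2 p = (\<Sum>i\<in>UNIV. X i p * pd c 2 (S 1 i) p + pd c 2 (X i) p * S 1 i p)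
      + (\<Sum>i\<in>UNIV. Y 1 i p * pd c 2 (P 2 i 2) p + pd c 2 (Y 1 i) p * P 2 i 2 p
         - (Y 2 i p * pd c 2 (P 1 i 2) p + pd c 2 (Y 2 i) p * P 1 i 2 p))"
      unfolding R2_def[abs_def] sum_2 using p by (simp add: pd_rules dif_rules d)
    have S_eqs: "S i j p = (\<Sum>k\<in>UNIV. pd c k (P i j k) p
     + (\<Sum>m\<in>UNIV. G c p k m k * P i j m p - G c p k i m * P m j k p - G c p k j m * P i m k p))" for i j
      by (rule S_def)
    have V: "V1 i p = pd c 2 (S 1 i) p - pd c 1 (S 2 i) p - (\<Sum>m\<in>UNIV. G c p 2 i m * S 1 m p)
      + (\<Sum>m\<in>UNIV. G c p 1 i m * S 2 m p) + (\<Sum>m\<in>UNIV. P 1 i m p * ricci G c p [] [2, m])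
      - (\<Sum>m\<in>UNIV. P 2 i m p * ricci G c p [] [1, m])" for i
      by (simp add: V1_def dcon_def dalg_def)
    have "pd c 1 R1 p + pd c 2 R2 p - (X 1 p * V1 1 p + X 2 p * V1 2 p) =
      (\<Sum>i\<in>UNIV. Y 2 i p * S 1 i p - Y 1 i p * S 2 i p)
      + (\<Sum>i\<in>UNIV. Y 1 i p * pd c 1 (P 2 i 1) p + pd c 1 (Y 1 i) p * P 2 i 1 p
         - (Y 2 i p * pd c 1 (P 1 i 1) p + pd c 1 (Y 2 i) p * P 1 i 1 p))
      + (\<Sum>i\<in>UNIV. Y 1 i p * pd c 2 (P 2 i 2) p + pd c 2 (Y 1 i) p * P 2 i 2 p
         - (Y 2 i p * pd c 2 (P 1 i 2) p + pd c 2 (Y 2 i) p * P 1 i 2 p))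
      - (\<Sum>i\<in>UNIV. X i p * ((\<Sum>m\<in>UNIV. P 1 i m p * ricci G c p [] [2, m])
      - (\<Sum>m\<in>UNIV. P 2 i m p * ricci G c p [] [1, m])))"
      unfolding e1 e2 V dX sum_2 G_sym_21[OF p] by (simp add: algebra_simps)
    also have "\<dots> = 0"
      unfolding dY[OF p] S_eqs sum_2
      by (simp add: P_rules[OF p] pd_P_rules[OF p] G_sym_21[OF p] riem_ricci[OF p])
         (simp add: algebra_simps)
    finally show ?thesis by simp
  qed
  show ?thesis
  proof (rule that[OF sU])
    fix p assume p: "p \<in> fst c \<inter> W"
    have "pd c 1 U1 p = pd c 1 R1 p - (f p * pd c 1 (\<lambda>q. inverse (w q) * V1 2 q) p + pd c 1 f p * (inverse (w p) * V1 2 p))"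
      "pd c 2 U2 p = pd c 2 R2 p + (f p * pd c 2 (\<lambda>q. inverse (w q) * V1 1 q) p + pd c 2 f p * (inverse (w p) * V1 1 p))"
      unfolding U1_def[abs_def] U2_def[abs_def]
      using p dif_smc[OF sR(1) p] dif_smc[OF sR(2) p] dif_smc[OF f p] dif_smc[OF sl p]
      by (simp_all add: pd_diff pd_add pd_mult[of p f] dif_mult[of f])
    moreover have "X 1 p * V1 1 p = - (pd c 2 f p * (inverse (w p) * V1 1 p))"
      "X 2 p * V1 2 p = pd c 1 f p * (inverse (w p) * V1 2 p)"
      unfolding X_eq[OF p] by simp_all
    moreover have "f p * KK V1 p * w p = - (f p * pd c 1 (\<lambda>q. inverse (w q) * V1 2 q) p) + f p * pd c 2 (\<lambda>q. inverse (w q) * V1 1 q) p"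
    proof -
      have "f p * (- inverse (w p) * (a - b)) * w p = - (f p * a) + f p * b" for a b
        using w_nz[OF p] by (simp add: field_simps)
      then show ?thesis unfolding KK_def curl_def .
    qed
    ultimately show "f p * KK V1 p * w p = pd c 1 U1 p + pd c 2 U2 p"
      using main[OF p] by linarith
  next
    fix U p assume U: "open U" and p: "p \<in> fst c \<inter> U" and 0: "\<And>q i j k. q \<in> fst c \<inter> U \<Longrightarrow> \<Phi> c q [] [i, j, k] = 0"
    have P0: "P i j k q = 0" if "q \<in> fst c \<inter> U" for i j k q using 0[OF that] by (simp add: P_def)
    have pd0: "pd c l g q = 0" if "\<And>r. r \<in> fst c \<inter> U \<Longrightarrow> g r = 0" "q \<in> fst c \<inter> U" for l g q
      using pd_cong[OF U that(2), of g "\<lambda>_. 0"] that by (simp add: pd_const)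
    have S0: "S i j q = 0" if "q \<in> fst c \<inter> U" for i j q
      unfolding S_def using P0[OF that] pd0[OF P0 that] by simp
    have "V1 i p = 0" for i
      unfolding V1_def dcon_def dalg_def using S0[OF p] P0[OF p] pd0[OF S0 p] by simp
    then show "U1 p = 0 \<and> U2 p = 0"
      by (simp add: U1_def U2_def R1_def R2_def S0[OF p] P0[OF p])
  qed
qed

end

text \<open>The first-order coefficient is linear in the variation, so a variation may be split by a
  partition of unity before its integral is computed.\<close>

lemma (in symp_variation) V1_sum:
  assumes V: "\<And>m. m \<in> I \<Longrightarrow> symp_variation c W \<Omega> G (\<Psi> m)"
    and sum: "\<And>q i j k. q \<in> fst c \<inter> W \<Longrightarrow> \<Phi> c q [] [i, j, k] = (\<Sum>m\<in>I. \<Psi> m c q [] [i, j, k])"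
    and p: "p \<in> fst c \<inter> W"
  shows "V1 i p = (\<Sum>m\<in>I. symp_variation.V1 c \<Omega> G (\<Psi> m) i p)"
proof -
  let ?P = "\<lambda>m. symp_variation.P c \<Omega> (\<Psi> m)" and ?S = "\<lambda>m. symp_variation.S c \<Omega> G (\<Psi> m)"
  have P: "P i j k q = (\<Sum>m\<in>I. ?P m i j k q)" if "q \<in> fst c \<inter> W" for i j k q
    unfolding P_def sum[OF that] sum_distrib_left by (simp add: symp_variation.P_def[OF V])
  have "pd c l (P i j k) q = pd c l (\<lambda>q. \<Sum>m\<in>I. ?P m i j k q) q" if "q \<in> fst c \<inter> W" for l i j k q
    by (rule cong_W[OF that]) (rule P)
  then have pdP: "pd c l (P i j k) q = (\<Sum>m\<in>I. pd c l (?P m i j k) q)" if "q \<in> fst c \<inter> W" for l i j k q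
    using that by (simp add: pd_sum dif_smc[OF symp_variation.smc_P[OF V] that])
  have S: "S i j q = (\<Sum>m\<in>I. ?S m i j q)" if q: "q \<in> fst c \<inter> W" for i j q
    unfolding S_def P[OF q] pdP[OF q] sum_2
    by (simp add: symp_variation.S_def[OF V] sum_2 sum.distrib sum_subtractf sum_distrib_left)
  have "pd c l (S i j) p = pd c l (\<lambda>q. \<Sum>m\<in>I. ?S m i j q) p" for l i j
    by (rule cong_W[OF p]) (rule S)
  then have pdS: "pd c l (S i j) p = (\<Sum>m\<in>I. pd c l (?S m i j) p)" for l i j
    using p by (simp add: pd_sum dif_smc[OF symp_variation.smc_S[OF V] p])
  show ?thesis
    unfolding V1_def dcon_def dalg_def P[OF p] S[OF p] pdS sum_2
    by (simp add: symp_variation.V1_def[OF V] dcon_def symp_variation.dalg_def[OF V] sum_2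
        sum.distrib sum_subtractf sum_distrib_left sum_distrib_right)
qed

lemma translate_0: "translate \<Omega> G 0 \<Phi> = G"
  by (intro ext) (simp add: translate_def)

section \<open>The first variation on the surface and a criterion for criticality\<close>

context symp_surface
begin

lemma symp_variation:
  assumes W: "open W" "W \<subseteq> M" and G: "symplectic_connection A \<Omega> W G" and \<Phi>: "sym3_field A W \<Phi>" and c: "c \<in> A"
  shows "symp_variation c W \<Omega> G \<Phi>"
proof -
  have "smc c W (\<lambda>p. \<Phi> c p [] [i, j, k])" for i j k
    using \<Phi> c unfolding sym3_field_iff tensor_field_3 by blast
  moreover have "symp_conn c W \<Omega> (translate \<Omega> G t \<Phi>)" for t
    by (rule symp_conn[OF c W symplectic_connection_translate[OF W G \<Phi>]])
  moreover have "\<Phi> c p [] [i, j, k] = \<Phi> c p [] [j, i, k]" "\<Phi> c p [] [i, j, k] = \<Phi> c p [] [i, k, j]"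
    if "p \<in> fst c \<inter> W" for p i j k
    using \<Phi> c that unfolding sym3_field_iff by blast+
  ultimately show ?thesis
    by (intro symp_variation.intro symp_variation_axioms.intro symp_conn[OF c W G])
qed

text \<open>Since \<open>K(\<nabla> + t\<Phi>)\<close> is a cubic polynomial in \<open>t\<close>, its coefficients are finite differences
  and inherit smoothness from \<open>K\<close>.\<close>

definition dK :: "'a connection \<Rightarrow> 'a tensor \<Rightarrow> nat \<Rightarrow> 'a \<Rightarrow> real" where
  "dK G \<Phi> n p = (let k = (\<lambda>t. Kfun A \<Omega> (translate \<Omega> G t \<Phi>) p) in
     if n = 1 then - 1 / 2 * k 0 + k 1 + (- 1 / 3) * k (- 1) + (- 1 / 6) * k 2
     else if n = 2 then 1 / 2 * k 1 + 1 / 2 * k (- 1) + (- 1) * k 0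
     else 1 / 2 * k 0 + (- 1 / 2) * k 1 + (- 1 / 6) * k (- 1) + 1 / 6 * k 2)"

lemma Kfun_variation:
  assumes W: "open W" "W \<subseteq> M" and G: "symplectic_connection A \<Omega> W G" and \<Phi>: "sym3_field A W \<Phi>"
    and c: "c \<in> A" "p \<in> fst c \<inter> W"
  shows "Kfun A \<Omega> (translate \<Omega> G t \<Phi>) p = Kfun A \<Omega> G p + t * dK G \<Phi> 1 p + t\<^sup>2 * dK G \<Phi> 2 p + t ^ 3 * dK G \<Phi> 3 p"
    "dK G \<Phi> 1 p = symp_chart.KK c \<Omega> (symp_variation.V1 c \<Omega> G \<Phi>) p"
    "dK G \<Phi> 2 p = symp_chart.KK c \<Omega> (symp_variation.V2 c \<Omega> G \<Phi>) p"
    "dK G \<Phi> 3 p = symp_chart.KK c \<Omega> (symp_variation.dalg c \<Omega> \<Phi> (symp_variation.T c \<Omega> \<Phi>)) p"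
proof -
  interpret c: symp_variation c W \<Omega> G \<Phi> by (rule symp_variation[OF W G \<Phi> c(1)])
  define k0 where "k0 = c.KK (dric G (ricci G) c) p"
  define k1 where "k1 = c.KK c.V1 p"
  define k2 where "k2 = c.KK c.V2 p"
  define k3 where "k3 = c.KK (c.dalg c.T) p"
  have K: "Kfun A \<Omega> (translate \<Omega> G t \<Phi>) p = k0 + t * k1 + t\<^sup>2 * k2 + t ^ 3 * k3" for t
    unfolding Kfun_eq[OF W symplectic_connection_translate[OF W G \<Phi>] c] k0_def k1_def k2_def k3_def
    by (rule c.K_translate[OF c(2)])
  \<comment> \<open>A cubic is determined by its values at -1, 0, 1 and 2; the weights in
    \<open>dK\<close> invert this interpolation.\<close>
  have "dK G \<Phi> 1 p = k1" "dK G \<Phi> 2 p = k2" "dK G \<Phi> 3 p = k3"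
    unfolding dK_def Let_def K by (simp_all add: field_simps)
  moreover have "Kfun A \<Omega> G p = k0" using K[of 0] by (simp add: translate_0)
  ultimately show "Kfun A \<Omega> (translate \<Omega> G t \<Phi>) p = Kfun A \<Omega> G p + t * dK G \<Phi> 1 p + t\<^sup>2 * dK G \<Phi> 2 p + t ^ 3 * dK G \<Phi> 3 p"
    "dK G \<Phi> 1 p = c.KK c.V1 p" "dK G \<Phi> 2 p = c.KK c.V2 p" "dK G \<Phi> 3 p = c.KK (c.dalg c.T) p"
    using K unfolding k1_def k2_def k3_def by simp_all
qed

lemma smooth_fun_if: "smooth_fun A W f \<Longrightarrow> smooth_fun A W g \<Longrightarrow> smooth_fun A W (\<lambda>p. if b then f p else g p)"
  by (cases b) simp_all

lemma smooth_dK: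
  assumes W: "open W" "W \<subseteq> M" and G: "symplectic_connection A \<Omega> W G" and \<Phi>: "sym3_field A W \<Phi>"
  shows "smooth_fun A W (dK G \<Phi> n)"
proof -
  note s = smooth_fun_if smooth_Kfun[OF W symplectic_connection_translate[OF W G \<Phi>]] smooth_fun_add[OF W(1)] smooth_fun_mult[OF W(1)] smooth_fun_const
  show ?thesis
    unfolding dK_def[abs_def] Let_def by (intro s)
qed

lemma dK_zero:
  assumes W: "open W" "W \<subseteq> M" and G: "symplectic_connection A \<Omega> W G" and \<Phi>: "sym3_field A W \<Phi>"
    and U: "open U" "U \<subseteq> W" and 0: "\<And>d q i j k. d \<in> A \<Longrightarrow> q \<in> fst d \<inter> U \<Longrightarrow> \<Phi> d q [] [i, j, k] = 0"
    and p: "p \<in> U"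
  shows "dK G \<Phi> 1 p = 0" "dK G \<Phi> 2 p = 0" "dK G \<Phi> 3 p = 0"
proof -
  obtain c where c: "c \<in> A" "p \<in> fst c" using chart_at p U W by blast
  interpret c: symp_variation c W \<Omega> G \<Phi> by (rule symp_variation[OF W G \<Phi> c(1)])
  have pW: "p \<in> fst c \<inter> W" and pU: "p \<in> fst c \<inter> U" using c p U by blast+
  show "dK G \<Phi> 1 p = 0" "dK G \<Phi> 2 p = 0" "dK G \<Phi> 3 p = 0"
    unfolding Kfun_variation(2-4)[OF W G \<Phi> c(1) pW]
    using c.variation_zero[OF U(1) pU 0[OF c(1)]] by blast+
qed

text \<open>The potentials U1 and U2 from \<open>variation_divergence\<close> inherit the support of
  \<Phi>, so the divergence theorem on the disc applies.\<close>

lemma integral_dK_disc: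
  assumes W: "open W" "W \<subseteq> M" and G: "symplectic_connection A \<Omega> W G" and \<Phi>: "sym3_field A W \<Phi>"
    and D: "disc W c x0 r"
    and supp: "\<And>d q i j k. d \<in> A \<Longrightarrow> q \<in> fst d \<inter> (W - chart_inv c ` cball x0 r) \<Longrightarrow> \<Phi> d q [] [i, j, k] = 0"
    and f: "smooth_fun A W f"
    and H: "\<And>c p i j k. c \<in> A \<Longrightarrow> p \<in> fst c \<inter> W \<Longrightarrow> lie_conn G (ham \<Omega> f) c p i j k = 0"
  shows "(LINT p:W|vol. f p * dK G \<Phi> 1 p) = 0"
    "set_integrable vol W (\<lambda>p. f p * dK G \<Phi> 1 p)"
proof -
  let ?K = "chart_inv c ` cball x0 r"
  have c: "c \<in> A" using D by (simp add: disc_def)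
  interpret c: symp_variation c W \<Omega> G \<Phi> by (rule symp_variation[OF W G \<Phi> c(1)])
  have U: "open (W - ?K)" using W(1) compact_imp_closed[OF compact_disc[OF D]] by (rule open_Diff)
  have fd: "smooth_fun A W (\<lambda>p. f p * dK G \<Phi> 1 p)" by (rule smooth_fun_mult[OF W(1) f smooth_dK[OF W G \<Phi>]])
  have z: "f p * dK G \<Phi> 1 p = 0" if "p \<in> W - ?K" for p
    using dK_zero(1)[OF W G \<Phi> U Diff_subset supp that] by simp
  have KW: "?K \<subseteq> W" using disc_dom(2)[OF D] by blast
  show "set_integrable vol W (\<lambda>p. f p * dK G \<Phi> 1 p)"
    by (rule smooth_integrable[OF W fd compact_disc[OF D] KW z])
  obtain U1 U2 where s: "smc c W U1" "smc c W U2"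
    and div: "\<And>p. p \<in> fst c \<inter> W \<Longrightarrow> f p * c.KK c.V1 p * c.w p = pd c 1 U1 p + pd c 2 U2 p"
    and 0: "\<And>U p. open U \<Longrightarrow> p \<in> fst c \<inter> U \<Longrightarrow> (\<And>q i j k. q \<in> fst c \<inter> U \<Longrightarrow> \<Phi> c q [] [i, j, k] = 0) \<Longrightarrow> U1 p = 0 \<and> U2 p = 0"
    using c.variation_divergence[OF smooth_funD[OF f c] H[OF c]] by blast
  show "(LINT p:W|vol. f p * dK G \<Phi> 1 p) = 0"
  proof (rule disc_divergence[OF W D smooth_continuous[OF W(1) c fd] _ s])
    show "f p * dK G \<Phi> 1 p = 0" if "p \<in> W" "p \<notin> ?K" for p using z that by blast
    show "U1 p = 0 \<and> U2 p = 0" if "p \<in> fst c \<inter> W" "p \<notin> ?K" for p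
      using that by (intro 0[OF U _ supp[OF c]]) auto
    show "f p * dK G \<Phi> 1 p * \<Omega> c p [] [1, 2] = pd c 1 U1 p + pd c 2 U2 p" if "p \<in> fst c \<inter> W" for p
      using div[OF that] unfolding Kfun_variation(2)[OF W G \<Phi> c that] c.w_def .
  qed
qed

lemma sym3_field_mult:
  assumes W: "open W" and \<psi>: "smooth_fun A W \<psi>" and \<Phi>: "sym3_field A W \<Phi>"
  shows "sym3_field A W (\<lambda>c p us ls. \<psi> p * \<Phi> c p us ls)"
proof -
  have "smc c W (\<lambda>p. \<psi> p * \<Phi> c p [] [i, j, k])" if "c \<in> A" for c i j k
    using \<Phi> that unfolding sym3_field_iff tensor_field_3
    by (intro chart.smc_mult[OF chart[OF that] W smooth_funD[OF \<psi> that]]) blast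
  moreover have "\<psi> p * \<Phi> c p [] [i, j, k] = (\<Sum>a\<in>UNIV. \<Sum>b\<in>UNIV. \<Sum>e\<in>UNIV.
         jac c d p a i * jac c d p b j * jac c d p e k * (\<psi> p * \<Phi> d p [] [a, b, e]))"
    if "c \<in> A" "d \<in> A" "p \<in> fst c \<inter> fst d \<inter> W" for c d p i j k
  proof -
    have "\<Phi> c p [] [i, j, k] = (\<Sum>a\<in>UNIV. \<Sum>b\<in>UNIV. \<Sum>e\<in>UNIV.
         jac c d p a i * jac c d p b j * jac c d p e k * \<Phi> d p [] [a, b, e])"
      using \<Phi> that unfolding sym3_field_iff tensor_field_3 by blast
    then show ?thesis by (simp add: sum_distrib_left mult.left_commute)
  qed
  moreover have "\<Phi> c p [] [i, j, k] = \<Phi> c p [] [j, i, k]" "\<Phi> c p [] [i, j, k] = \<Phi> c p [] [i, k, j]"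
    if "c \<in> A" "p \<in> fst c \<inter> W" for c p i j k
    using \<Phi> that unfolding sym3_field_iff by blast+
  ultimately show ?thesis unfolding sym3_field_iff tensor_field_3 by simp
qed

text \<open>The partition of unity multiplies the variation and not f: a cut-off f would no longer
  satisfy \<H>(f) = 0.\<close>

lemma integral_dK:
  assumes W: "open W" "W \<subseteq> M" and G: "symplectic_connection A \<Omega> W G" and \<Phi>: "sym3_field A W \<Phi>"
    and C: "compact C" "C \<subseteq> W"
    and supp: "\<And>d q i j k. d \<in> A \<Longrightarrow> q \<in> fst d \<inter> (W - C) \<Longrightarrow> \<Phi> d q [] [i, j, k] = 0"
    and f: "smooth_fun A W f"
    and H: "\<And>c p i j k. c \<in> A \<Longrightarrow> p \<in> fst c \<inter> W \<Longrightarrow> lie_conn G (ham \<Omega> f) c p i j k = 0"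
  shows "(LINT p:W|vol. f p * dK G \<Phi> 1 p) = 0"
proof -
  obtain n c x0 r \<psi> where "subordinate_partition W C n c x0 r \<psi>"
    by (rule partition_of_unity[OF W C])
  note pou = subordinate_partitionD[OF this]
  define \<Psi> :: "nat \<Rightarrow> 'a tensor" where "\<Psi> k = (\<lambda>c p us ls. \<psi> k p * \<Phi> c p us ls)" for k
  have \<Psi>: "sym3_field A W (\<Psi> k)" if "k < n" for k
    unfolding \<Psi>_def by (rule sym3_field_mult[OF W(1) smooth_fun_Int[OF W pou(2)[OF that]] \<Phi>])
  have I: "(LINT p:W|vol. f p * dK G (\<Psi> k) 1 p) = 0" "set_integrable vol W (\<lambda>p. f p * dK G (\<Psi> k) 1 p)" if k: "k < n" for k
    by (rule integral_dK_disc[OF W G \<Psi>[OF k] pou(1)[OF k] _ f H]; simp add: \<Psi>_def pou(3)[OF k])+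
  have sum: "dK G \<Phi> 1 p = (\<Sum>k<n. dK G (\<Psi> k) 1 p)" if p: "p \<in> W" for p
  proof -
    obtain c where c: "c \<in> A" "p \<in> fst c" using chart_at p W by blast
    have pW: "p \<in> fst c \<inter> W" using c p by blast
    interpret c: symp_variation c W \<Omega> G \<Phi> by (rule symp_variation[OF W G \<Phi> c(1)])
    note V = symp_variation[OF W G \<Psi> c(1)]
    have "\<Phi> c q [] [i, j, k] = (\<Sum>m<n. \<Psi> m c q [] [i, j, k])" if "q \<in> fst c \<inter> W" for q i j k
      using supp[OF c(1), of q i j k] that pou(4)[of q] unfolding \<Psi>_def
      by (cases "q \<in> C") (auto simp: sum_distrib_right[symmetric])
    then have V1: "c.V1 i q = (\<Sum>m<n. 1 * symp_variation.V1 c \<Omega> G (\<Psi> m) i q)" if "q \<in> fst c \<inter> W" for i q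
      using c.V1_sum[of "{..<n}" \<Psi>, OF V _ that] by simp
    have "c.KK c.V1 p = (\<Sum>m<n. 1 * c.KK (symp_variation.V1 c \<Omega> G (\<Psi> m)) p)"
      by (rule c.KK_sum[OF pW _ V1]) (auto intro: symp_variation.smc_V(1)[OF V])
    then show ?thesis using Kfun_variation(2)[OF W G _ c(1) pW] \<Phi> \<Psi> by simp
  qed
  have eq: "indicator W p *\<^sub>R (f p * dK G \<Phi> 1 p) = (\<Sum>k<n. indicator W p *\<^sub>R (f p * dK G (\<Psi> k) 1 p))" for p
    using sum[of p] by (cases "p \<in> W") (simp_all add: sum_distrib_left)
  have "(LINT p:W|vol. f p * dK G \<Phi> 1 p) = (\<Sum>k<n. LINT p:W|vol. f p * dK G (\<Psi> k) 1 p)"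
    using I(2) unfolding set_lebesgue_integral_def set_integrable_def eq
    by (subst Bochner_Integration.integral_sum) auto
  then show ?thesis using I(1) by simp
qed

text \<open>The difference of squares is a polynomial in t with compactly supported smooth
  coefficients, so its integral is a polynomial and no differentiation under the integral occurs.
  Its linear coefficient is the integral of 2 a f times the first variation, which is zero.\<close>

lemma critical_if_Hop_eq_0:
  assumes W: "open W" "W \<subseteq> M" and G: "symplectic_connection A \<Omega> W G"
    and f: "smooth_fun A W f" and K: "\<And>p. p \<in> W \<Longrightarrow> Kfun A \<Omega> G p = a * f p"
    and H: "\<And>c p i j k. c \<in> A \<Longrightarrow> p \<in> fst c \<inter> W \<Longrightarrow> lie_conn G (ham \<Omega> f) c p i j k = 0"
  shows "critical A \<Omega> W G"
  unfolding critical_def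
proof (intro allI impI, elim conjE)
  fix \<Phi> assume \<Phi>: "sym3_field A W \<Phi>" and "compactly_supported_tensor A W 0 3 \<Phi>"
  then obtain C where C: "compact C" "C \<subseteq> W" and C0: "\<forall>c\<in>A. \<forall>p\<in>fst c \<inter> W - C. \<forall>us\<in>idx 0. \<forall>ls\<in>idx 3. \<Phi> c p us ls = 0"
    unfolding compactly_supported_tensor_def by blast
  have supp: "\<Phi> c p [] [i, j, k] = 0" if "c \<in> A" "p \<in> fst c \<inter> (W - C)" for c p i j k
    using C0 that by (auto simp: idx_def)
  let ?L = "dK G \<Phi> 1" and ?M = "dK G \<Phi> 2" and ?N = "dK G \<Phi> 3"
  \<comment> \<open>\<open>co k\<close> is the coefficient of t^(k+1): the constant term has been
    subtracted.\<close>
  define co where "co k p = (if k = 0 then 2 * a * (f p * ?L p) else if k = 1 then 2 * a * (f p * ?M p) + ?L p * ?L p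
    else if k = 2 then 2 * a * (f p * ?N p) + 2 * (?L p * ?M p) else if k = 3 then 2 * (?L p * ?N p) + ?M p * ?M p
    else if k = 4 then 2 * (?M p * ?N p) else ?N p * ?N p)" for k :: nat and p
  have co: "set_integrable vol W (co k)" for k
  proof (rule smooth_integrable[OF W _ C])
    note s = smooth_fun_if f smooth_dK[OF W G \<Phi>] smooth_fun_add[OF W(1)] smooth_fun_mult[OF W(1)] smooth_fun_const
    show "smooth_fun A W (co k)"
      unfolding co_def[abs_def]
      by (intro s)
    have U: "open (W - C)" using W(1) compact_imp_closed[OF C(1)] by (rule open_Diff)
    show "co k p = 0" if "p \<in> W - C" for p
      using dK_zero[OF W G \<Phi> U Diff_subset supp that] unfolding co_def by simp
  qed
  let ?I = "\<lambda>k. LINT p:W|vol. co k p"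
  have eq: "indicator W p *\<^sub>R ((Kfun A \<Omega> (translate \<Omega> G t \<Phi>) p)\<^sup>2 - (Kfun A \<Omega> G p)\<^sup>2) =
      (\<Sum>k<6. t ^ Suc k *\<^sub>R (indicator W p *\<^sub>R co k p))" for t p
  proof (cases "p \<in> W")
    case True
    obtain c where "c \<in> A" "p \<in> fst c" using chart_at True W by blast
    then have "Kfun A \<Omega> (translate \<Omega> G t \<Phi>) p = a * f p + t * ?L p + t\<^sup>2 * ?M p + t ^ 3 * ?N p"
      using Kfun_variation(1)[OF W G \<Phi>, of c p t] True K by auto
    then show ?thesis using True K[OF True]
      by (simp add: co_def numeral_eq_Suc) (simp add: algebra_simps)
  qed simp
  have "(LINT p:W|vol. (Kfun A \<Omega> (translate \<Omega> G t \<Phi>) p)\<^sup>2 - (Kfun A \<Omega> G p)\<^sup>2) = (\<Sum>k<6. t ^ Suc k * ?I k)" for t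
    using co unfolding set_lebesgue_integral_def set_integrable_def eq
    by (subst Bochner_Integration.integral_sum) (auto simp: integrable_mult_right)
  moreover have "?I 0 = 0"
    using integral_dK[OF W G \<Phi> C supp f H] by (simp add: co_def)
  moreover have "((\<lambda>t. \<Sum>k<6. t ^ Suc k * ?I k) has_real_derivative ?I 0) (at 0)"
    by (auto intro!: derivative_eq_intros simp: numeral_eq_Suc)
  ultimately show "((\<lambda>t. LINT p:W|vol. (Kfun A \<Omega> (translate \<Omega> G t \<Phi>) p)\<^sup>2 - (Kfun A \<Omega> G p)\<^sup>2)
      has_real_derivative 0) (at 0)"
    by simp
qed

end

section \<open>The adjoint of \<open>\<H>\<close> at \<open>\<Gamma>\<close>\<close>

lemma (in symp_conn) smc_cov_ham:
  assumes "smc c W f"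
  shows "smc c W (\<lambda>p. cov G (ham \<Omega> f) c p [k] [j])"
  unfolding cov_1_0 sum_2 by (intro smc_simps smc_ham smc_G assms)

context killing_chart
begin

lemma Zd_cong:
  assumes "p \<in> fst c \<inter> Mhat" "\<And>q. q \<in> fst c \<inter> Mhat \<Longrightarrow> f q = g q"
  shows "Zd f p = Zd g p"
proof -
  have "pd c i f p = pd c i g p" for i by (rule h.cong_W[OF assms(1)]) (rule assms(2))
  then show ?thesis by (simp add: Zd_def)
qed

lemma Zd_rules:
  assumes p: "p \<in> fst c \<inter> Mhat" and f: "smc c Mhat f" and g: "smc c Mhat g"
  shows "Zd (\<lambda>q. f q + g q) p = Zd f p + Zd g p" "Zd (\<lambda>q. f q * g q) p = f p * Zd g p + Zd f p * g p"
    "Zd (\<lambda>q. a * f q) p = a * Zd f p" "Zd (\<lambda>q. - f q) p = - Zd f p"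
  using h.dif_smc[OF f p] h.dif_smc[OF g p] p
  by (simp_all add: Zd_def pd_ring_rules dif_rules algebra_simps)

lemma Zd_gamma: "p \<in> fst c \<Longrightarrow> Zd \<gamma> p = ((\<gamma> p)\<^sup>2 - \<nu> p) / 2"
  using nu_Zd[OF c_in] by (simp add: field_simps)

text \<open>As Z has divergence \<gamma>, this says that y Z is divergence-free.\<close>

lemma Zd_y: "p \<in> fst c \<inter> Mhat \<Longrightarrow> Zd y p = - \<gamma> p * y p"
proof -
  assume p: "p \<in> fst c \<inter> Mhat"
  have "Zd y p = 2 * \<gamma> p * y p * (y p * (inverse (w p) * (z 2 p * pd c 1 \<gamma> p - z 1 p * pd c 2 \<gamma> p)))"
    unfolding Zd_def pd_y[OF p] by (simp add: power2_eq_square algebra_simps)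
  then show ?thesis unfolding yB[OF p] by simp
qed

definition B :: "real \<Rightarrow> ('a \<Rightarrow> real) \<Rightarrow> 2 \<Rightarrow> 'a \<Rightarrow> real" where
  "B t f j p = (\<Sum>q\<in>UNIV. z q p * cov (nabla t) (ham \<Omega> f) c p [q] [j])"

text \<open>Leibniz rule for the pairing of Z with the Hamiltonian field, which is
  \<open>Zd f\<close>. The parameter t disappears because
  \<open>\<Gamma>\<^sub>j\<^sub>m\<^sup>q Z\<^sub>q = 0\<close>.\<close>

lemma B_eq:
  assumes p: "p \<in> fst c \<inter> Mhat" and f: "smc c Mhat f"
  shows "B t f j p = pd c j (Zd f) p - \<gamma> p / 2 * pd c j f p"
proof -
  note p' = Mhat_dom[OF p]
  have d: "dif c (pd c i f) p" for i by (rule h.dif_smc[OF smc_pd[OF open_Mhat f] p])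
  have h1: "pd c j (\<lambda>q. ham \<Omega> f c q [1] []) p = pd c j (\<lambda>q. - (inverse (w q) * pd c 2 f q)) p"
    by (rule h.cong_W[OF p]) (simp add: h.ham_eqs)
  have h2: "pd c j (\<lambda>q. ham \<Omega> f c q [2] []) p = pd c j (\<lambda>q. inverse (w q) * pd c 1 f q) p"
    by (rule h.cong_W[OF p]) (simp add: h.ham_eqs)
  show ?thesis
    using p p' w_nz'[OF p'(1)] exhaust_2[of j]
    unfolding B_def cov_1_0 sum_2 h1 h2 h.ham_eqs[OF p] h.translate_eq[OF p] P_Gam Zd_def[abs_def]
    by (elim disjE)
      (simp_all add: pd_ring_rules pd_inverse_w dif_rules difs d pd_z Omega_eqs G_sym_21 sum_2, simp_all add: field_simps)
qed

text \<open>Leibniz rule once more. The curvature term becomes the product of df and d\<gamma>,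
  since by \<open>riem_decomp\<close> it pairs the Ricci tensor with Z; the part of Ricci
  proportional to t Z Z drops out.\<close>

lemma lie_conn_Z:
  assumes p: "p \<in> fst c \<inter> Mhat" and f: "smc c Mhat f"
  shows "(\<Sum>q\<in>UNIV. z q p * lie_conn (nabla t) (ham \<Omega> f) c p i j q) =
    pd c i (B t f j) p - \<gamma> p / 2 * (\<Sum>m\<in>UNIV. \<Omega> c p [] [i, m] * cov (nabla t) (ham \<Omega> f) c p [m] [j])
    - (\<Sum>m\<in>UNIV. nabla t c p i j m * B t f m p) - 1 / 2 * pd c i f p * pd c j \<gamma> p"
proof -
  interpret n: symp_conn c Mhat \<Omega> "nabla t" by (rule h.conn_translate)
  note p' = Mhat_dom[OF p]
  have d: "dif c (\<lambda>q. cov (nabla t) (ham \<Omega> f) c q [k] [j]) p" for k j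
    by (rule h.dif_smc[OF n.smc_cov_ham[OF f] p])
  have dB: "pd c i (B t f j) p = (\<Sum>q\<in>UNIV. z q p * pd c i (\<lambda>r. cov (nabla t) (ham \<Omega> f) c r [q] [j]) p
      + pd c i (z q) p * cov (nabla t) (ham \<Omega> f) c p [q] [j])"
    unfolding B_def[abs_def] sum_2 using p'
    by (simp add: pd_ring_rules dif_rules difs d del: cov.simps)
  show ?thesis
    using w_nz'[OF p'(1)] exhaust_2[of i]
    unfolding lie_conn_def cov_1_1 dB B_def sum_2 n.riem_decomp[OF p] ricci_nabla[OF p] h.ham_eqs[OF p]
      h.translate_eq[OF p] P_Gam pd_z[OF p'(1)] pd_gamma[OF p'(1)]
    by (elim disjE) (simp_all add: Omega_eqs[OF p'(2)] G_sym_21[OF p'(2)] field_simps del: cov.simps)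
qed

text \<open>\<Gamma> is a cube of Z, so the contraction only sees \<H>(f) along Z. The result is a
  third-order ordinary differential expression in the derivation \<open>Zd\<close>, and it does not
  depend on t.\<close>

lemma contract_Gam_Hop:
  assumes p: "p \<in> fst c \<inter> Mhat" and f: "smc c Mhat f"
  shows "contract \<Omega> 3 Gam (Hop \<Omega> (nabla t) f) c p =
    - y p * (Zd (\<lambda>q. Zd (Zd f) q - \<gamma> q / 2 * Zd f q) p - \<gamma> p * (Zd (Zd f) p - \<gamma> p / 2 * Zd f p)
      - 1 / 2 * Zd \<gamma> p * Zd f p)"
proof -
  interpret n: symp_conn c Mhat \<Omega> "nabla t" by (rule h.conn_translate)
  note p' = Mhat_dom[OF p]
  let ?v = "inverse (w p)"
  let ?L = "\<lambda>i j. \<Sum>q\<in>UNIV. z q p * lie_conn (nabla t) (ham \<Omega> f) c p i j q"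
  have "contract \<Omega> 3 Gam (Hop \<Omega> (nabla t) f) c p =
    - y p * (?v * z 2 p * (?v * z 2 p * ?L 1 1 - ?v * z 1 p * ?L 1 2)
      - ?v * z 1 p * (?v * z 2 p * ?L 2 1 - ?v * z 1 p * ?L 2 2))"
    unfolding contract_3 raise_3 Hop_def sum_2 up_eqs[OF p'(2)] using w_nz'[OF p'(1)]
    by (simp add: Gam_def Omega_eqs[OF p'(2)]) (simp add: field_simps)
  moreover have "?v * z 2 p * (?v * z 2 p * ?L 1 1 - ?v * z 1 p * ?L 1 2)
      - ?v * z 1 p * (?v * z 2 p * ?L 2 1 - ?v * z 1 p * ?L 2 2) =
    Zd (\<lambda>q. inverse (w q) * (z 2 q * B t f 1 q - z 1 q * B t f 2 q)) p
      - \<gamma> p * (?v * (z 2 p * B t f 1 p - z 1 p * B t f 2 p)) - 1 / 2 * Zd \<gamma> p * Zd f p"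
  proof -
    have "smc c Mhat (B t f j)" for j
      unfolding B_def[abs_def] sum_2
      by (intro h.smc_simps n.smc_cov_ham f smc_mono[OF smc_z Mhat_M])
    then have dB: "dif c (B t f j) p" for j by (rule h.dif_smc[OF _ p])
    show ?thesis
      using p p' w_nz'[OF p'(1)]
      unfolding lie_conn_Z[OF p f] Zd_def sum_2 h.translate_eq[OF p] P_Gam
      by (simp add: pd_ring_rules pd_inverse_w dif_rules difs dB pd_z Omega_eqs G_sym_21 sum_2 del: cov.simps)
         (simp add: B_def sum_2 field_simps del: cov.simps)
  qed
  moreover have b: "inverse (w q) * (z 2 q * B t f 1 q - z 1 q * B t f 2 q) = Zd (Zd f) q - \<gamma> q / 2 * Zd f q"
    if "q \<in> fst c \<inter> Mhat" for q
    unfolding B_eq[OF that f] by (simp add: Zd_def[of "Zd f"] Zd_def[of f] algebra_simps)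
  moreover have "Zd (\<lambda>q. inverse (w q) * (z 2 q * B t f 1 q - z 1 q * B t f 2 q)) p =
      Zd (\<lambda>q. Zd (Zd f) q - \<gamma> q / 2 * Zd f q) p"
    by (rule Zd_cong[OF p b])
  ultimately show ?thesis using b[OF p] by simp
qed

end

section \<open>Divergences along Z and the adjoint of \<H> at \<Gamma>\<close>

context killing
begin

text \<open>\<open>Zd\<close> as an operator on functions on the surface, so that it can be iterated
  independently of charts.\<close>

definition Zop :: "('a \<Rightarrow> real) \<Rightarrow> 'a \<Rightarrow> real" where
  "Zop f = scalar A (\<lambda>c p. killing_chart.Zd \<Omega> Z c f p)"

lemma Zop_eq:
  assumes f: "smooth_fun A Mhat f" and c: "c \<in> A" "p \<in> fst c \<inter> Mhat"
  shows "Zop f p = killing_chart.Zd \<Omega> Z c f p"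
  unfolding Zop_def
proof (rule scalar_eqI[OF c(1)])
  show pc: "p \<in> fst c" using c(2) by blast
  fix d assume d: "d \<in> A" "p \<in> fst d"
  interpret d: chart d by (rule chart[OF d(1)])
  have "dif d f p" using d.smc_dif[OF smooth_funD[OF f d(1)] open_Mhat] c d by blast
  then show "killing_chart.Zd \<Omega> Z c f p = killing_chart.Zd \<Omega> Z d f p"
    by (rule Zd_transition[OF c(1) pc d])
qed

lemma smooth_Zop:
  assumes f: "smooth_fun A Mhat f"
  shows "smooth_fun A Mhat (Zop f)"
proof (rule smooth_funI)
  fix c assume c: "c \<in> A"
  interpret c: killing_chart M A \<Omega> D Z \<gamma> \<nu> Mhat c by (rule killing_chart[OF c])
  show "smc c Mhat (Zop f)"
    by (rule c.smc_cong[OF open_Mhat c.smc_Zd[OF open_Mhat Mhat_M smooth_funD[OF f c]]]) (rule Zop_eq[OF f c, symmetric])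
qed

lemma Zop_zero:
  assumes f: "smooth_fun A Mhat f" and U: "open U" "U \<subseteq> Mhat" "p \<in> U" and 0: "\<And>q. q \<in> U \<Longrightarrow> f q = 0"
  shows "Zop f p = 0"
proof -
  obtain c where c: "c \<in> A" "p \<in> fst c" using chart_at U Mhat_M by blast
  interpret c: killing_chart M A \<Omega> D Z \<gamma> \<nu> Mhat c by (rule killing_chart[OF c(1)])
  have pU: "p \<in> fst c \<inter> U" and pM: "p \<in> fst c \<inter> Mhat" using c U by blast+
  have "pd c i f p = pd c i (\<lambda>q. 0) p" for i by (rule c.pd_cong[OF U(1) pU]) (simp add: 0)
  then show ?thesis unfolding Zop_eq[OF f c(1) pM] c.Zd_def using c by (simp add: c.pd_const)
qed

lemma smooth_gamma_Mhat: "smooth_fun A Mhat \<gamma>"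
  by (rule smooth_fun_Int[OF open_Mhat Mhat_M smooth_gamma])

lemma smooth_nu_Mhat: "smooth_fun A Mhat \<nu>"
  by (rule smooth_fun_Int[OF open_Mhat Mhat_M smooth_nu])

abbreviation divZ where "divZ g p \<equiv> Zop g p + \<gamma> p * g p"

lemma smooth_divZ: "smooth_fun A Mhat g \<Longrightarrow> smooth_fun A Mhat (divZ g)"
  by (intro smooth_fun_add smooth_fun_mult open_Mhat smooth_Zop smooth_gamma_Mhat)

lemma integral_divZ_disc:
  assumes D: "disc Mhat c x0 r" and g: "smooth_fun A Mhat g"
    and supp: "\<And>p. p \<in> Mhat - chart_inv c ` cball x0 r \<Longrightarrow> g p = 0"
  shows "set_integrable vol Mhat (divZ g)" "(LINT p:Mhat|vol. divZ g p) = 0"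
proof -
  let ?K = "chart_inv c ` cball x0 r"
  have c: "c \<in> A" using D by (simp add: disc_def)
  interpret c: killing_chart M A \<Omega> D Z \<gamma> \<nu> Mhat c by (rule killing_chart[OF c])
  have U: "open (Mhat - ?K)" using open_Mhat compact_imp_closed[OF compact_disc[OF D]] by (rule open_Diff)
  have KW: "?K \<subseteq> Mhat" using disc_dom(2)[OF D] by blast
  have z: "divZ g p = 0" if "p \<in> Mhat - ?K" for p
    using Zop_zero[OF g U Diff_subset that supp] supp[OF that] by simp
  show "set_integrable vol Mhat (divZ g)"
    by (rule smooth_integrable[OF open_Mhat Mhat_M smooth_divZ[OF g] compact_disc[OF D] KW z])
  \<comment> \<open>These are the components of g Z multiplied by w, whose coordinate divergence is
    w times the covariant one.\<close>
  have s: "smc c Mhat (\<lambda>p. c.z 2 p * g p)" "smc c Mhat (\<lambda>p. - c.z 1 p * g p)"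
    by (intro c.h.smc_simps c.smc_mono[OF c.smc_z Mhat_M] smooth_funD[OF g c])+
  show "(LINT p:Mhat|vol. divZ g p) = 0"
  proof (rule disc_divergence[OF open_Mhat Mhat_M D smooth_continuous[OF open_Mhat c smooth_divZ[OF g]] _ s])
    show "divZ g p = 0" if "p \<in> Mhat" "p \<notin> ?K" for p using z that by blast
    show "c.z 2 p * g p = 0 \<and> - c.z 1 p * g p = 0" if "p \<in> fst c \<inter> Mhat" "p \<notin> ?K" for p
      using supp[of p] that by simp
    show "divZ g p * \<Omega> c p [] [1, 2] = pd c 1 (\<lambda>p. c.z 2 p * g p) p + pd c 2 (\<lambda>p. - c.z 1 p * g p) p"
      if p: "p \<in> fst c \<inter> Mhat" for p
    proof -
      note p' = c.Mhat_dom[OF p]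
      have d: "dif c g p" by (rule c.h.dif_smc[OF smooth_funD[OF g c] p])
      have "pd c 1 (\<lambda>p. c.z 2 p * g p) p + pd c 2 (\<lambda>p. - c.z 1 p * g p) p =
          (c.z 2 p * pd c 1 g p - c.z 1 p * pd c 2 g p) + (\<gamma> p * c.w p) * g p"
        unfolding c.gamma_w[OF p'(1)] curl_def using p'
        by (simp add: c.pd_ring_rules c.dif_rules c.difs d) (simp add: algebra_simps)
      moreover have "(inverse (c.w p) * x + \<gamma> p * g p) * c.w p = x + (\<gamma> p * c.w p) * g p" for x
        using c.w_nz'[OF p'(1)] by (simp add: field_simps)
      ultimately show ?thesis
        unfolding Zop_eq[OF g c p] c.Zd_def c.w_def[symmetric] by simp
    qed
  qed
qed

lemma integral_divZ:
  assumes g: "smooth_fun A Mhat g" and C: "compact C" "C \<subseteq> Mhat" and supp: "\<And>p. p \<in> Mhat - C \<Longrightarrow> g p = 0"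
  shows "(LINT p:Mhat|vol. divZ g p) = 0"
proof -
  obtain n c x0 r \<psi> where "subordinate_partition Mhat C n c x0 r \<psi>"
    by (rule partition_of_unity[OF open_Mhat Mhat_M C])
  note pou = subordinate_partitionD[OF this]
  define \<phi> where "\<phi> k p = \<psi> k p * g p" for k p
  have s: "smooth_fun A Mhat (\<phi> k)" if "k < n" for k
    unfolding \<phi>_def[abs_def]
    by (rule smooth_fun_mult[OF open_Mhat smooth_fun_Int[OF open_Mhat Mhat_M pou(2)[OF that]] g])
  have I: "set_integrable vol Mhat (divZ (\<phi> k))" "(LINT p:Mhat|vol. divZ (\<phi> k) p) = 0" if k: "k < n" for k
    by (rule integral_divZ_disc[OF pou(1)[OF k] s[OF k]]; simp add: \<phi>_def pou(3)[OF k])+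
  have g_sum: "g p = (\<Sum>k<n. \<phi> k p)" if "p \<in> Mhat" for p
    using pou(4)[of p] supp[of p] that unfolding \<phi>_def
    by (cases "p \<in> C") (simp_all add: sum_distrib_right[symmetric])
  have "divZ g p = (\<Sum>k<n. divZ (\<phi> k) p)" if p: "p \<in> Mhat" for p
  proof -
    obtain c where c: "c \<in> A" "p \<in> fst c" using chart_at p Mhat_M by blast
    have pM: "p \<in> fst c \<inter> Mhat" using c p by blast
    interpret c: killing_chart M A \<Omega> D Z \<gamma> \<nu> Mhat c by (rule killing_chart[OF c(1)])
    have d: "dif c (\<phi> k) p" if "k < n" for k by (rule c.h.dif_smc[OF smooth_funD[OF s[OF that] c(1)] pM])
    have "pd c i g p = pd c i (\<lambda>q. \<Sum>k<n. \<phi> k q) p" for i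
      by (rule c.h.cong_W[OF pM]) (simp add: g_sum)
    moreover have "pd c i (\<lambda>q. \<Sum>k<n. \<phi> k q) p = (\<Sum>k<n. pd c i (\<phi> k) p)" for i
      by (rule c.pd_sum[OF c(2)]) (simp add: d)
    ultimately have "pd c i g p = (\<Sum>k<n. pd c i (\<phi> k) p)" for i by simp
    then show ?thesis
      using g_sum[OF p] unfolding Zop_eq[OF g c(1) pM]
      by (simp add: Zop_eq[OF s c(1) pM] c.Zd_def sum.distrib sum_subtractf sum_distrib_left right_diff_distrib)
  qed
  then have eq: "indicator Mhat p *\<^sub>R divZ g p = (\<Sum>k<n. indicator Mhat p *\<^sub>R divZ (\<phi> k) p)" for p
    by (cases "p \<in> Mhat") simp_all
  have "(LINT p:Mhat|vol. divZ g p) = (\<Sum>k<n. LINT p:Mhat|vol. divZ (\<phi> k) p)"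
    using I(1) unfolding set_lebesgue_integral_def set_integrable_def eq
    by (subst Bochner_Integration.integral_sum) auto
  then show ?thesis using I(2) by simp
qed

text \<open>Here \<open>\<Gamma>\<^sup>i\<^sup>j\<^sup>k \<H>(f)\<^sub>i\<^sub>j\<^sub>k\<close> is written as a multiple of \<open>f\<close> plus the divergence
  \<open>\<nabla>\<^sub>p (g Z\<^sup>p) = Z\<^sup>p dg\<^sub>p + \<gamma> g\<close>.\<close>

definition potential :: "('a \<Rightarrow> real) \<Rightarrow> 'a \<Rightarrow> real" where
  "potential f p = y p * ((- 1) * Zop (Zop f) p + 3 / 2 * (\<gamma> p * Zop f p)
     + (1 / 4 * \<nu> p + (- 3 / 4) * (\<gamma> p * \<gamma> p)) * f p)"

lemma smooth_potential: "smooth_fun A Mhat f \<Longrightarrow> smooth_fun A Mhat (potential f)"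
  unfolding potential_def[abs_def]
  by (intro smooth_fun_add smooth_fun_mult open_Mhat smooth_Zop smooth_gamma_Mhat smooth_nu_Mhat smooth_fun_const smooth_y)

text \<open>Write \<open>potential f\<close> as y h. As y Z is divergence-free, the divergence of y
  h Z is y Z(h). The coefficients -1, 3/2 \<gamma> and \<nu>/4 - 3/4 \<gamma>^2 of h are found by
  matching the third, second and first derivatives of f in \<open>contract_Gam_Hop\<close>.
  Differentiating the last one leaves 3/4 \<gamma> f y (\<nu> - \<gamma>^2) = 3/4 \<gamma> f, which
  the explicit term compensates; this is the origin of the adjoint.\<close>

lemma contract_divZ:
  assumes f: "smooth_fun A Mhat f" and p: "p \<in> Mhat"
  shows "scalar A (contract \<Omega> 3 Gam (Hop \<Omega> (nabla t) f)) p = f p * (- (3 / 4) * \<gamma> p) + divZ (potential f) p"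
proof -
  obtain c where c: "c \<in> A" "p \<in> fst c"
    and sc: "scalar A (contract \<Omega> 3 Gam (Hop \<Omega> (nabla t) f)) p = contract \<Omega> 3 Gam (Hop \<Omega> (nabla t) f) c p"
    by (rule scalar_cases[of p]) (use p Mhat_M in blast)+
  have pM: "p \<in> fst c \<inter> Mhat" using c p by blast
  interpret c: killing_chart M A \<Omega> D Z \<gamma> \<nu> Mhat c by (rule killing_chart[OF c(1)])
  note sf = smooth_funD[OF f c(1)] and sZ = smooth_funD[OF smooth_Zop[OF f] c(1)]
    and sZZ = smooth_funD[OF smooth_Zop[OF smooth_Zop[OF f]] c(1)]
    and sg = smooth_funD[OF smooth_gamma_Mhat c(1)] and sn = smooth_funD[OF smooth_nu_Mhat c(1)]
    and sy = smooth_funD[OF smooth_y c(1)]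
  have Z1: "c.Zd f q = Zop f q" and Z2: "c.Zd (Zop f) q = Zop (Zop f) q" if "q \<in> fst c \<inter> Mhat" for q
    using Zop_eq[OF f c(1) that] Zop_eq[OF smooth_Zop[OF f] c(1) that] by simp_all
  have Z11: "c.Zd (c.Zd f) q = Zop (Zop f) q" if "q \<in> fst c \<inter> Mhat" for q
    using c.Zd_cong[OF that Z1] Z2[OF that] by simp
  have Z3: "c.Zd (\<lambda>q. c.Zd (c.Zd f) q - \<gamma> q / 2 * c.Zd f q) p = c.Zd (\<lambda>q. Zop (Zop f) q + (- 1 / 2) * (\<gamma> q * Zop f q)) p"
    by (rule c.Zd_cong[OF pM]) (simp add: Z11 Z1)
  note sr = c.smc_add[OF open_Mhat] c.smc_mult[OF open_Mhat] c.smc_const sf sZ sZZ sg sn sy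
  have Znu: "c.Zd \<nu> p = 0" unfolding c.Zd_def using c.pd_nu[OF c(2)] by simp
  have Zconst: "c.Zd (\<lambda>q. a) p = 0" for a unfolding c.Zd_def using c(2) by (simp add: c.pd_const)
  note R = c.Zd_rules(1)[OF pM] c.Zd_rules(2)[OF pM] Zconst
  have E1: "c.Zd (\<lambda>q. Zop (Zop f) q + (- 1 / 2) * (\<gamma> q * Zop f q)) p =
      c.Zd (Zop (Zop f)) p - 1 / 2 * (\<gamma> p * Zop (Zop f) p + c.Zd \<gamma> p * Zop f p)"
    by (simp only: R sr Z2[OF pM]; simp add: algebra_simps)
  have E2: "c.Zd (potential f) p = - \<gamma> p * potential f p
     + y p * (- c.Zd (Zop (Zop f)) p + 3 / 2 * (\<gamma> p * Zop (Zop f) p + c.Zd \<gamma> p * Zop f p)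
       + (1 / 4 * \<nu> p + (- 3 / 4) * (\<gamma> p * \<gamma> p)) * Zop f p + (- 3 / 4) * (2 * \<gamma> p * c.Zd \<gamma> p) * f p)"
  proof -
    let ?a = "\<lambda>q. (1 / 4 * \<nu> q + (- 3 / 4) * (\<gamma> q * \<gamma> q)) * f q"
    let ?b = "\<lambda>q. (- 1) * Zop (Zop f) q + 3 / 2 * (\<gamma> q * Zop f q)"
    have sa: "smc c Mhat ?a" "smc c Mhat ?b" "smc c Mhat (\<lambda>q. ?b q + ?a q)" by (intro sr)+
    have a: "c.Zd ?a p = (1 / 4 * \<nu> p + (- 3 / 4) * (\<gamma> p * \<gamma> p)) * Zop f p + (- 3 / 4) * (2 * \<gamma> p * c.Zd \<gamma> p) * f p"
      by (simp only: R sr Z1[OF pM] Znu; simp add: algebra_simps)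
    have b: "c.Zd ?b p = - c.Zd (Zop (Zop f)) p + 3 / 2 * (\<gamma> p * Zop (Zop f) p + c.Zd \<gamma> p * Zop f p)"
      by (simp only: R sr Z2[OF pM]; simp add: algebra_simps)
    have "c.Zd (potential f) p = y p * (c.Zd ?b p + c.Zd ?a p) + c.Zd y p * (?b p + ?a p)"
      unfolding potential_def[abs_def] R(2)[OF sy sa(3)] R(1)[OF sa(2,1)] ..
    then show ?thesis unfolding a b c.Zd_y[OF pM] potential_def by (simp add: algebra_simps)
  qed
  have Zg: "c.Zd \<gamma> p = - 1 / 2 * (\<nu> p - (\<gamma> p)\<^sup>2)" unfolding c.Zd_gamma[OF c(2)] by (simp add: field_simps)
  have "f p * (- (3 / 4) * \<gamma> p) + divZ (potential f) p =
      - (3 / 4) * \<gamma> p * f p + y p * (- c.Zd (Zop (Zop f)) p + 3 / 2 * (\<gamma> p * Zop (Zop f) p + c.Zd \<gamma> p * Zop f p)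
       + (1 / 4 * \<nu> p + (- 3 / 4) * (\<gamma> p * \<gamma> p)) * Zop f p) + 3 / 4 * \<gamma> p * f p * (y p * (\<nu> p - (\<gamma> p)\<^sup>2))"
    unfolding Zop_eq[OF smooth_potential[OF f] c(1) pM] E2 Zg by (simp add: algebra_simps)
  also have "\<dots> = contract \<Omega> 3 Gam (Hop \<Omega> (nabla t) f) c p"
    unfolding c.contract_Gam_Hop[OF pM sf] Z3 E1 Z11[OF pM] Z1[OF pM] y_u[OF p] Zg
    by (simp add: power2_eq_square algebra_simps)
  finally show ?thesis unfolding sc ..
qed

text \<open>- 3/4 \<gamma> satisfies the defining property of the adjoint because divergences
  integrate to zero; hence the chosen function satisfies it too, and the two agree on Mhat by
  \<open>smooth_fun_eq_if_integrals_eq\<close>.\<close>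

lemma Hadj_Gam:
  assumes p: "p \<in> Mhat"
  shows "Hadj A \<Omega> Mhat (nabla t) Gam p = - (3 / 4) * \<gamma> p"
proof -
  let ?h = "\<lambda>p. - (3 / 4) * \<gamma> p"
  let ?spec = "\<lambda>h. smooth_fun A Mhat h \<and> (\<forall>f. smooth_fun A Mhat f \<and> compactly_supported_fun Mhat f \<longrightarrow>
        (LINT p:Mhat|vol. f p * h p) =
        (LINT p:Mhat|vol. scalar A (contract \<Omega> 3 Gam (Hop \<Omega> (nabla t) f)) p))"
  have sh: "smooth_fun A Mhat ?h"
    by (intro smooth_fun_mult smooth_fun_const open_Mhat smooth_gamma_Mhat)
  have h: "?spec ?h"
  proof (intro conjI allI impI sh, elim conjE)
    fix f assume f: "smooth_fun A Mhat f" and "compactly_supported_fun Mhat f"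
    then obtain C where C: "compact C" "C \<subseteq> Mhat" and f0: "\<forall>p\<in>Mhat - C. f p = 0"
      unfolding compactly_supported_fun_def by blast
    have U: "open (Mhat - C)" using open_Mhat compact_imp_closed[OF C(1)] by (rule open_Diff)
    have z: "f p = 0" "Zop f p = 0" if "p \<in> Mhat - C" for p
      using f0 that Zop_zero[OF f U Diff_subset that] by simp_all
    have z2: "Zop (Zop f) p = 0" if "p \<in> Mhat - C" for p
      by (rule Zop_zero[OF smooth_Zop[OF f] U Diff_subset that z(2)])
    have g0: "potential f p = 0" if "p \<in> Mhat - C" for p
      unfolding potential_def z[OF that] z2[OF that] by simp
    have "divZ (potential f) p = 0" if "p \<in> Mhat - C" for p
      using Zop_zero[OF smooth_potential[OF f] U Diff_subset that g0] g0[OF that] by simp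
    then have i2: "set_integrable vol Mhat (divZ (potential f))"
      by (rule smooth_integrable[OF open_Mhat Mhat_M smooth_divZ[OF smooth_potential[OF f]] C])
    have i1: "set_integrable vol Mhat (\<lambda>p. f p * ?h p)"
      by (rule smooth_integrable[OF open_Mhat Mhat_M smooth_fun_mult[OF open_Mhat f sh] C]) (simp add: z)
    have "(LINT p:Mhat|vol. scalar A (contract \<Omega> 3 Gam (Hop \<Omega> (nabla t) f)) p) =
        (LINT p:Mhat|vol. f p * ?h p + divZ (potential f) p)"
      unfolding set_lebesgue_integral_def
      by (rule Bochner_Integration.integral_cong) (auto simp: contract_divZ[OF f] indicator_def)
    also have "\<dots> = (LINT p:Mhat|vol. f p * ?h p)"
      using set_integral_add(2)[OF i1 i2] integral_divZ[OF smooth_potential[OF f] C g0] by simp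
    finally show "(LINT p:Mhat|vol. f p * ?h p) = (LINT p:Mhat|vol. scalar A (contract \<Omega> 3 Gam (Hop \<Omega> (nabla t) f)) p)" ..
  qed
  then have H: "?spec (Hadj A \<Omega> Mhat (nabla t) Gam)"
    unfolding Hadj_def by (rule someI[of ?spec ?h])
  show ?thesis
  proof (rule smooth_fun_eq_if_integrals_eq[OF open_Mhat Mhat_M conjunct1[OF H] sh _ p])
    fix f assume f: "smooth_fun A Mhat f" "compactly_supported_fun Mhat f"
    show "(LINT p:Mhat|vol. f p * Hadj A \<Omega> Mhat (nabla t) Gam p) = (LINT p:Mhat|vol. f p * ?h p)"
      using conjunct2[OF H, rule_format, OF conjI[OF f]] conjunct2[OF h, rule_format, OF conjI[OF f]]
      by (rule trans[OF _ sym])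
  qed
qed

lemma critical_nabla: "critical A \<Omega> Mhat (nabla t)"
proof (rule critical_if_Hop_eq_0[OF open_Mhat Mhat_M conn_nabla smooth_gamma_Mhat])
  show "Kfun A \<Omega> (nabla t) p = (- (3 / 4) * t) * \<gamma> p" if "p \<in> Mhat" for p by (rule K_nabla[OF that])
  show "lie_conn (nabla t) (ham \<Omega> \<gamma>) c p i j k = 0" if "c \<in> A" "p \<in> fst c \<inter> Mhat" for c p i j k
    by (rule killing_chart.lie_conn_gamma[OF killing_chart[OF that(1)] that(2)])
qed

end

section \<open>The Jacobi operator at \<Gamma>\<close>

context killing_chart
begin

lemma lie_conn_cmult_gamma:
  assumes f: "\<And>q. q \<in> fst c \<inter> Mhat \<Longrightarrow> f q = a * \<gamma> q" and p: "p \<in> fst c \<inter> Mhat"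
  shows "lie_conn (nabla t) (ham \<Omega> f) c p i j k = 0"
proof -
  interpret n: symp_conn c Mhat \<Omega> "nabla t" by (rule h.conn_translate)
  have h1: "ham \<Omega> f c q [k] [] = a * ham \<Omega> \<gamma> c q [k] []" if "q \<in> fst c \<inter> Mhat" for q k
    by (rule pd_cmult_ham(1)[OF _ that]) (rule f)
  have h2: "pd c j (\<lambda>q. ham \<Omega> f c q [k] []) q = a * pd c j (\<lambda>q. ham \<Omega> \<gamma> c q [k] []) q" if "q \<in> fst c \<inter> Mhat" for q j k
    by (rule pd_cmult_ham(2)[OF _ that]) (rule f)
  have c1: "cov (nabla t) (ham \<Omega> f) c q [k] [j] = a * cov (nabla t) (ham \<Omega> \<gamma>) c q [k] [j]"
    if "q \<in> fst c \<inter> Mhat" for q k j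
    unfolding cov_1_0 sum_2 h1[OF that] h2[OF that] by (simp add: algebra_simps)
  have "pd c i (\<lambda>q. cov (nabla t) (ham \<Omega> f) c q [k] [j]) p = pd c i (\<lambda>q. a * cov (nabla t) (ham \<Omega> \<gamma>) c q [k] [j]) p" for k i j
    by (rule h.cong_W[OF p]) (rule c1)
  moreover have "dif c (\<lambda>q. cov (nabla t) (ham \<Omega> \<gamma>) c q [k] [j]) p" for k j
    by (rule h.dif_smc[OF n.smc_cov_ham[OF smooth_funD[OF smooth_gamma_Mhat c_in]] p])
  ultimately have c2: "pd c i (\<lambda>q. cov (nabla t) (ham \<Omega> f) c q [k] [j]) p = a * pd c i (\<lambda>q. cov (nabla t) (ham \<Omega> \<gamma>) c q [k] [j]) p" for k i j
    using p by (simp add: pd_ring_rules dif_rules del: cov.simps)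
  have "lie_conn (nabla t) (ham \<Omega> f) c p i j k = a * lie_conn (nabla t) (ham \<Omega> \<gamma>) c p i j k"
    unfolding lie_conn_def cov_1_1 sum_2 c1[OF p] c2 h1[OF p] by (simp add: algebra_simps del: cov.simps)
  then show ?thesis by (simp add: lie_conn_gamma[OF p])
qed

lemma jacobi_op_Gam:
  assumes p: "p \<in> fst c \<inter> Mhat"
  shows "jacobi_op A \<Omega> Mhat (nabla t) Gam c p [] [i, j, k] = 0"
proof -
  have "lie_conn (nabla t) (ham \<Omega> (Hadj A \<Omega> Mhat (nabla t) Gam)) c p i j q = 0" for q
    by (rule lie_conn_cmult_gamma[where a = "- (3 / 4)", OF _ p]) (simp add: Hadj_Gam)
  moreover have "lie_deriv (ham \<Omega> (Kfun A \<Omega> (nabla t))) Gam c p [] [i, j, k] = 0"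
    by (rule lie_deriv_Gam[where a = "- (3 / 4) * t", OF _ p]) (simp add: K_nabla)
  ultimately show ?thesis unfolding jacobi_op_def Hop_def by simp
qed

end

theorem theorem7p1:
  fixes M :: "'a::{t2_space,second_countable_topology} set"
    and A :: "'a chart set"
    and \<Omega> Z \<Gamma> Q :: "'a tensor"
    and D :: "'a connection"
    and \<gamma> \<nu> :: "'a \<Rightarrow> real"
    and Mhat :: "'a set"
    and nabla :: "real \<Rightarrow> 'a connection"
  assumes "smooth_surface M A" and "connected M"
    and "symplectic_form A M \<Omega>"
    and "symplectic_connection A \<Omega> M D" and "parallel_ricci A M D"
    and "tensor_field A M 0 1 Z"
    and "\<exists>c\<in>A. \<exists>p\<in>fst c. \<exists>i. Z c p [] [i] \<noteq> 0"
    and "\<forall>c\<in>A. \<forall>p\<in>fst c. \<forall>i j. symmetrize (cov D Z) c p [] [i, j] = 0"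
    and "\<gamma> = scalar A (\<lambda>c p. \<Sum>q\<in>UNIV. cov D (raise \<Omega> Z) c p [q] [q])"
    and "\<nu> = (\<lambda>p. (\<gamma> p)\<^sup>2 + 4 * scalar A (\<lambda>c p. \<Sum>a\<in>UNIV. \<Sum>b\<in>UNIV.
               raise \<Omega> Z c p [a] [] * raise \<Omega> Z c p [b] [] * ricci D c p [] [a, b]) p)"
    and "Mhat = {p\<in>M. (\<gamma> p)\<^sup>2 \<noteq> \<nu> p}"
    and "\<Gamma> = (\<lambda>c p us ls. inverse (\<nu> p - (\<gamma> p)\<^sup>2) *
               Z c p [] [ls ! 0] * Z c p [] [ls ! 1] * Z c p [] [ls ! 2])"
    and "nabla = (\<lambda>t. translate \<Omega> D t \<Gamma>)"
    and "Q = symmetrize (\<lambda>c p us ls. Z c p [] [ls ! 0] * Z c p [] [ls ! 1] *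
               (\<Sum>q\<in>UNIV. ricci D c p [] [ls ! 2, q] * raise \<Omega> Z c p [q] []))"
  shows "\<nu> constant_on M \<and>
    sym3_field A Mhat \<Gamma> \<and>
    (\<forall>t. symplectic_connection A \<Omega> Mhat (nabla t) \<and>
      (\<forall>c\<in>A. \<forall>p\<in>fst c \<inter> Mhat. \<forall>i j.
         ricci (nabla t) c p [] [i, j] =
           ricci D c p [] [i, j] +
           t * \<gamma> p * inverse (\<nu> p - (\<gamma> p)\<^sup>2) * Z c p [] [i] * Z c p [] [j]) \<and>
      (\<forall>c\<in>A. \<forall>p\<in>fst c \<inter> Mhat. \<forall>i j k.
         symmetrize (cov (nabla t) (ricci (nabla t))) c p [] [i, j, k] =
           - 4 * t * \<nu> p * (inverse (\<nu> p - (\<gamma> p)\<^sup>2))\<^sup>2 * Q c p [] [i, j, k]) \<and>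
      (\<forall>c\<in>A. \<forall>p\<in>fst c \<inter> Mhat. \<forall>i.
         rho \<Omega> (nabla t) c p [] [i] =
           1 / 2 * t * (\<nu> p - 3 * (\<gamma> p)\<^sup>2) * inverse (\<nu> p - (\<gamma> p)\<^sup>2) * Z c p [] [i]) \<and>
      (\<forall>p\<in>Mhat. Kfun A \<Omega> (nabla t) p = - (3 / 4) * t * \<gamma> p) \<and>
      (\<forall>p\<in>Mhat. tau A \<Omega> (nabla t) p = 3 / 16 * t\<^sup>2 * \<nu> p) \<and>
      (\<forall>c\<in>A. \<forall>p\<in>fst c \<inter> Mhat. \<forall>i j k. Hop \<Omega> (nabla t) \<gamma> c p [] [i, j, k] = 0) \<and>
      critical A \<Omega> Mhat (nabla t)) \<and>
    ((\<exists>c\<in>A. \<exists>p\<in>fst c \<inter> Mhat. \<exists>i j k.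
        4 * \<nu> p * (inverse (\<nu> p - (\<gamma> p)\<^sup>2))\<^sup>2 * Q c p [] [i, j, k] \<noteq> 0) \<longrightarrow>
      (\<forall>t. t \<noteq> 0 \<longrightarrow> \<not> preferred A Mhat (nabla t))) \<and>
    (\<forall>t. \<forall>c\<in>A. \<forall>p\<in>fst c \<inter> Mhat. \<forall>i j k.
       jacobi_op A \<Omega> Mhat (nabla t) \<Gamma> c p [] [i, j, k] = 0)"
proof -
  interpret surface M A by (rule surface.intro) (rule assms)
  interpret killing M A \<Omega> D Z \<gamma> \<nu> Mhat
    by (intro killing.intro killing_axioms.intro symp_surface.intro symp_surface_axioms.intro surface_axioms assms)
  have Gam: "\<Gamma> = Gam" unfolding assms(12) Gam_def[abs_def] y_def ..
  have nabla: "nabla t = translate \<Omega> D t Gam" for t unfolding assms(13) Gam ..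
  note y = y_def[symmetric]
  have S: "symmetrize (cov (nabla t) (ricci (nabla t))) c p [] [i, j, k] =
      - 4 * t * \<nu> p * (inverse (\<nu> p - (\<gamma> p)\<^sup>2))\<^sup>2 * Q c p [] [i, j, k]"
    if "c \<in> A" "p \<in> fst c \<inter> Mhat" for t c p i j k
    unfolding nabla y assms(14)
    by (rule killing_chart.symmetrize_cov_ricci_nabla[OF killing_chart[OF that(1)] that(2)])
  show ?thesis
    unfolding Gam
  proof (intro conjI allI impI ballI)
    show "\<nu> constant_on M" by (rule nu_constant)
    show "sym3_field A Mhat Gam" by (rule sym3_Gam)
    fix t
    show "symplectic_connection A \<Omega> Mhat (nabla t)" unfolding nabla by (rule conn_nabla)
    show "critical A \<Omega> Mhat (nabla t)" unfolding nabla by (rule critical_nabla)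
    show "Kfun A \<Omega> (nabla t) p = - (3 / 4) * t * \<gamma> p" if "p \<in> Mhat" for p
      unfolding nabla by (rule K_nabla[OF that])
    show "tau A \<Omega> (nabla t) p = 3 / 16 * t\<^sup>2 * \<nu> p" if "p \<in> Mhat" for p
      unfolding nabla by (rule tau_nabla[OF that])
    fix c p i j k assume c: "c \<in> A" and p: "p \<in> fst c \<inter> Mhat"
    interpret c: killing_chart M A \<Omega> D Z \<gamma> \<nu> Mhat c by (rule killing_chart[OF c])
    show "ricci (nabla t) c p [] [i, j] = ricci D c p [] [i, j] +
           t * \<gamma> p * inverse (\<nu> p - (\<gamma> p)\<^sup>2) * Z c p [] [i] * Z c p [] [j]"
      unfolding nabla y by (rule c.ricci_nabla[OF p])
    show "symmetrize (cov (nabla t) (ricci (nabla t))) c p [] [i, j, k] =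
      - 4 * t * \<nu> p * (inverse (\<nu> p - (\<gamma> p)\<^sup>2))\<^sup>2 * Q c p [] [i, j, k]" by (rule S[OF c p])
    show "rho \<Omega> (nabla t) c p [] [i] =
           1 / 2 * t * (\<nu> p - 3 * (\<gamma> p)\<^sup>2) * inverse (\<nu> p - (\<gamma> p)\<^sup>2) * Z c p [] [i]"
      unfolding nabla y by (rule c.rho_nabla[OF p])
    show "Hop \<Omega> (nabla t) \<gamma> c p [] [i, j, k] = 0" unfolding nabla by (rule c.Hop_gamma[OF p])
    show "jacobi_op A \<Omega> Mhat (nabla t) Gam c p [] [i, j, k] = 0" unfolding nabla by (rule c.jacobi_op_Gam[OF p])
  next
    fix t :: real assume "t \<noteq> 0"
    assume "\<exists>c\<in>A. \<exists>p\<in>fst c \<inter> Mhat. \<exists>i j k. 4 * \<nu> p * (inverse (\<nu> p - (\<gamma> p)\<^sup>2))\<^sup>2 * Q c p [] [i, j, k] \<noteq> 0"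
    then obtain c p i j k where c: "c \<in> A" "p \<in> fst c \<inter> Mhat"
      and "4 * \<nu> p * (inverse (\<nu> p - (\<gamma> p)\<^sup>2))\<^sup>2 * Q c p [] [i, j, k] \<noteq> 0" by blast
    with \<open>t \<noteq> 0\<close> have "symmetrize (cov (nabla t) (ricci (nabla t))) c p [] [i, j, k] \<noteq> 0"
      unfolding S[OF c] by simp
    with c show "\<not> preferred A Mhat (nabla t)" unfolding preferred_def by blast
  qed
qed

end
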